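(* Let $G$ be an abelian group such that $|G|<2^{\omega_1}$. Then $G$ admits a minimal pseudocompact group topology if and only if $G$ admits a compact metric group topology.
   Context: All group topologies are assumed Hausdorff. A Hausdorff group topology $\tau$ on a group $G$ is minimal if every Hausdorff group topology $\tau'\subseteq\tau$ on $G$ satisfies $\tau'=\tau$. A topological group is pseudocompact if every continuous real-valued function on it is bounded. A "minimal pseudocompact group topology" is a single group topology that is both minimal and pseudocompact; a "compact metric group topology" is a group topology that is compact and metrizable. *)

theory Defs
  imports "HOL-Analysis.Analysis" "HOL-Algebra.Group"
begin

unbundle cardinal_syntax

text \<open>All group topologies are Hausdorff by convention.\<close>

definition group_topology :: "('a, 'b) monoid_scheme \<Rightarrow> 'a topology \<Rightarrow> bool" where
  "group_topology G T \<longleftrightarrow>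
     topspace T = carrier G \<and>
     continuous_map (prod_topology T T) T (\<lambda>(x, y). x \<otimes>\<^bsub>G\<^esub> y) \<and>
     continuous_map T T (\<lambda>x. inv\<^bsub>G\<^esub> x) \<and>
     Hausdorff_space T"

definition minimal_group_topology :: "('a, 'b) monoid_scheme \<Rightarrow> 'a topology \<Rightarrow> bool" where
  "minimal_group_topology G T \<longleftrightarrow>
     group_topology G T \<and>
     (\<forall>T'. group_topology G T' \<and> {U. openin T' U} \<subseteq> {U. openin T U} \<longrightarrow> T' = T)"

definition pseudocompact_space :: "'a topology \<Rightarrow> bool" where
  "pseudocompact_space T \<longleftrightarrow>
     (\<forall>f :: 'a \<Rightarrow> real. continuous_map T euclideanreal f \<longrightarrow> bounded (f ` topspace T))"

text \<open>The exponent \<open>cardSuc natLeq\<close> is the cardinal successor of \<open>\<omega>\<close>, that is \<open>\<omega>\<^sub>1\<close>.\<close>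

abbreviation two_to_omega1 :: "(nat set \<Rightarrow> bool) rel" where
  "two_to_omega1 \<equiv> ctwo ^c cardSuc natLeq"

end

theory Submission
  imports Defs "HOL-Algebra.Free_Abelian_Groups" "HOL-Number_Theory.Cong"
begin

text \<open>
  Let \<open>T\<close> be minimal and pseudocompact and let \<open>X\<close> be the group of continuous characters of \<open>(G, T)\<close>.
  Pseudocompactness makes every continuous pseudonorm totally bounded, and the Peter--Weyl argument (an
  eigenfunction of a convolution operator, then an extremal positive definite eigenfunction) shows that
  \<open>X\<close> separates points. By minimality, a subgroup \<open>Y\<close> of \<open>X\<close> that separates points induces \<open>T\<close>, and
  the characters that are continuous for the topology induced by \<open>Y\<close> belong to \<open>Y\<close>; so every proper subgroup
  of \<open>X\<close> vanishes at some \<open>g \<noteq> 1\<close>.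

  If \<open>X\<close> is countable, then \<open>T\<close> is metrizable, hence compact. If \<open>X\<close> is uncountable, then for some prime
  \<open>p\<close> it has at least \<open>2\<^sup>\<omega>\<^sup>1\<close> homomorphisms \<open>h\<close> into the Pruefer group of \<open>p\<close>. The kernel of a nontrivial \<open>h\<close>
  vanishes at some \<open>g \<noteq> 1\<close>, so evaluation at \<open>g\<close> factors through \<open>h\<close>. There are at most continuum many
  factorizations, the fibres of this assignment are small, and \<open>G\<close> has at least continuum many elements;
  so \<open>G\<close> has at least \<open>2\<^sup>\<omega>\<^sup>1\<close> elements.

  Characters are handled on a free abelian group that maps onto \<open>G\<close> (or \<open>X\<close>), so that the analysis takes place
  on a type of class \<open>ab_group_add\<close> with a pseudonorm that need not be a norm.
\<close>

section \<open>Invariant means on precompact groups\<close>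

text \<open>The analysis runs on a group that carries only a totally bounded pseudonorm: it need be
  neither Hausdorff nor complete, so no Haar measure and no \<open>L\<^sup>2\<close> completion is
  at hand. The integral is replaced by von Neumann's mean, obtained from averages over finite lists
  of translates, and every limit of functions is taken uniformly, after an equation or a convolution
  has made them equicontinuous.

  The counting rests on the shape of the Pruefer group. It is divisible, so a partial homomorphism
  extends; it is countable, so a factorization is a subset of a countable set; its proper subgroups
  are finite, so two homomorphisms with the same code differ by one of bounded exponent. For the
  whole circle the last two points would fail. Behind this stands the known criterion for
  minimality: a nontrivial closed subgroup of the compact group Hom(\<open>X\<close>, circle) must
  meet the image of \<open>G\<close> nontrivially. Here it is applied, in terms of kernels, to the
  closed subgroup generated by \<open>h\<close>.\<close>

definition avg :: "'g::ab_group_add list \<Rightarrow> ('g \<Rightarrow> 'b::real_vector) \<Rightarrow> 'g \<Rightarrow> 'b" where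
  "avg L f y = (\<Sum>x\<leftarrow>L. f (x + y)) /\<^sub>R real (length L)"

text \<open>The mean of an almost periodic function in von Neumann's sense: one average must be
  close to the constant at all points \<open>y\<close> at once. A list may repeat a translation, as
  compositions of averages do.\<close>

definition has_mean :: "('g::ab_group_add \<Rightarrow> 'b::real_normed_vector) \<Rightarrow> 'b \<Rightarrow> bool" where
  "has_mean f m \<longleftrightarrow> (\<forall>e>0. \<exists>L. L \<noteq> [] \<and> (\<forall>y. norm (avg L f y - m) \<le> e))"

lemma sum_list_swap:
  "(\<Sum>x\<leftarrow>L. \<Sum>y\<leftarrow>K. f x y) = (\<Sum>y\<leftarrow>K. \<Sum>x\<leftarrow>L. (f x y :: 'b::comm_monoid_add))"
  by (induction L) (simp_all add: sum_list_addf)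

lemma sum_list_scaleR: "(\<Sum>x\<leftarrow>L. c *\<^sub>R f x) = c *\<^sub>R (\<Sum>x\<leftarrow>L. f x :: 'b::real_vector)"
  by (induction L) (simp_all add: scaleR_add_right)

text \<open>Translations of an abelian group commute. All comparisons of two averages below go
  through this common composition.\<close>

lemma avg_commute: "avg L (avg K f) = avg K (avg L f)"
proof
  fix z
  have "(\<Sum>x\<leftarrow>L. \<Sum>y\<leftarrow>K. f (y + (x + z))) = (\<Sum>y\<leftarrow>K. \<Sum>x\<leftarrow>L. f (x + (y + z)))"
    by (subst sum_list_swap) (simp add: add.left_commute)
  then show "avg L (avg K f) z = avg K (avg L f) z"
    by (simp add: avg_def[abs_def] sum_list_scaleR mult.commute)
qed

lemma avg_avg: "avg L (avg K f) = avg (concat (map (\<lambda>x. map (\<lambda>y. y + x) K) L)) f"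
proof
  fix z
  have "(\<Sum>x\<leftarrow>concat (map (\<lambda>x. map (\<lambda>y. y + x) K) L). f (x + z)) = (\<Sum>x\<leftarrow>L. \<Sum>y\<leftarrow>K. f (y + (x + z)))"
    by (induction L) (simp_all add: o_def add.assoc)
  moreover have "length (concat (map (\<lambda>x. map (\<lambda>y. y + x) K) L)) = length L * length K"
    by (induction L) simp_all
  ultimately show "avg L (avg K f) z = avg (concat (map (\<lambda>x. map (\<lambda>y. y + x) K) L)) f z"
    by (simp add: avg_def[abs_def] sum_list_scaleR)
qed

text \<open>The list \<open>P\<close> does not depend on \<open>f\<close>; simultaneous
  approximation of several means relies on that.\<close>

lemma ex_avg_avg:
  assumes "L \<noteq> []" "K \<noteq> []"
  shows "\<exists>P. P \<noteq> [] \<and> (\<forall>f::'g::ab_group_add \<Rightarrow> 'b::real_vector. avg L (avg K f) = avg P f)"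
proof (intro exI conjI allI)
  show "concat (map (\<lambda>x. map (\<lambda>y. y + x) K) L) \<noteq> []"
    using assms by (cases L; cases K) auto
qed (rule avg_avg)

lemma avg_const: "L \<noteq> [] \<Longrightarrow> avg L (\<lambda>_. c) y = c"
proof -
  have "(\<Sum>x\<leftarrow>L. c) = real (length L) *\<^sub>R c"
    by (induction L) (simp_all add: algebra_simps)
  then show "L \<noteq> [] \<Longrightarrow> avg L (\<lambda>_. c) y = c" by (simp add: avg_def)
qed

lemma avg_add: "avg L (\<lambda>x. f x + g x) y = avg L f y + avg L g y"
  by (simp add: avg_def sum_list_addf scaleR_add_right)

lemma avg_diff: "avg L (\<lambda>x. f x - g x) y = avg L f y - avg L g y"
  by (simp add: avg_def sum_list_subtractf scaleR_diff_right)

lemma avg_shift: "avg L (\<lambda>x. f (x + a)) y = avg L f (y + a)"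
  by (simp add: avg_def add.assoc)

lemma avg_bounded_linear:
  assumes "bounded_linear h"
  shows "h (avg L f y) = avg L (\<lambda>x. h (f x)) y"
proof -
  interpret bounded_linear h by fact
  have "h (\<Sum>x\<leftarrow>L. f (x + y)) = (\<Sum>x\<leftarrow>L. h (f (x + y)))"
    by (induction L) (simp_all add: add zero)
  then show ?thesis by (simp add: avg_def scaleR)
qed

lemma norm_avg_le:
  fixes f :: "'g::ab_group_add \<Rightarrow> 'b::real_normed_vector"
  assumes "L \<noteq> []" "\<And>x. norm (f x) \<le> B"
  shows "norm (avg L f y) \<le> B"
proof -
  have "norm (\<Sum>x\<leftarrow>L. f (x + y)) \<le> (\<Sum>x\<leftarrow>L. B)"
  proof (induction L)
    case (Cons a L)
    then show ?case using norm_triangle_mono[OF assms(2) Cons] by simp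
  qed simp
  then show ?thesis using assms(1)
    by (simp add: avg_def sum_list_triv field_simps)
qed

lemma avg_mono:
  fixes f :: "'g::ab_group_add \<Rightarrow> real"
  assumes "\<And>x. f x \<le> g x"
  shows "avg L f y \<le> avg L g y"
  unfolding avg_def
  by (rule scaleR_left_mono) (use assms in \<open>auto intro: sum_list_mono\<close>)

lemma avg_le: "L \<noteq> [] \<Longrightarrow> (\<And>x. f x \<le> B) \<Longrightarrow> avg L f y \<le> (B::real)"
  using avg_mono[of f "\<lambda>_. B" L y] by (simp add: avg_const)

lemma avg_ge: "L \<noteq> [] \<Longrightarrow> (\<And>x. B \<le> f x) \<Longrightarrow> (B::real) \<le> avg L f y"
  using avg_mono[of "\<lambda>_. B" f L y] by (simp add: avg_const)

lemma norm_avg_diff_le: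
  assumes "L \<noteq> []" "\<And>y. norm (f y - m) \<le> e"
  shows "norm (avg L f y - m) \<le> (e::real)"
  using norm_avg_le[of L "\<lambda>x. f x - m" e y] assms by (simp add: avg_diff avg_const)

text \<open>Averaging again does not move a function away from a constant to which it is uniformly
  close. So the composition of a good average for \<open>m\<close> with a good one for
  \<open>n\<close> is close to both.\<close>

lemma has_mean_unique:
  assumes "has_mean f m" "has_mean f n"
  shows "m = n"
proof (rule ccontr)
  assume "m \<noteq> n"
  then have e: "norm (m - n) / 3 > 0" by simp
  obtain L where L: "L \<noteq> []" "\<And>y. norm (avg L f y - m) \<le> norm (m - n) / 3"
    using assms(1) e unfolding has_mean_def by blast
  obtain K where K: "K \<noteq> []" "\<And>y. norm (avg K f y - n) \<le> norm (m - n) / 3"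
    using assms(2) e unfolding has_mean_def by blast
  have "norm (avg K (avg L f) 0 - m) \<le> norm (m - n) / 3"
    by (rule norm_avg_diff_le[OF K(1) L(2)])
  moreover have "norm (avg K (avg L f) 0 - n) \<le> norm (m - n) / 3"
    unfolding avg_commute[of K] by (rule norm_avg_diff_le[OF L(1) K(2)])
  moreover have "norm (m - n) \<le> norm (avg K (avg L f) 0 - n) + norm (avg K (avg L f) 0 - m)"
    using norm_triangle_ineq4[of "avg K (avg L f) 0 - n" "avg K (avg L f) 0 - m"] by simp
  ultimately show False using e by linarith
qed

text \<open>Lists that are good for single functions are composed. A further average preserves the
  estimates already reached, and by commutation each factor may be viewed as the inner one.\<close>

lemma has_mean_uniform:
  fixes f :: "'i \<Rightarrow> 'g::ab_group_add \<Rightarrow> 'b::real_normed_vector"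
  assumes "finite I" "\<And>i. i \<in> I \<Longrightarrow> has_mean (f i) (m i)" "e > 0"
  shows "\<exists>L. L \<noteq> [] \<and> (\<forall>i\<in>I. \<forall>y. norm (avg L (f i) y - m i) \<le> e)"
  using assms
proof (induction I)
  case empty
  show ?case by (rule exI[of _ "[0]"]) simp
next
  case (insert i I)
  then obtain L where L: "L \<noteq> []" "\<And>i y. i \<in> I \<Longrightarrow> norm (avg L (f i) y - m i) \<le> e"
    by auto
  obtain K where K: "K \<noteq> []" "\<And>y. norm (avg K (f i) y - m i) \<le> e"
    using insert.prems unfolding has_mean_def by blast
  obtain P where P: "P \<noteq> []" "\<And>f::'g \<Rightarrow> 'b. avg L (avg K f) = avg P f"
    using ex_avg_avg[OF L(1) K(1)] by blast
  have "norm (avg P (f j) y - m j) \<le> e" if "j \<in> insert i I" for j y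
  proof (cases "j = i")
    case True
    then show ?thesis unfolding P(2)[symmetric]
      by (auto intro!: norm_avg_diff_le[OF L(1)] K(2))
  next
    case False
    with that have "j \<in> I" by simp
    then show ?thesis unfolding P(2)[symmetric] avg_commute[of L]
      by (auto intro!: norm_avg_diff_le[OF K(1)] L(2))
  qed
  with P(1) show ?case by blast
qed

lemma has_mean_const: "has_mean (\<lambda>_. c) c"
  unfolding has_mean_def by (intro allI impI exI[of _ "[0]"]) (simp add: avg_const)

lemma has_mean_add:
  assumes "has_mean f m" "has_mean g n"
  shows "has_mean (\<lambda>x. f x + g x) (m + n)"
  unfolding has_mean_def
proof (intro allI impI)
  fix e :: real assume "e > 0"
  then have "\<exists>L. L \<noteq> [] \<and> (\<forall>i\<in>UNIV. \<forall>y. norm (avg L (if i then f else g) y - (if i then m else n)) \<le> e / 2)"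
    by (intro has_mean_uniform) (use assms in auto)
  then obtain L where L: "L \<noteq> []"
    "\<And>i y. norm (avg L (if i then f else g) y - (if i then m else n)) \<le> e / 2"
    by blast
  have "norm (avg L (\<lambda>x. f x + g x) y - (m + n)) \<le> e" for y
    using L(2)[of True y] L(2)[of False y] norm_triangle_ineq[of "avg L f y - m" "avg L g y - n"]
    by (simp add: avg_add algebra_simps)
  with L(1) show "\<exists>L. L \<noteq> [] \<and> (\<forall>y. norm (avg L (\<lambda>x. f x + g x) y - (m + n)) \<le> e)" by blast
qed

lemma has_mean_bounded_linear:
  assumes "bounded_linear h" "has_mean f m"
  shows "has_mean (\<lambda>x. h (f x)) (h m)"
  unfolding has_mean_def
proof (intro allI impI)
  interpret bounded_linear h by fact
  fix e :: real assume e: "e > 0"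
  obtain B where B: "B > 0" "\<And>x. norm (h x) \<le> norm x * B" using pos_bounded by blast
  have "e / B > 0" using e B(1) by simp
  then obtain L where L: "L \<noteq> []" "\<And>y. norm (avg L f y - m) \<le> e / B"
    using assms(2) unfolding has_mean_def by blast
  have "norm (avg L (\<lambda>x. h (f x)) y - h m) \<le> e" for y
  proof -
    have "norm (avg L (\<lambda>x. h (f x)) y - h m) = norm (h (avg L f y - m))"
      by (simp add: avg_bounded_linear[OF assms(1)] diff)
    also have "\<dots> \<le> norm (avg L f y - m) * B" by (rule B)
    also have "\<dots> \<le> e / B * B" by (rule mult_right_mono[OF L(2)]) (use B in simp)
    finally show ?thesis using B by simp
  qed
  with L(1) show "\<exists>L. L \<noteq> [] \<and> (\<forall>y. norm (avg L (\<lambda>x. h (f x)) y - h m) \<le> e)" by blast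
qed

lemma has_mean_shift:
  assumes "has_mean f m"
  shows "has_mean (\<lambda>x. f (x + a)) m"
  using assms unfolding has_mean_def avg_shift by meson

lemma has_mean_norm_le:
  assumes "has_mean f m" "\<And>x. norm (f x) \<le> B"
  shows "norm m \<le> B"
proof (rule field_le_epsilon)
  fix e :: real assume "e > 0"
  then obtain L where L: "L \<noteq> []" "\<And>y. norm (avg L f y - m) \<le> e"
    using assms(1) unfolding has_mean_def by blast
  have "norm (avg L f 0) \<le> B" by (rule norm_avg_le[OF L(1) assms(2)])
  then show "norm m \<le> B + e"
    using norm_triangle_ineq3[of "avg L f 0" m] L(2)[of 0] by linarith
qed

lemma has_mean_ge:
  assumes "has_mean f m" "\<And>x. (B::real) \<le> f x"
  shows "B \<le> m"
proof (rule field_le_epsilon)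
  fix e :: real assume "e > 0"
  then obtain L where L: "L \<noteq> []" "\<And>y. norm (avg L f y - m) \<le> e"
    using assms(1) unfolding has_mean_def by blast
  show "B \<le> m + e"
    using avg_ge[OF L(1), of B f 0] assms(2) L(2)[of 0] by (simp add: abs_le_iff)
qed

text \<open>It is enough to bound one average from below; \<open>f\<close> itself may be small at
  many points. This is how a function that is large only on a ball gets a positive mean.\<close>

lemma has_mean_avg_ge:
  assumes "has_mean f m" "L \<noteq> []" "\<And>x. (B::real) \<le> avg L f x"
  shows "B \<le> m"
proof (rule field_le_epsilon)
  fix e :: real assume "e > 0"
  then obtain K where K: "K \<noteq> []" "\<And>y. norm (avg K f y - m) \<le> e"
    using assms(1) unfolding has_mean_def by blast
  have "norm (avg L (avg K f) 0 - m) \<le> e" by (rule norm_avg_diff_le[OF assms(2) K(2)])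
  moreover have "B \<le> avg L (avg K f) 0"
    unfolding avg_commute[of L] by (rule avg_ge[OF K(1) assms(3)])
  ultimately show "B \<le> m + e" by (simp add: abs_le_iff)
qed

section \<open>Uniformly continuous functions for a totally bounded pseudonorm, and their invariant
  mean\<close>

locale bounded_pseudonorm =
  fixes N :: "'g::ab_group_add \<Rightarrow> real"
  assumes zero [simp]: "N 0 = 0" and minus [simp]: "N (- x) = N x"
    and triangle: "N (x + y) \<le> N x + N y"
    and totally_bounded: "e > 0 \<Longrightarrow> \<exists>F. finite F \<and> (\<forall>x. \<exists>y\<in>F. N (x - y) < e)"
begin

text \<open>Total boundedness means that the group modulo \<open>N x = 0\<close> has a compact
  completion. With real or complex values, the functions \<open>uc\<close> are the restrictions of
  the continuous functions on it; hence they are bounded and closed under products.\<close>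

definition uc :: "('g \<Rightarrow> 'b::real_normed_vector) \<Rightarrow> bool" where
  "uc f \<longleftrightarrow> (\<forall>e>0. \<exists>d>0. \<forall>x y. N (x - y) < d \<longrightarrow> norm (f x - f y) < e)"

lemma nonneg: "0 \<le> N x"
  using triangle[of x "- x"] by simp

lemma commute: "N (x - y) = N (y - x)"
  using minus[of "x - y"] by (simp del: minus)

lemma net:
  assumes "e > 0"
  obtains L where "L \<noteq> []" "\<And>x. \<exists>y\<in>set L. N (x - y) < e"
proof -
  obtain F where F: "finite F" "\<And>x. \<exists>y\<in>F. N (x - y) < e" using totally_bounded[OF assms] by blast
  obtain L where "set L = F" using finite_list[OF F(1)] by blast
  with F show thesis by (intro that[of L]) auto
qed

lemma ucD:
  assumes "uc f" "e > 0"
  obtains d where "d > 0" "\<And>x y. N (x - y) < d \<Longrightarrow> norm (f x - f y) < e"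
  using assms unfolding uc_def by blast

lemma uc_bounded:
  assumes "uc f"
  obtains B where "B > 0" "\<And>x. norm (f x) \<le> B"
proof -
  obtain d where d: "d > 0" "\<And>x y. N (x - y) < d \<Longrightarrow> norm (f x - f y) < 1"
    using ucD[OF assms, of 1] by auto
  obtain F where F: "finite F" "\<And>x. \<exists>y\<in>F. N (x - y) < d" using totally_bounded[OF d(1)] by blast
  define B where "B = 1 + (\<Sum>y\<in>F. norm (f y))"
  have "norm (f x) \<le> B" for x
  proof -
    obtain y where y: "y \<in> F" "N (x - y) < d" using F by blast
    have "norm (f x) \<le> norm (f x - f y) + norm (f y)" by (metis norm_triangle_sub add.commute)
    moreover have "norm (f y) \<le> (\<Sum>y\<in>F. norm (f y))"
      by (rule member_le_sum[OF y(1)]) (use F in auto)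
    ultimately show ?thesis using d(2)[OF y(2)] unfolding B_def by linarith
  qed
  moreover have "B > 0" unfolding B_def by (simp add: add_pos_nonneg sum_nonneg)
  ultimately show thesis using that by blast
qed

lemma uc_const [simp, intro]: "uc (\<lambda>_. c)"
  unfolding uc_def by (auto intro: exI[of _ 1])

lemma uc_bounded_linear:
  assumes "bounded_linear h" "uc f"
  shows "uc (\<lambda>x. h (f x))"
  unfolding uc_def
proof (intro allI impI)
  interpret bounded_linear h by fact
  fix e :: real assume e: "e > 0"
  obtain B where B: "B > 0" "\<And>x. norm (h x) \<le> norm x * B" using pos_bounded by blast
  obtain d where d: "d > 0" "\<And>x y. N (x - y) < d \<Longrightarrow> norm (f x - f y) < e / B"
    using ucD[OF assms(2), of "e / B"] e B by auto
  have "norm (h (f x) - h (f y)) < e" if "N (x - y) < d" for x y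
  proof -
    have "norm (h (f x) - h (f y)) \<le> norm (f x - f y) * B" using B(2)[of "f x - f y"] by (simp add: diff)
    also have "\<dots> < e / B * B" by (rule mult_strict_right_mono[OF d(2)[OF that] B(1)])
    finally show ?thesis using B by simp
  qed
  with d(1) show "\<exists>d>0. \<forall>x y. N (x - y) < d \<longrightarrow> norm (h (f x) - h (f y)) < e" by blast
qed

lemma uc_add [intro]:
  assumes "uc f" "uc g"
  shows "uc (\<lambda>x. f x + g x)"
  unfolding uc_def
proof (intro allI impI)
  fix e :: real assume e: "e > 0"
  obtain d where d: "d > 0" "\<And>x y. N (x - y) < d \<Longrightarrow> norm (f x - f y) < e / 2"
    using ucD[OF assms(1), of "e / 2"] e by auto
  obtain d' where d': "d' > 0" "\<And>x y. N (x - y) < d' \<Longrightarrow> norm (g x - g y) < e / 2"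
    using ucD[OF assms(2), of "e / 2"] e by auto
  have "norm ((f x + g x) - (f y + g y)) < e" if "N (x - y) < min d d'" for x y
    using norm_triangle_ineq[of "f x - f y" "g x - g y"] d(2)[of x y] d'(2)[of x y] that
    by (simp add: algebra_simps)
  moreover have "min d d' > 0" using d d' by simp
  ultimately show "\<exists>d>0. \<forall>x y. N (x - y) < d \<longrightarrow> norm ((f x + g x) - (f y + g y)) < e" by blast
qed

lemma uc_mult [intro]:
  fixes f g :: "'g \<Rightarrow> 'b::real_normed_algebra"
  assumes "uc f" "uc g"
  shows "uc (\<lambda>x. f x * g x)"
  unfolding uc_def
proof (intro allI impI)
  fix e :: real assume e: "e > 0"
  obtain A where A: "A > 0" "\<And>x. norm (f x) \<le> A" using uc_bounded[OF assms(1)] by blast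
  obtain B where B: "B > 0" "\<And>x. norm (g x) \<le> B" using uc_bounded[OF assms(2)] by blast
  obtain d where d: "d > 0" "\<And>x y. N (x - y) < d \<Longrightarrow> norm (f x - f y) < e / (2 * B)"
    using ucD[OF assms(1), of "e / (2 * B)"] e B by auto
  obtain d' where d': "d' > 0" "\<And>x y. N (x - y) < d' \<Longrightarrow> norm (g x - g y) < e / (2 * A)"
    using ucD[OF assms(2), of "e / (2 * A)"] e A by auto
  have "norm (f x * g x - f y * g y) < e" if "N (x - y) < min d d'" for x y
  proof -
    have 1: "norm (f x - f y) < e / (2 * B)" "norm (g x - g y) < e / (2 * A)"
      using that d(2)[of x y] d'(2)[of x y] by auto
    have "f x * g x - f y * g y = (f x - f y) * g x + f y * (g x - g y)" by (simp add: algebra_simps)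
    then have "norm (f x * g x - f y * g y) \<le> norm (f x - f y) * norm (g x) + norm (f y) * norm (g x - g y)"
      by (metis add_mono_thms_linordered_semiring(1) norm_mult_ineq norm_triangle_mono)
    also have "\<dots> \<le> norm (f x - f y) * B + A * norm (g x - g y)"
      by (intro add_mono mult_left_mono mult_right_mono A B) auto
    also have "\<dots> < e / (2 * B) * B + A * (e / (2 * A))"
      by (intro add_strict_mono mult_strict_right_mono mult_strict_left_mono 1 A B)
    finally show ?thesis using A B by simp
  qed
  moreover have "min d d' > 0" using d d' by simp
  ultimately show "\<exists>d>0. \<forall>x y. N (x - y) < d \<longrightarrow> norm (f x * g x - f y * g y) < e" by blast
qed

lemma uc_isometry:
  assumes "uc f" "\<And>x y. N (h x - h y) = N (x - y)"
  shows "uc (\<lambda>x. f (h x))"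
  unfolding uc_def
proof (intro allI impI)
  fix e :: real assume "e > 0"
  then obtain d where "d > 0" "\<And>x y. N (x - y) < d \<Longrightarrow> norm (f x - f y) < e"
    using ucD[OF assms(1)] by blast
  then show "\<exists>d>0. \<forall>x y. N (x - y) < d \<longrightarrow> norm (f (h x) - f (h y)) < e"
    using assms(2) by (intro exI[of _ d]) simp
qed

lemma uc_shift [intro]:
  assumes "uc f"
  shows "uc (\<lambda>x. f (x + a))" "uc (\<lambda>x. f (a + x))" "uc (\<lambda>x. f (x - a))" "uc (\<lambda>x. f (a - x))"
proof -
  have "N ((a - x) - (a - y)) = N (x - y)" for x y using commute[of x y] by simp
  then show "uc (\<lambda>x. f (a - x))" by (rule uc_isometry[OF assms])
qed (rule uc_isometry[OF assms], simp)+

lemma uc_uminus [intro]: "uc f \<Longrightarrow> uc (\<lambda>x. - f x)"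
  by (rule uc_bounded_linear[OF bounded_linear_minus[OF bounded_linear_ident]])

lemma uc_diff [intro]: "uc f \<Longrightarrow> uc g \<Longrightarrow> uc (\<lambda>x. f x - g x)"
  using uc_add[of f "\<lambda>x. - g x"] uc_uminus[of g] by simp

lemma uc_cnj [intro]: "uc f \<Longrightarrow> uc (\<lambda>x. cnj (f x))"
  by (rule uc_bounded_linear[OF bounded_linear_cnj])

lemma uc_Re [intro]: "uc f \<Longrightarrow> uc (\<lambda>x. Re (f x))"
  by (rule uc_bounded_linear[OF bounded_linear_Re])

lemma uc_Im [intro]: "uc f \<Longrightarrow> uc (\<lambda>x. Im (f x))"
  by (rule uc_bounded_linear[OF bounded_linear_Im])

lemma uc_of_real [intro]: "uc f \<Longrightarrow> uc (\<lambda>x. complex_of_real (f x))"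
  by (rule uc_bounded_linear[OF bounded_linear_of_real])

lemma uc_sum_list [intro]: "(\<And>x. x \<in> set L \<Longrightarrow> uc (f x)) \<Longrightarrow> uc (\<lambda>y. \<Sum>x\<leftarrow>L. f x y)"
  by (induction L) auto

text \<open>\<open>Q\<close> collects the oscillation bounds of averages of \<open>f\<close>; its
  infimum \<open>c\<close> is zero. If \<open>c\<close> were positive, an average \<open>g\<close>
  with nearly minimal oscillation would still fall well below its upper bound near some
  \<open>z\<close>. Averaging \<open>g\<close> over a net puts a point near \<open>z\<close> into
  every sum, so the upper bound drops by a fixed amount while the lower bound stays.\<close>

lemma has_mean_real_exists:
  fixes f :: "'g \<Rightarrow> real"
  assumes f: "uc f"
  shows "\<exists>m. has_mean f m"
proof -
  define Q where "Q = {t. \<exists>L a. L \<noteq> [] \<and> (\<forall>y. a \<le> avg L f y \<and> avg L f y \<le> a + t)}"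
  have Q_nonneg: "0 \<le> t" if "t \<in> Q" for t
    using that unfolding Q_def by (auto dest: spec[of _ 0])
  obtain B where B: "B > 0" "\<And>x. norm (f x) \<le> B" using uc_bounded[OF f] by blast
  have "avg [0] f y = f y" for y by (simp add: avg_def)
  then have "2 * B \<in> Q" unfolding Q_def using B(2)
    by (auto intro!: exI[of _ "[0]"] exI[of _ "-B"] simp: abs_le_iff minus_le_iff)
  then have Q_ne: "Q \<noteq> {}" by blast
  have bdd: "bdd_below Q" unfolding bdd_below_def using Q_nonneg by blast
  define c where "c = Inf Q"
  have c_le: "c \<le> t" if "t \<in> Q" for t unfolding c_def by (rule cInf_lower[OF that bdd])
  have c_nonneg: "0 \<le> c" unfolding c_def by (rule cInf_greatest[OF Q_ne Q_nonneg])
  have "c = 0"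
  proof (rule ccontr)
    assume "c \<noteq> 0"
    with c_nonneg have c: "c > 0" by simp
    \<comment> \<open>Every average of \<open>f\<close> inherits the modulus \<open>d\<close>. So
      the net and its size \<open>k\<close> are fixed here, before an average with oscillation close
      to \<open>c\<close> is chosen.\<close>
    obtain d where d: "d > 0" "\<And>x y. N (x - y) < d \<Longrightarrow> norm (f x - f y) < c / 4"
      using ucD[OF f, of "c/4"] c by auto
    obtain F where F: "F \<noteq> []" "\<And>x. \<exists>y\<in>set F. N (x - y) < d" using net[OF d(1)] by blast
    define k where "k = real (length F)"
    have k: "k \<ge> 1" unfolding k_def using F(1) by (cases F) auto
    \<comment> \<open>The net average gains at least \<open>c / (2 * k)\<close>; an excess of
      \<open>c / (4 * k)\<close> over the infimum is therefore already contradictory.\<close>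
    have "c < c * (1 + 1 / (4 * k))" using c k by (simp add: field_simps)
    then obtain t where t: "t \<in> Q" "t < c * (1 + 1 / (4 * k))"
      using cInf_lessD[OF Q_ne] unfolding c_def by blast
    obtain L a where L: "L \<noteq> []" "\<And>y. a \<le> avg L f y" "\<And>y. avg L f y \<le> a + t"
      using t(1) unfolding Q_def by blast
    define g where "g = avg L f"
    have g_mod: "\<bar>g x - g y\<bar> \<le> c / 4" if "N (x - y) < d" for x y
    proof -
      have "norm (avg L (\<lambda>z. f (z + x) - f (z + y)) 0) \<le> c / 4"
        by (rule norm_avg_le[OF L(1)]) (use d(2)[of "_ + x" "_ + y"] that in \<open>auto intro: less_imp_le\<close>)
      then show ?thesis by (simp add: avg_diff avg_shift g_def)
    qed
    \<comment> \<open>Otherwise \<open>a\<close> could be raised by \<open>c / 4\<close>, and the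
      oscillation bound \<open>t - c / 4\<close> would lie below \<open>c\<close>.\<close>
    have "\<exists>z. g z < a + c / 4"
    proof (rule ccontr)
      assume "\<not> (\<exists>z. g z < a + c / 4)"
      then have "\<forall>y. a + c / 4 \<le> avg L f y \<and> avg L f y \<le> (a + c / 4) + (t - c / 4)"
        using L(3) unfolding g_def by (auto simp: not_less)
      then have "t - c / 4 \<in> Q" unfolding Q_def using L(1) by blast
      then have "c \<le> t - c / 4" by (rule c_le)
      moreover have "c * (1 + 1 / (4 * k)) \<le> c + c / 4" using c k by (simp add: field_simps)
      ultimately show False using t(2) by linarith
    qed
    then obtain z where z: "g z < a + c / 4" by blast
    have upper: "avg F g y \<le> a + t - (t - c / 2) / k" for y
    proof -
      obtain x where x: "x \<in> set F" "N (z - y - x) < d" using F(2) by blast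
      have gx: "g (x + y) \<le> a + c / 2"
      proof -
        have "N (z - (x + y)) < d" using x(2) by (simp add: algebra_simps)
        from g_mod[OF this] z show ?thesis by linarith
      qed
      obtain F1 F2 where F12: "F = F1 @ x # F2" using split_list[OF x(1)] by blast
      have le: "(\<Sum>x\<leftarrow>K. g (x + y)) \<le> real (length K) * (a + t)" for K
        using sum_list_mono[of K "\<lambda>x. g (x + y)" "\<lambda>_. a + t"] L(3) unfolding g_def
        by (simp add: sum_list_triv)
      have "(\<Sum>x\<leftarrow>F. g (x + y)) \<le> real (length F1) * (a + t) + (a + c / 2) + real (length F2) * (a + t)"
        using le[of F1] le[of F2] gx by (simp add: F12)
      also have "\<dots> = k * (a + t) - (t - c / 2)" by (simp add: k_def F12 algebra_simps)
      finally have "(\<Sum>x\<leftarrow>F. g (x + y)) / k \<le> (k * (a + t) - (t - c / 2)) / k"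
        using k by (intro divide_right_mono) auto
      moreover have "avg F g y = (\<Sum>x\<leftarrow>F. g (x + y)) / k"
        by (simp add: avg_def k_def divide_inverse mult.commute)
      moreover have "(k * (a + t) - (t - c / 2)) / k = a + t - (t - c / 2) / k"
        using k by (simp add: diff_divide_distrib)
      ultimately show ?thesis by simp
    qed
    have lower: "a \<le> avg F g y" for y by (rule avg_ge[OF F(1)]) (use L(2) in \<open>simp add: g_def\<close>)
    obtain P where P: "P \<noteq> []" "\<And>f::'g \<Rightarrow> real. avg F (avg L f) = avg P f"
      using ex_avg_avg[OF F(1) L(1)] by blast
    have "t - (t - c / 2) / k \<in> Q"
      unfolding Q_def using P upper lower unfolding g_def
      by (auto intro!: exI[of _ P] exI[of _ a] simp: add_diff_eq)
    then have "c \<le> t - (t - c / 2) / k" by (rule c_le)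
    moreover have "(c / 2) / k \<le> (t - c / 2) / k"
      using c_le[OF t(1)] k by (intro divide_right_mono) auto
    moreover have "c * (1 + 1 / (4 * k)) < c + (c / 2) / k" using c k by (simp add: field_simps)
    ultimately show False using t(2) by linarith
  qed
  \<comment> \<open>Lower bounds of averages. By commutation each of them is at most every upper
    bound of an average, so \<open>Sup A\<close> lies between the bounds of every average.\<close>
  define A where "A = {a. \<exists>L. L \<noteq> [] \<and> (\<forall>y. a \<le> avg L f y)}"
  have A_le: "a' \<le> a + t" if L: "L \<noteq> []" "\<And>y. avg L f y \<le> a + t" and "a' \<in> A" for L a t a'
  proof -
    obtain K where K: "K \<noteq> []" "\<And>y. a' \<le> avg K f y" using \<open>a' \<in> A\<close> unfolding A_def by blast
    have "a' \<le> avg L (avg K f) 0" by (rule avg_ge[OF L(1) K(2)])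
    also have "\<dots> \<le> a + t" unfolding avg_commute[of L] by (rule avg_le[OF K(1) L(2)])
    finally show ?thesis .
  qed
  have "has_mean f (Sup A)"
    unfolding has_mean_def
  proof (intro allI impI)
    fix e :: real assume "e > 0"
    then have "Inf Q < e" using \<open>c = 0\<close> unfolding c_def by simp
    then obtain t where "t \<in> Q" "t < e" using cInf_lessD[OF Q_ne] by blast
    then obtain L a where L: "L \<noteq> []" "\<And>y. a \<le> avg L f y" "\<And>y. avg L f y \<le> a + t"
      unfolding Q_def by blast
    have a: "a \<in> A" unfolding A_def using L by blast
    have "bdd_above A" unfolding bdd_above_def using A_le[OF L(1) L(3)] by blast
    then have "a \<le> Sup A" using a by (auto intro: cSup_upper)
    moreover have "Sup A \<le> a + t" by (rule cSup_least) (use a A_le[OF L(1) L(3)] in auto)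
    ultimately have "norm (avg L f y - Sup A) \<le> e" for y
      using L(2)[of y] L(3)[of y] \<open>t < e\<close> by (simp add: abs_le_iff)
    with L(1) show "\<exists>L. L \<noteq> [] \<and> (\<forall>y. norm (avg L f y - Sup A) \<le> e)" by blast
  qed
  then show ?thesis by blast
qed

definition mean :: "('g \<Rightarrow> complex) \<Rightarrow> complex" where
  "mean f = (THE m. has_mean f m)"

lemma mean_eqI: "has_mean f m \<Longrightarrow> mean f = m"
  unfolding mean_def by (rule the_equality) (auto intro: has_mean_unique)

lemma has_mean_mean:
  assumes "uc f"
  shows "has_mean f (mean f)"
proof -
  obtain a where a: "has_mean (\<lambda>x. Re (f x)) a" using has_mean_real_exists[OF uc_Re[OF assms]] by blast
  obtain b where b: "has_mean (\<lambda>x. Im (f x)) b" using has_mean_real_exists[OF uc_Im[OF assms]] by blast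
  have "has_mean (\<lambda>x. of_real (Re (f x)) + \<i> * of_real (Im (f x))) (of_real a + \<i> * of_real b)"
    by (intro has_mean_add has_mean_bounded_linear[OF bounded_linear_of_real a]
        has_mean_bounded_linear[of "\<lambda>x. \<i> * of_real x", OF _ b]
        bounded_linear_const_mult bounded_linear_of_real)
  then have "has_mean f (of_real a + \<i> * of_real b)" by (simp flip: complex_eq)
  then show ?thesis using mean_eqI by metis
qed

lemma mean_const [simp]: "mean (\<lambda>_. c) = c"
  by (rule mean_eqI[OF has_mean_const])

lemma mean_add: "uc f \<Longrightarrow> uc g \<Longrightarrow> mean (\<lambda>x. f x + g x) = mean f + mean g"
  by (intro mean_eqI has_mean_add has_mean_mean)

lemma mean_cmult: "uc f \<Longrightarrow> mean (\<lambda>x. c * f x) = c * mean f"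
  by (intro mean_eqI has_mean_bounded_linear[of "\<lambda>x. c * x"] has_mean_mean bounded_linear_mult_right)

lemma mean_diff: "uc f \<Longrightarrow> uc g \<Longrightarrow> mean (\<lambda>x. f x - g x) = mean f - mean g"
  using mean_add[of f "\<lambda>x. (-1) * g x"] mean_cmult[of g "-1"] by (auto simp: uc_uminus)

lemma mean_cnj: "uc f \<Longrightarrow> mean (\<lambda>x. cnj (f x)) = cnj (mean f)"
  by (intro mean_eqI has_mean_bounded_linear[of cnj] has_mean_mean bounded_linear_cnj)

lemma mean_shift: "uc f \<Longrightarrow> mean (\<lambda>x. f (x + a)) = mean f"
  by (intro mean_eqI has_mean_shift has_mean_mean)

lemma mean_sum_list:
  "(\<And>x. x \<in> set L \<Longrightarrow> uc (f x)) \<Longrightarrow> mean (\<lambda>y. \<Sum>x\<leftarrow>L. f x y) = (\<Sum>x\<leftarrow>L. mean (f x))"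
  by (induction L) (simp_all add: mean_add uc_sum_list)

lemma norm_mean_le: "uc f \<Longrightarrow> (\<And>x. norm (f x) \<le> B) \<Longrightarrow> norm (mean f) \<le> B"
  by (rule has_mean_norm_le[OF has_mean_mean])

lemma Re_mean_ge: "uc f \<Longrightarrow> (\<And>x. B \<le> Re (f x)) \<Longrightarrow> B \<le> Re (mean f)"
  by (rule has_mean_ge[OF has_mean_bounded_linear[OF bounded_linear_Re has_mean_mean]])

lemma Re_mean_mono: "uc f \<Longrightarrow> uc g \<Longrightarrow> (\<And>x. Re (f x) \<le> Re (g x)) \<Longrightarrow> Re (mean f) \<le> Re (mean g)"
  using Re_mean_ge[of "\<lambda>x. g x - f x" 0] by (auto simp: mean_diff uc_diff)

lemma norm_mean_diff_le:
  "uc f \<Longrightarrow> uc g \<Longrightarrow> (\<And>x. norm (f x - g x) \<le> B) \<Longrightarrow> norm (mean f - mean g) \<le> B"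
  using norm_mean_le[of "\<lambda>x. f x - g x" B] by (auto simp: mean_diff)

text \<open>Finitely many translates of the ball cover the group.\<close>

lemma mean_pos_of_ball:
  assumes "d > 0"
  obtains k where "k > 0"
    "\<And>f c. uc f \<Longrightarrow> (\<And>x. 0 \<le> Re (f x)) \<Longrightarrow> (\<And>x. N (x - a) < d \<Longrightarrow> c \<le> Re (f x)) \<Longrightarrow> k * c \<le> Re (mean f)"
proof -
  obtain F where F: "F \<noteq> []" "\<And>x. \<exists>y\<in>set F. N (x - y) < d" using net[OF assms] by blast
  define k where "k = real (length F)"
  have k: "k \<ge> 1" unfolding k_def using F(1) by (cases F) auto
  have "c / k \<le> Re (mean f)" if f: "uc f" "\<And>x. 0 \<le> Re (f x)" "\<And>x. N (x - a) < d \<Longrightarrow> c \<le> Re (f x)" for f c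
  proof (rule has_mean_avg_ge[OF _ F(1)])
    show "has_mean (\<lambda>x. Re (f x)) (Re (mean f))"
      by (rule has_mean_bounded_linear[OF bounded_linear_Re has_mean_mean[OF f(1)]])
    fix y
    obtain x where x: "x \<in> set F" "N (a - y - x) < d" using F(2) by blast
    have "N (x + y - a) < d" using x(2) commute[of "x + y" a] by (simp add: algebra_simps)
    then have "c \<le> Re (f (x + y))" by (rule f(3))
    also have "\<dots> \<le> (\<Sum>x\<leftarrow>F. Re (f (x + y)))"
      by (rule member_le_sum_list) (use x f(2) in auto)
    finally show "c / k \<le> avg F (\<lambda>x. Re (f x)) y"
      using k by (simp add: avg_def k_def[symmetric] field_simps)
  qed
  then show thesis using that[of "1 / k"] k by simp
qed

text \<open>By the second hypothesis \<open>y\<close> may be restricted to a finite net, on which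
  one list \<open>L\<close> approximates all the means in \<open>x\<close>; by uniformity in
  \<open>x\<close> it then does so for every \<open>y\<close>. The average over \<open>L\<close> is
  a finite sum and commutes with the mean in \<open>y\<close>.\<close>

lemma mean_Fubini:
  assumes 1: "\<And>e. e > 0 \<Longrightarrow> \<exists>d>0. \<forall>x x' y. N (x - x') < d \<longrightarrow> norm (F x y - F x' y) < e"
    and 2: "\<And>e. e > 0 \<Longrightarrow> \<exists>d>0. \<forall>x y y'. N (y - y') < d \<longrightarrow> norm (F x y - F x y') < e"
  shows "mean (\<lambda>y. mean (\<lambda>x. F x y)) = mean (\<lambda>x. mean (\<lambda>y. F x y))"
    and "uc (\<lambda>y. mean (\<lambda>x. F x y))"
proof -
  have uc1: "uc (\<lambda>x. F x y)" for y using 1 unfolding uc_def by meson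
  have uc2: "uc (\<lambda>y. F x y)" for x using 2 unfolding uc_def by meson
  show ucy: "uc (\<lambda>y. mean (\<lambda>x. F x y))"
    unfolding uc_def
  proof (intro allI impI)
    fix e :: real assume e: "e > 0"
    then obtain d where d: "d > 0" "\<And>x y y'. N (y - y') < d \<Longrightarrow> norm (F x y - F x y') < e / 2"
      using 2[of "e / 2"] by auto
    have "norm (mean (\<lambda>x. F x y) - mean (\<lambda>x. F x y')) < e" if "N (y - y') < d" for y y'
      using norm_mean_diff_le[OF uc1 uc1, of y y' "e / 2"] d(2)[OF that] e by (force intro: less_imp_le)
    with d(1) show "\<exists>d>0. \<forall>y y'. N (y - y') < d \<longrightarrow> norm (mean (\<lambda>x. F x y) - mean (\<lambda>x. F x y')) < e"
      by blast
  qed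
  have "has_mean (\<lambda>x. mean (\<lambda>y. F x y)) (mean (\<lambda>y. mean (\<lambda>x. F x y)))"
    unfolding has_mean_def
  proof (intro allI impI)
    fix e :: real assume e: "e > 0"
    then obtain d where d: "d > 0" "\<And>x y y'. N (y - y') < d \<Longrightarrow> norm (F x y - F x y') < e / 3"
      using 2[of "e / 3"] by auto
    obtain Y where Y: "finite Y" "\<And>y. \<exists>y'\<in>Y. N (y - y') < d" using totally_bounded[OF d(1)] by blast
    have "\<exists>L. L \<noteq> [] \<and> (\<forall>y\<in>Y. \<forall>z. norm (avg L (\<lambda>x. F x y) z - mean (\<lambda>x. F x y)) \<le> e / 3)"
      by (rule has_mean_uniform[OF Y(1) has_mean_mean[OF uc1]]) (use e in simp)
    then obtain L where L: "L \<noteq> []"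
      "\<And>y z. y \<in> Y \<Longrightarrow> norm (avg L (\<lambda>x. F x y) z - mean (\<lambda>x. F x y)) \<le> e / 3"
      by blast
    have L': "norm (avg L (\<lambda>x. F x y) z - mean (\<lambda>x. F x y)) \<le> e" for y z
    proof -
      obtain y' where y': "y' \<in> Y" "N (y - y') < d" using Y(2) by blast
      have le: "norm (F x y - F x y') \<le> e / 3" for x using d(2)[OF y'(2), of x] by simp
      have "norm (avg L (\<lambda>x. F x y) z - avg L (\<lambda>x. F x y') z) \<le> e / 3"
        unfolding avg_diff[symmetric] by (rule norm_avg_le[OF L(1) le])
      moreover have "norm (mean (\<lambda>x. F x y) - mean (\<lambda>x. F x y')) \<le> e / 3"
        by (rule norm_mean_diff_le[OF uc1 uc1 le])
      moreover have "norm ((p - p') - (q - q') + (p' - q')) \<le> norm (p - p') + norm (q - q') + norm (p' - q')"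
        for p p' q q' :: complex
        by (metis add_right_mono norm_triangle_ineq norm_triangle_ineq4 order_trans)
      from this[of "avg L (\<lambda>x. F x y) z" "avg L (\<lambda>x. F x y') z" "mean (\<lambda>x. F x y)" "mean (\<lambda>x. F x y')"]
      have "norm (avg L (\<lambda>x. F x y) z - mean (\<lambda>x. F x y)) \<le>
          norm (avg L (\<lambda>x. F x y) z - avg L (\<lambda>x. F x y') z) + norm (mean (\<lambda>x. F x y) - mean (\<lambda>x. F x y'))
          + norm (avg L (\<lambda>x. F x y') z - mean (\<lambda>x. F x y'))" by simp
      ultimately show ?thesis using L(2)[OF y'(1), of z] by linarith
    qed
    have "norm (avg L (\<lambda>x. mean (\<lambda>y. F x y)) z - mean (\<lambda>y. mean (\<lambda>x. F x y))) \<le> e" for z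
    proof -
      have s: "uc (\<lambda>y. \<Sum>x\<leftarrow>L. F (x + z) y)" by (intro uc_sum_list uc2)
      have "avg L (\<lambda>x. mean (\<lambda>y. F x y)) z = mean (\<lambda>y. avg L (\<lambda>x. F x y) z)"
        unfolding avg_def scaleR_conv_of_real
        by (subst mean_cmult[OF s]) (simp add: mean_sum_list uc2)
      moreover have "uc (\<lambda>y. avg L (\<lambda>x. F x y) z)"
        unfolding avg_def scaleR_conv_of_real by (intro uc_mult uc_const s)
      ultimately show ?thesis using norm_mean_diff_le[OF _ ucy L'] by simp
    qed
    with L(1) show "\<exists>L. L \<noteq> [] \<and>
        (\<forall>y. norm (avg L (\<lambda>x. mean (F x)) y - mean (\<lambda>y. mean (\<lambda>x. F x y))) \<le> e)" by blast
  qed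
  then show "mean (\<lambda>y. mean (\<lambda>x. F x y)) = mean (\<lambda>x. mean (\<lambda>y. F x y))"
    by (rule mean_eqI[symmetric])
qed

end

section \<open>Convolution\<close>

context bounded_pseudonorm
begin

text \<open>Joint continuity and the bound together pass to products of kernels; the continuity
  gives both hypotheses of \<open>mean_Fubini\<close>.\<close>

definition bi_uc :: "('g \<Rightarrow> 'g \<Rightarrow> complex) \<Rightarrow> bool" where
  "bi_uc F \<longleftrightarrow> (\<forall>e>0. \<exists>d>0. \<forall>x x' y y'. N (x - x') < d \<longrightarrow> N (y - y') < d \<longrightarrow> norm (F x y - F x' y') < e)
     \<and> (\<exists>B>0. \<forall>x y. norm (F x y) \<le> B)"

lemma bi_uc_mult:
  assumes "bi_uc F" "bi_uc G"
  shows "bi_uc (\<lambda>x y. F x y * G x y)"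
proof -
  obtain A where A: "A > 0" "\<And>x y. norm (F x y) \<le> A" using assms(1) unfolding bi_uc_def by blast
  obtain B where B: "B > 0" "\<And>x y. norm (G x y) \<le> B" using assms(2) unfolding bi_uc_def by blast
  show ?thesis unfolding bi_uc_def
  proof (intro conjI allI impI)
    fix e :: real assume e: "e > 0"
    obtain d where d: "d > 0"
      "\<And>x x' y y'. N (x - x') < d \<Longrightarrow> N (y - y') < d \<Longrightarrow> norm (F x y - F x' y') < e / (2 * B)"
      using assms(1) e B(1) unfolding bi_uc_def
      by (metis divide_pos_pos mult_pos_pos zero_less_numeral)
    obtain d' where d': "d' > 0"
      "\<And>x x' y y'. N (x - x') < d' \<Longrightarrow> N (y - y') < d' \<Longrightarrow> norm (G x y - G x' y') < e / (2 * A)"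
      using assms(2) e A(1) unfolding bi_uc_def
      by (metis divide_pos_pos mult_pos_pos zero_less_numeral)
    have "norm (F x y * G x y - F x' y' * G x' y') < e"
      if "N (x - x') < min d d'" "N (y - y') < min d d'" for x x' y y'
    proof -
      have 1: "norm (F x y - F x' y') < e / (2 * B)" "norm (G x y - G x' y') < e / (2 * A)"
        using that by (auto intro: d d')
      have "F x y * G x y - F x' y' * G x' y' = (F x y - F x' y') * G x y + F x' y' * (G x y - G x' y')"
        by (simp add: algebra_simps)
      then have "norm (F x y * G x y - F x' y' * G x' y') \<le>
          norm (F x y - F x' y') * norm (G x y) + norm (F x' y') * norm (G x y - G x' y')"
        by (metis norm_mult norm_triangle_ineq)
      also have "\<dots> \<le> norm (F x y - F x' y') * B + A * norm (G x y - G x' y')"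
        by (intro add_mono mult_left_mono mult_right_mono A B) auto
      also have "\<dots> < e / (2 * B) * B + A * (e / (2 * A))"
        by (intro add_strict_mono mult_strict_right_mono mult_strict_left_mono 1 A B)
      finally show ?thesis using A B by simp
    qed
    moreover have "min d d' > 0" using d d' by simp
    ultimately show "\<exists>d>0. \<forall>x x' y y'. N (x - x') < d \<longrightarrow> N (y - y') < d \<longrightarrow>
        norm (F x y * G x y - F x' y' * G x' y') < e" by blast
  next
    have "norm (F x y * G x y) \<le> A * B" for x y
      unfolding norm_mult by (intro mult_mono A B) (use A in \<open>auto intro: less_imp_le\<close>)
    then show "\<exists>B>0. \<forall>x y. norm (F x y * G x y) \<le> B" using A B by (intro exI[of _ "A * B"]) simp
  qed
qed

lemma bi_uc_comp:
  assumes f: "uc f" and h: "\<And>x x' y y'. N (h x y - h x' y') \<le> N (x - x') + N (y - y')"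
  shows "bi_uc (\<lambda>x y. f (h x y))"
  unfolding bi_uc_def
proof (intro conjI allI impI)
  fix e :: real assume e: "e > 0"
  obtain d where d: "d > 0" "\<And>x y. N (x - y) < d \<Longrightarrow> norm (f x - f y) < e"
    using ucD[OF f e] by blast
  have "norm (f (h x y) - f (h x' y')) < e" if "N (x - x') < d / 2" "N (y - y') < d / 2" for x x' y y'
    using d(2) h[of x y x' y'] that by fastforce
  with d(1) show "\<exists>d>0. \<forall>x x' y y'. N (x - x') < d \<longrightarrow> N (y - y') < d \<longrightarrow>
        norm (f (h x y) - f (h x' y')) < e" by (intro exI[of _ "d / 2"]) simp
next
  obtain B where "B > 0" "\<And>x. norm (f x) \<le> B" using uc_bounded[OF f] by blast
  then show "\<exists>B>0. \<forall>x y. norm (f (h x y)) \<le> B" by blast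
qed

lemma bi_uc_fst [intro]: "uc f \<Longrightarrow> bi_uc (\<lambda>x y. f x)"
  by (rule bi_uc_comp) (simp_all add: nonneg)

lemma bi_uc_snd [intro]: "uc f \<Longrightarrow> bi_uc (\<lambda>x y. f y)"
  by (rule bi_uc_comp) (simp_all add: nonneg)

lemma bi_uc_diff [intro]: "uc f \<Longrightarrow> bi_uc (\<lambda>x y. f (x - y))"
proof (rule bi_uc_comp)
  fix x x' y y' :: 'g
  have "x - y - (x' - y') = (x - x') + - (y - y')" by (simp add: algebra_simps)
  then show "N (x - y - (x' - y')) \<le> N (x - x') + N (y - y')" by (metis triangle minus)
qed

lemma bi_uc_diff' [intro]: "uc f \<Longrightarrow> bi_uc (\<lambda>x y. f (y - x))"
proof (rule bi_uc_comp)
  fix x x' y y' :: 'g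
  have "y - x - (y' - x') = - (x - x') + (y - y')" by (simp add: algebra_simps)
  then show "N (y - x - (y' - x')) \<le> N (x - x') + N (y - y')" by (metis triangle minus)
qed

lemma bi_uc_add [intro]: "uc f \<Longrightarrow> bi_uc (\<lambda>x y. f (x + y))"
proof (rule bi_uc_comp)
  fix x x' y y' :: 'g
  have "x + y - (x' + y') = (x - x') + (y - y')" by (simp add: algebra_simps)
  then show "N (x + y - (x' + y')) \<le> N (x - x') + N (y - y')" by (metis triangle)
qed

lemma bi_uc_Fubini:
  assumes "bi_uc F"
  shows "mean (\<lambda>y. mean (\<lambda>x. F x y)) = mean (\<lambda>x. mean (\<lambda>y. F x y))"
    and "uc (\<lambda>y. mean (\<lambda>x. F x y))"
proof -
  have 1: "\<exists>d>0. \<forall>x x' y. N (x - x') < d \<longrightarrow> norm (F x y - F x' y) < e"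
    and 2: "\<exists>d>0. \<forall>x y y'. N (y - y') < d \<longrightarrow> norm (F x y - F x y') < e" if e: "e > 0" for e
  proof -
    obtain d where d: "d > 0"
      "\<And>x x' y y'. N (x - x') < d \<Longrightarrow> N (y - y') < d \<Longrightarrow> norm (F x y - F x' y') < e"
      using assms e unfolding bi_uc_def by meson
    then show "\<exists>d>0. \<forall>x x' y. N (x - x') < d \<longrightarrow> norm (F x y - F x' y) < e"
      "\<exists>d>0. \<forall>x y y'. N (y - y') < d \<longrightarrow> norm (F x y - F x y') < e"
      by (auto intro!: exI[of _ d])
  qed
  show "mean (\<lambda>y. mean (\<lambda>x. F x y)) = mean (\<lambda>x. mean (\<lambda>y. F x y))"
    by (rule mean_Fubini(1)[OF 1 2])
  show "uc (\<lambda>y. mean (\<lambda>x. F x y))"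
    by (rule mean_Fubini(2)[OF 1 2])
qed

text \<open>The squared \<open>L\<^sup>2\<close> norm for the invariant mean.\<close>

definition nsq :: "('g \<Rightarrow> complex) \<Rightarrow> real" where
  "nsq f = Re (mean (\<lambda>x. f x * cnj (f x)))"

lemma uc_nsq [intro]: "uc f \<Longrightarrow> uc (\<lambda>x. f x * cnj (f x))"
  by (intro uc_mult uc_cnj)

lemma nsq_le: "uc f \<Longrightarrow> (\<And>x. norm (f x) \<le> B) \<Longrightarrow> nsq f \<le> B\<^sup>2"
  unfolding nsq_def
  by (rule order_trans[OF complex_Re_le_cmod norm_mean_le[OF uc_nsq]])
    (simp_all add: norm_mult power2_eq_square mult_mono')

lemma nsq_nonneg: "uc f \<Longrightarrow> 0 \<le> nsq f"
  unfolding nsq_def by (rule Re_mean_ge[OF uc_nsq]) (simp_all add: complex_mult_cnj)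

text \<open>The mean is faithful on nonnegative functions: here the squared modulus stays above half
  its value at \<open>a\<close> on a ball around \<open>a\<close>.\<close>

lemma nsq_pos:
  assumes f: "uc f" and "f a \<noteq> 0"
  shows "0 < nsq f"
proof -
  define g where "g x = f x * cnj (f x)" for x
  have g: "uc g" unfolding g_def using f by blast
  have ga: "Re (g a) > 0"
    using assms(2) by (simp add: g_def complex_mult_cnj sum_power2_gt_zero_iff complex_eq_iff)
  then obtain d where d: "d > 0" "\<And>x y. N (x - y) < d \<Longrightarrow> norm (g x - g y) < Re (g a) / 2"
    using ucD[OF g, of "Re (g a) / 2"] by auto
  obtain k where k: "k > 0"
    "\<And>f c. uc f \<Longrightarrow> (\<And>x. 0 \<le> Re (f x)) \<Longrightarrow> (\<And>x. N (x - a) < d \<Longrightarrow> c \<le> Re (f x)) \<Longrightarrow> k * c \<le> Re (mean f)"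
    using mean_pos_of_ball[OF d(1)] by blast
  have "Re (g a) / 2 \<le> Re (g x)" if "N (x - a) < d" for x
    using d(2)[OF that] abs_Re_le_cmod[of "g x - g a"] by (simp add: abs_le_iff)
  moreover have "0 \<le> Re (g x)" for x by (simp add: g_def complex_mult_cnj)
  ultimately have "k * (Re (g a) / 2) \<le> Re (mean g)" by (intro k(2) g)
  moreover have "0 < k * (Re (g a) / 2)" using k ga by simp
  ultimately show ?thesis unfolding nsq_def g_def[symmetric] by linarith
qed

lemma uc_norm [intro]: "uc f \<Longrightarrow> uc (\<lambda>x. norm (f x))"
  unfolding uc_def by (metis norm_triangle_ineq3 order_le_less_trans real_norm_def)

text \<open>Multiplication by the conjugate phase \<open>c\<close> turns the mean of
  \<open>f\<close> into its modulus; after that only real parts are compared.\<close>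

lemma norm_mean_le_mean:
  assumes f: "uc f" and g: "uc g" and le: "\<And>x. norm (f x) \<le> Re (g x)"
  shows "norm (mean f) \<le> Re (mean g)"
proof -
  define c where "c = cnj (sgn (mean f))"
  have c: "norm c \<le> 1" by (simp add: c_def norm_sgn)
  have "of_real (norm (mean f)) = c * mean f"
    by (cases "mean f = 0")
      (auto simp: c_def sgn_div_norm complex_norm_square[symmetric] power2_eq_square scaleR_conv_of_real field_simps)
  then have "norm (mean f) = Re (mean (\<lambda>x. c * f x))"
    by (metis Re_complex_of_real mean_cmult[OF f])
  also have "\<dots> \<le> Re (mean g)"
  proof (rule Re_mean_mono[OF uc_mult[OF uc_const f] g])
    fix x
    have "Re (c * f x) \<le> norm (c * f x)" by (rule complex_Re_le_cmod)
    also have "\<dots> \<le> 1 * norm (f x)" unfolding norm_mult by (rule mult_right_mono[OF c]) simp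
    finally show "Re (c * f x) \<le> Re (g x)" using le[of x] by simp
  qed
  finally show ?thesis .
qed

text \<open>Cauchy-Schwarz in linear form, from
  \<open>2 * norm (g x) \<le> s + (norm (g x))\<^sup>2 / s\<close>. With \<open>s\<close> left free
  no square root occurs; as \<open>nsq g\<close> tends to 0, a small fixed \<open>s\<close> makes
  the bound small.\<close>

lemma norm_mean_mult_le:
  assumes f: "uc f" and g: "uc g" and K: "\<And>x. norm (f x) \<le> K" and s: "s > 0"
  shows "norm (mean (\<lambda>x. f x * g x)) \<le> K * (s + nsq g / s) / 2"
proof -
  have K0: "0 \<le> K" using order_trans[OF norm_ge_zero K] .
  define q where "q x = of_real (K / 2) * (of_real s + of_real (1 / s) * (g x * cnj (g x)))" for x
  have ucq: "uc q" unfolding q_def using g by (intro uc_mult uc_add uc_const uc_cnj)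
  have "norm (mean (\<lambda>x. f x * g x)) \<le> Re (mean q)"
  proof (rule norm_mean_le_mean[OF uc_mult[OF f g] ucq])
    fix x
    have "0 \<le> (s - norm (g x))\<^sup>2 / s" using s by simp
    also have "\<dots> = s + (norm (g x))\<^sup>2 / s - 2 * norm (g x)"
      using s by (simp add: power2_eq_square field_simps)
    finally have "norm (g x) \<le> (s + (norm (g x))\<^sup>2 / s) / 2" by simp
    then have "norm (f x) * norm (g x) \<le> K * ((s + (norm (g x))\<^sup>2 / s) / 2)"
      by (intro mult_mono K K0) auto
    also have "\<dots> = Re (q x)"
      by (simp add: q_def complex_norm_square[symmetric])
    finally show "norm (f x * g x) \<le> Re (q x)" by (simp add: norm_mult)
  qed
  also have "mean q = of_real (K / 2) * (of_real s + of_real (1 / s) * mean (\<lambda>x. g x * cnj (g x)))"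
    unfolding q_def using g
    by (simp add: mean_cmult mean_add uc_add uc_mult uc_cnj del: of_real_divide)
  also have "Re \<dots> = K * (s + nsq g / s) / 2" by (simp add: nsq_def)
  finally show ?thesis .
qed

definition conv :: "('g \<Rightarrow> complex) \<Rightarrow> ('g \<Rightarrow> complex) \<Rightarrow> 'g \<Rightarrow> complex" where
  "conv k g x = mean (\<lambda>y. k (x - y) * g y)"

lemma uc_conv [intro]: "uc k \<Longrightarrow> uc g \<Longrightarrow> uc (conv k g)"
  unfolding conv_def[abs_def]
  by (rule bi_uc_Fubini(2)[of "\<lambda>y x. k (x - y) * g y"]) (intro bi_uc_mult bi_uc_diff' bi_uc_fst)

lemma uc_conv_arg [intro]: "uc k \<Longrightarrow> uc g \<Longrightarrow> uc (\<lambda>y. k (x - y) * g y :: complex)"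
  by (rule uc_mult[OF uc_shift(4)])

lemma conv_cmult: "uc k \<Longrightarrow> uc g \<Longrightarrow> conv k (\<lambda>x. c * g x) x = c * conv k g x"
  unfolding conv_def using mean_cmult[OF uc_conv_arg, of k g c x] by (simp add: mult.left_commute)

lemma conv_diff: "uc k \<Longrightarrow> uc f \<Longrightarrow> uc g \<Longrightarrow> conv k (\<lambda>x. f x - g x) x = conv k f x - conv k g x"
  unfolding conv_def using mean_diff[OF uc_conv_arg uc_conv_arg, of k f k g x x] by (simp add: algebra_simps)

lemma conv_add: "uc k \<Longrightarrow> uc f \<Longrightarrow> uc g \<Longrightarrow> conv k (\<lambda>x. f x + g x) x = conv k f x + conv k g x"
  unfolding conv_def using mean_add[OF uc_conv_arg uc_conv_arg, of k f k g x x] by (simp add: algebra_simps)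

lemma conv_shift:
  assumes "uc k" "uc g"
  shows "conv k (\<lambda>z. g (z + a)) x = conv k g (x + a)"
  using mean_shift[OF uc_conv_arg[OF assms, of "x + a"], of a] by (simp add: conv_def)

lemma norm_conv_le:
  assumes "uc k" "uc g" "\<And>x. norm (k x) \<le> K" "\<And>x. norm (g x) \<le> B"
  shows "norm (conv k g x) \<le> K * B"
  unfolding conv_def
  by (rule norm_mean_le[OF uc_conv_arg[OF assms(1,2)]])
    (auto simp: norm_mult intro!: mult_mono' assms(3,4))

text \<open>The kernel \<open>k (x - y)\<close> is Hermitian, so this is the exchange of the two
  means.\<close>

lemma conv_selfadjoint:
  assumes k: "uc k" "\<And>x. k (- x) = cnj (k x)" and g: "uc g" and h: "uc h"
  shows "mean (\<lambda>x. conv k g x * cnj (h x)) = mean (\<lambda>x. g x * cnj (conv k h x))"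
proof -
  have "mean (\<lambda>x. conv k g x * cnj (h x)) = mean (\<lambda>x. mean (\<lambda>y. k (x - y) * g y * cnj (h x)))"
    unfolding conv_def using mean_cmult[OF uc_conv_arg[OF k(1) g], of "cnj (h _)"]
    by (simp add: mult_ac)
  also have "\<dots> = mean (\<lambda>y. mean (\<lambda>x. k (x - y) * g y * cnj (h x)))"
    using g h k by (intro bi_uc_Fubini(1)[symmetric] bi_uc_mult bi_uc_diff bi_uc_snd bi_uc_fst uc_cnj)
  also have "\<dots> = mean (\<lambda>y. g y * cnj (conv k h y))"
  proof -
    have "mean (\<lambda>x. k (x - y) * g y * cnj (h x)) = g y * cnj (conv k h y)" for y
    proof -
      have "k (x - y) = cnj (k (y - x))" for x using k(2)[of "y - x"] by simp
      then have "(\<lambda>x. k (x - y) * g y * cnj (h x)) = (\<lambda>x. g y * cnj (k (y - x) * h x))"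
        by (simp add: fun_eq_iff)
      then show ?thesis unfolding conv_def
        using mean_cmult[OF uc_cnj[OF uc_conv_arg[OF k(1) h]], of "g y" y] mean_cnj[OF uc_conv_arg[OF k(1) h], of y]
        by simp
    qed
    then show ?thesis by simp
  qed
  finally show ?thesis .
qed

lemma mean_uniform_limit:
  assumes "uniform_limit UNIV f h sequentially" "\<And>n. uc (f n)" "uc h"
  shows "(\<lambda>n. mean (f n)) \<longlonglongrightarrow> mean h"
proof (rule metric_LIMSEQ_I)
  fix e :: real assume e: "e > 0"
  then have "\<forall>\<^sub>F n in sequentially. \<forall>x\<in>UNIV. dist (f n x) (h x) < e / 2"
    using uniform_limitD[OF assms(1), of "e / 2"] by simp
  then obtain n0 where n0: "\<And>n x. n \<ge> n0 \<Longrightarrow> dist (f n x) (h x) < e / 2"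
    unfolding eventually_sequentially by blast
  have "dist (mean (f n)) (mean h) < e" if "n \<ge> n0" for n
    using norm_mean_diff_le[OF assms(2,3), of n "e / 2"] n0[OF that] e
    by (force simp: dist_norm intro: less_imp_le)
  then show "\<exists>n0. \<forall>n\<ge>n0. dist (mean (f n)) (mean h) < e" by blast
qed

lemma conv_uniform_limit:
  assumes f: "uniform_limit UNIV f h sequentially" "\<And>n. uc (f n)" "uc h" and k: "uc k"
  shows "uniform_limit UNIV (\<lambda>n. conv k (f n)) (conv k h) sequentially"
proof (rule uniform_limitI)
  fix e :: real assume e: "e > 0"
  obtain K where K: "K > 0" "\<And>x. norm (k x) \<le> K" using uc_bounded[OF k] by blast
  have "\<forall>\<^sub>F n in sequentially. \<forall>x\<in>UNIV. dist (f n x) (h x) < e / (2 * K)"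
    using uniform_limitD[OF f(1), of "e / (2 * K)"] e K(1) by simp
  then show "\<forall>\<^sub>F n in sequentially. \<forall>x\<in>UNIV. dist (conv k (f n) x) (conv k h x) < e"
  proof (rule eventually_mono, intro ballI)
    fix n x assume le: "\<forall>x\<in>UNIV. dist (f n x) (h x) < e / (2 * K)"
    have "norm (conv k (\<lambda>y. f n y - h y) x) \<le> K * (e / (2 * K))"
      by (rule norm_conv_le) (use le K k f in \<open>auto simp: dist_norm intro: less_imp_le\<close>)
    then show "dist (conv k (f n) x) (conv k h x) < e"
      using K e by (simp add: dist_norm conv_diff k f)
  qed
qed

lemma nsq_uniform_limit:
  assumes f: "uniform_limit UNIV f h sequentially" "\<And>n. uc (f n)" "uc h"
    and B: "\<And>n x. norm (f n x) \<le> B"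
  shows "(\<lambda>n. nsq (f n)) \<longlonglongrightarrow> nsq h"
proof -
  have bh: "bounded (range h)" using uc_bounded[OF f(3)] by (metis bounded_iff rangeE)
  have c: "uniform_limit UNIV (\<lambda>n x. cnj (f n x)) (\<lambda>x. cnj (h x)) sequentially"
    using f(1) unfolding uniform_limit_iff by (simp add: dist_norm flip: complex_cnj_diff)
  have bc: "bounded (range (\<lambda>x. cnj (h x)))" using bh unfolding bounded_iff by auto
  have "uniform_limit UNIV (\<lambda>n x. f n x * cnj (f n x)) (\<lambda>x. h x * cnj (h x)) sequentially"
    by (rule uniform_lim_mult[OF f(1) c bh bc])
  then show ?thesis unfolding nsq_def
    by (intro tendsto_Re mean_uniform_limit uc_nsq f(2,3))
qed

text \<open>A countable dense set replaces compactness of the domain: pointwise convergence on it,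
  total boundedness and equicontinuity give a uniform Cauchy sequence.\<close>

lemma Arzela_Ascoli_uc:
  fixes f :: "nat \<Rightarrow> 'g \<Rightarrow> complex"
  assumes B: "\<And>n x. norm (f n x) \<le> B"
    and equi: "\<And>e. e > 0 \<Longrightarrow> \<exists>d>0. \<forall>n x y. N (x - y) < d \<longrightarrow> norm (f n x - f n y) < e"
  obtains r h where "strict_mono (r :: nat \<Rightarrow> nat)" "uniform_limit UNIV (\<lambda>n. f (r n)) h sequentially" "uc h"
proof -
  have "\<exists>F. finite F \<and> (\<forall>x. \<exists>y\<in>F. N (x - y) < 1 / real (Suc m))" for m
    by (rule totally_bounded) simp
  then obtain F where F: "\<And>m. finite (F m)" "\<And>m x. \<exists>y\<in>F m. N (x - y) < 1 / real (Suc m)"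
    by metis
  have "countable (\<Union>m. F m)" using F(1) by (auto intro: countable_finite)
  moreover have "(\<Union>m. F m) \<noteq> {}" using F(2)[of 0] by blast
  ultimately obtain D :: "nat \<Rightarrow> 'g" where D: "range D = (\<Union>m. F m)"
    using that[OF range_from_nat_into] by simp
  \<comment> \<open>The values on the enumerated dense set form a point of a countable product of
    discs; its sequential compactness stands for the diagonal argument.\<close>
  have "compact (PiE UNIV (\<lambda>_::nat. cball 0 B) :: (nat \<Rightarrow> complex) set)"
    using compactin_PiE[of "\<lambda>_::nat. euclidean :: complex topology" UNIV "\<lambda>_. cball 0 B"]
    by (simp add: euclidean_product_topology)
  then have "seq_compact (PiE UNIV (\<lambda>_::nat. cball 0 B) :: (nat \<Rightarrow> complex) set)"
    by (rule compact_imp_seq_compact)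
  moreover have "\<forall>n. (\<lambda>i. f n (D i)) \<in> PiE UNIV (\<lambda>_::nat. cball 0 B)" using B by (simp add: PiE_UNIV_domain)
  ultimately obtain l r where r: "strict_mono (r :: nat \<Rightarrow> nat)"
    "((\<lambda>n. (\<lambda>i. f n (D i))) \<circ> r) \<longlonglongrightarrow> l"
    unfolding seq_compact_def by meson
  have pt: "(\<lambda>n. f (r n) (D i)) \<longlonglongrightarrow> l i" for i
  proof -
    have "isCont (\<lambda>g::nat \<Rightarrow> complex. g i) l"
      using continuous_on_product_coordinates[of i] continuous_on_eq_continuous_at[OF open_UNIV] by blast
    from isCont_tendsto_compose[OF this r(2)] show ?thesis by (simp add: o_def)
  qed
  have "uniformly_Cauchy_on UNIV (\<lambda>n. f (r n))"
    unfolding uniformly_Cauchy_on_def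
  proof (intro allI impI)
    fix e :: real assume e: "e > 0"
    obtain d where d: "d > 0" "\<And>n x y. N (x - y) < d \<Longrightarrow> norm (f n x - f n y) < e / 3"
      using equi[of "e / 3"] e by auto
    obtain m where m: "1 / real (Suc m) < d" using d(1) nat_approx_posE by (metis)
    have "\<exists>n0. \<forall>n\<ge>n0. \<forall>n'\<ge>n0. norm (f (r n) y - f (r n') y) < e / 3" if y: "y \<in> F m" for y
    proof -
      obtain i where "y = D i" using y D by (metis UN_I UNIV_I rangeE)
      then have "Cauchy (\<lambda>n. f (r n) y)" using pt[of i] by (auto intro: LIMSEQ_imp_Cauchy)
      then show ?thesis using e unfolding Cauchy_def dist_norm by (metis divide_pos_pos zero_less_numeral)
    qed
    then obtain n0 where n0: "\<And>y n n'. y \<in> F m \<Longrightarrow> n \<ge> n0 y \<Longrightarrow> n' \<ge> n0 y \<Longrightarrow> norm (f (r n) y - f (r n') y) < e / 3"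
      by metis
    define M where "M = Max (n0 ` F m)"
    have "dist (f (r n) x) (f (r n') x) < e" if n: "n \<ge> M" "n' \<ge> M" for n n' x
    proof -
      obtain y where y: "y \<in> F m" "N (x - y) < d" using F(2)[of m x] m by fastforce
      have "n0 y \<le> M" unfolding M_def using y(1) F(1)[of m] by simp
      then have "norm (f (r n) y - f (r n') y) < e / 3" using n by (intro n0 y(1)) auto
      moreover have "norm (f (r n) x - f (r n) y) < e / 3" "norm (f (r n') x - f (r n') y) < e / 3"
        using d(2)[OF y(2)] by auto
      ultimately show ?thesis
        using dist_triangle[of "f (r n) x" "f (r n') x" "f (r n) y"]
          dist_triangle[of "f (r n) y" "f (r n') x" "f (r n') y"]
        by (simp add: dist_norm norm_minus_commute[of "f (r n') y"])
    qed
    then show "\<exists>M. \<forall>x\<in>UNIV. \<forall>m\<ge>M. \<forall>n\<ge>M. dist (f (r m) x) (f (r n) x) < e" by blast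
  qed
  then obtain h where h: "uniform_limit UNIV (\<lambda>n. f (r n)) h sequentially"
    using Cauchy_uniformly_convergent uniformly_convergent_on_def by blast
  have "uc h" unfolding uc_def
  proof (intro allI impI)
    fix e :: real assume e: "e > 0"
    obtain d where d: "d > 0" "\<And>n x y. N (x - y) < d \<Longrightarrow> norm (f n x - f n y) < e / 2"
      using equi[of "e / 2"] e by auto
    have "norm (h x - h y) < e" if "N (x - y) < d" for x y
    proof -
      have "(\<lambda>n. norm (f (r n) x - f (r n) y)) \<longlonglongrightarrow> norm (h x - h y)"
        by (intro tendsto_intros tendsto_uniform_limitI[OF h]) auto
      then have "norm (h x - h y) \<le> e / 2"
        by (rule tendsto_upperbound) (use d(2)[OF that] in \<open>auto intro!: always_eventually less_imp_le\<close>)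
      then show ?thesis using e by simp
    qed
    with d(1) show "\<exists>d>0. \<forall>x y. N (x - y) < d \<longrightarrow> norm (h x - h y) < e" by blast
  qed
  with r(1) h show thesis using that by blast
qed

end

section \<open>Separating characters\<close>

text \<open>A list of pairs stands for a finitely supported complex measure, a sum of point masses.
  This is the sesquilinear form that \<open>f\<close> defines on such measures.\<close>

definition form :: "('g::ab_group_add \<Rightarrow> complex) \<Rightarrow> (complex \<times> 'g) list \<Rightarrow> (complex \<times> 'g) list \<Rightarrow> complex" where
  "form f L K = (\<Sum>p\<leftarrow>L. \<Sum>q\<leftarrow>K. fst p * cnj (fst q) * f (snd p - snd q))"

definition posdef :: "('g::ab_group_add \<Rightarrow> complex) \<Rightarrow> bool" where
  "posdef f \<longleftrightarrow> (\<forall>x. f (- x) = cnj (f x)) \<and> (\<forall>L. 0 \<le> Re (form f L L))"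

text \<open>Translation of the measure by \<open>a\<close> and multiplication with \<open>c\<close>.
  So \<open>L @ twist c a L\<close> is the convolution of \<open>L\<close> with a unit mass at 0
  plus the mass \<open>c\<close> at \<open>a\<close>.\<close>

definition twist :: "complex \<Rightarrow> 'g::ab_group_add \<Rightarrow> (complex \<times> 'g) list \<Rightarrow> (complex \<times> 'g) list" where
  "twist c a = map (\<lambda>p. (c * fst p, snd p + a))"

lemma sum_list_mult_sum_list:
  "(\<Sum>p\<leftarrow>L. f p) * (\<Sum>q\<leftarrow>K. g q) = (\<Sum>p\<leftarrow>L. \<Sum>q\<leftarrow>K. f p * g q :: 'b::semiring_0)"
  by (induction L) (simp_all add: distrib_right sum_list_const_mult)

lemma form_append1: "form f (L @ L') K = form f L K + form f L' K"
  by (simp add: form_def)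

lemma form_append2: "form f L (K @ K') = form f L K + form f L K'"
  by (simp add: form_def sum_list_addf)

lemma form_add: "form (\<lambda>x. f x + g x) L K = form f L K + form g L K"
  by (simp add: form_def distrib_left sum_list_addf)

lemma form_cmult: "form (\<lambda>x. c * f x) L K = c * form f L K"
  by (simp add: form_def mult.left_commute flip: sum_list_const_mult)

lemma form_twist: "form f (twist c a L) (twist d b K) = c * cnj d * form (\<lambda>x. f (x + (a - b))) L K"
  by (simp add: form_def twist_def o_def mult_ac algebra_simps flip: sum_list_const_mult)

lemma twist_1_0 [simp]: "twist 1 0 L = L"
  by (simp add: twist_def)

lemma posdef_norm_le:
  assumes "posdef f"
  shows "norm (f x) \<le> Re (f 0)" "f 0 = of_real (Re (f 0))"
proof -
  have herm: "f (- y) = cnj (f y)" for y using assms unfolding posdef_def by blast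
  have "f 0 = cnj (f 0)" using herm[of 0] by simp
  then show f0: "f 0 = of_real (Re (f 0))" by (simp add: complex_eq_iff)
  \<comment> \<open>Then \<open>c * f x = - norm (f x)\<close>, the choice that makes the cross
    terms most negative. If \<open>f x = 0\<close>, then \<open>c = 0\<close> and the form reduces
    to \<open>f 0\<close>.\<close>
  define c where "c = - cnj (sgn (f x))"
  have "0 \<le> Re (form f [(1, 0), (c, x)] [(1, 0), (c, x)])" using assms unfolding posdef_def by blast
  also have "form f [(1, 0), (c, x)] [(1, 0), (c, x)] = f 0 * (1 + c * cnj c) + (cnj (c * f x) + c * f x)"
    by (simp add: form_def herm algebra_simps)
  also have "c * f x = - of_real (norm (f x))"
    by (cases "f x = 0")
      (auto simp: c_def sgn_div_norm complex_norm_square[symmetric] power2_eq_square scaleR_conv_of_real field_simps)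
  also have "c * cnj c = of_real ((norm c)\<^sup>2)" by (simp add: complex_norm_square[symmetric])
  finally have *: "0 \<le> Re (f 0) * (1 + (norm c)\<^sup>2) - 2 * norm (f x)"
    by (subst (asm) f0) simp
  have "norm c = (if f x = 0 then 0 else 1)" by (simp add: c_def norm_sgn)
  with * show "norm (f x) \<le> Re (f 0)" by (auto split: if_splits)
qed

text \<open>On the convolution of \<open>L\<close> with a unit mass at 0 plus \<open>c\<close> at
  \<open>a\<close>, the form equals twice the form of \<open>f\<close> plus the translated terms. A
  quarter of it and one half of the form of \<open>f\<close> add up to the claim. The factor 1/4,
  instead of the extreme value 1/2, keeps the value at 0 at least half of \<open>f 0\<close>, which
  serves the later normalization.\<close>

lemma posdef_perturb:
  assumes f: "posdef f" and c: "norm c = 1"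
  shows "posdef (\<lambda>x. f x + (1/4) * (c * f (x + a) + cnj c * f (x - a)))"
  unfolding posdef_def
proof (intro conjI allI)
  have herm: "f (- y) = cnj (f y)" for y using f unfolding posdef_def by blast
  fix x
  show "f (- x) + (1/4) * (c * f (- x + a) + cnj c * f (- x - a)) =
      cnj (f x + (1/4) * (c * f (x + a) + cnj c * f (x - a)))"
  proof -
    have "- x - a = - (x + a)" "- x + a = - (x - a)" by simp_all
    then show ?thesis by (simp only: herm) simp
  qed
next
  fix L
  have cc: "c * cnj c = 1" using c by (simp add: complex_norm_square[symmetric])
  have 1: "form f (L @ twist c a L) (L @ twist c a L) =
      2 * form f L L + (c * form (\<lambda>x. f (x + a)) L L + cnj c * form (\<lambda>x. f (x - a)) L L)"
    using form_twist[of f 1 0 L c a L] form_twist[of f c a L 1 0 L] form_twist[of f c a L c a L] cc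
    by (simp add: form_append1 form_append2)
  have 2: "form (\<lambda>x. f x + (1/4) * (c * f (x + a) + cnj c * f (x - a))) L L =
      (1/2) * form f L L + (1/4) * form f (L @ twist c a L) (L @ twist c a L)"
    unfolding 1 by (simp only: form_add form_cmult) (simp add: algebra_simps)
  have "0 \<le> Re (form f L L)" "0 \<le> Re (form f (L @ twist c a L) (L @ twist c a L))"
    using f unfolding posdef_def by blast+
  then show "0 \<le> Re (form (\<lambda>x. f x + (1/4) * (c * f (x + a) + cnj c * f (x - a))) L L)"
    unfolding 2 by simp
qed

lemma posdef_scale:
  assumes "posdef f" "t \<ge> 0"
  shows "posdef (\<lambda>x. of_real t * f x)"
  using assms unfolding posdef_def form_cmult by simp

lemma posdef_LIMSEQ:
  assumes "\<And>n. posdef (f n)" "\<And>x. (\<lambda>n. f n x) \<longlonglongrightarrow> h x"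
  shows "posdef h"
  unfolding posdef_def
proof (intro conjI allI)
  fix x
  have "(\<lambda>n. f n (- x)) \<longlonglongrightarrow> cnj (h x)"
    using tendsto_cnj[OF assms(2)[of x]] assms(1) unfolding posdef_def by simp
  then show "h (- x) = cnj (h x)" using assms(2) LIMSEQ_unique by blast
next
  fix L
  have sl: "(\<lambda>n. \<Sum>q\<leftarrow>K. g n q) \<longlonglongrightarrow> (\<Sum>q\<leftarrow>K. k q)" if "\<And>q. (\<lambda>n. g n q) \<longlonglongrightarrow> k q"
    for g :: "nat \<Rightarrow> (complex \<times> 'a) \<Rightarrow> complex" and k K
    by (induction K) (auto intro!: tendsto_add that)
  have "(\<lambda>n. form (f n) L L) \<longlonglongrightarrow> form h L L"
    unfolding form_def by (rule sl, rule sl) (intro tendsto_mult tendsto_const assms(2))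
  then have "(\<lambda>n. Re (form (f n) L L)) \<longlonglongrightarrow> Re (form h L L)" by (rule tendsto_Re)
  moreover have "\<And>n. 0 \<le> Re (form (f n) L L)" using assms(1) unfolding posdef_def by blast
  ultimately show "0 \<le> Re (form h L L)" by (meson LIMSEQ_le_const)
qed

context bounded_pseudonorm
begin

lemma nsq_cmult: "uc g \<Longrightarrow> nsq (\<lambda>x. c * g x) = (norm c)\<^sup>2 * nsq g"
proof -
  assume g: "uc g"
  have "(\<lambda>x. c * g x * cnj (c * g x)) = (\<lambda>x. of_real ((norm c)\<^sup>2) * (g x * cnj (g x)))"
    by (simp add: fun_eq_iff complex_norm_square mult_ac del: of_real_power)
  then show ?thesis unfolding nsq_def by (simp add: mean_cmult[OF uc_nsq[OF g]] del: of_real_power)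
qed

lemma nsq_diff_scaled:
  assumes f: "uc f" and g: "uc g"
  shows "nsq (\<lambda>x. f x - of_real t * g x) = nsq f - 2 * t * Re (mean (\<lambda>x. f x * cnj (g x))) + t\<^sup>2 * nsq g"
proof -
  have fg: "uc (\<lambda>x. f x * cnj (g x))" using f g by (intro uc_mult uc_cnj)
  have "(\<lambda>x. (f x - of_real t * g x) * cnj (f x - of_real t * g x)) =
     (\<lambda>x. (f x * cnj (f x) + of_real (t\<^sup>2) * (g x * cnj (g x)))
        - of_real t * (f x * cnj (g x) + cnj (f x * cnj (g x))))"
    by (simp add: fun_eq_iff algebra_simps power2_eq_square)
  then have "mean (\<lambda>x. (f x - of_real t * g x) * cnj (f x - of_real t * g x)) =
      mean (\<lambda>x. f x * cnj (f x)) + of_real (t\<^sup>2) * mean (\<lambda>x. g x * cnj (g x))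
        - of_real t * (mean (\<lambda>x. f x * cnj (g x)) + cnj (mean (\<lambda>x. f x * cnj (g x))))"
    using f g fg
    by (simp only: mean_diff mean_add mean_cmult mean_cnj uc_add uc_mult uc_cnj uc_const)
  then have "nsq (\<lambda>x. f x - of_real t * g x) = Re (mean (\<lambda>x. f x * cnj (f x))
        + of_real (t\<^sup>2) * mean (\<lambda>x. g x * cnj (g x))
        - of_real t * (mean (\<lambda>x. f x * cnj (g x)) + cnj (mean (\<lambda>x. f x * cnj (g x)))))"
    unfolding nsq_def by (rule arg_cong)
  then show ?thesis unfolding nsq_def by (simp add: algebra_simps)
qed

text \<open>\<open>l\<close> is the squared operator norm of \<open>conv k\<close>. For
  near-maximizers \<open>g n\<close>, expanding the square by self-adjointness shows that the defect
  \<open>r n\<close> in the eigenvalue equation tends to 0 in the mean square. The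
  \<open>g n\<close> themselves need not converge, but their twofold convolutions are
  equicontinuous, and a uniform limit of these is an eigenfunction. Working with the squared
  operator avoids the choice of a sign for the eigenvalue.\<close>

lemma eigenfunction:
  assumes k: "uc k" "\<And>x. k (- x) = cnj (k x)" "k 0 \<noteq> 0"
  obtains l h where "l > 0" "uc h" "h a \<noteq> 0" "\<And>x. conv k (conv k h) x = of_real l * h x"
proof -
  obtain K where K: "K > 0" "\<And>x. norm (k x) \<le> K" using uc_bounded[OF k(1)] by blast
  have conv_bound: "norm (conv k g x) \<le> K" if "uc g" "nsq g \<le> 1" for g x
  proof -
    have "norm (conv k g x) \<le> K * (1 + nsq g / 1) / 2"
      unfolding conv_def by (rule norm_mean_mult_le) (use that K k in auto)
    also have "\<dots> \<le> K" using K(1) that(2) by (simp add: field_simps)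
    finally show ?thesis .
  qed
  define A where "A = {nsq (conv k g) |g. uc g \<and> nsq g \<le> 1}"
  have bdd: "bdd_above A"
    using nsq_le[OF uc_conv[OF k(1)] conv_bound] unfolding A_def bdd_above_def by blast
  define l where "l = Sup A"
  have le_l: "nsq (conv k g) \<le> l" if "uc g" "nsq g \<le> 1" for g
    unfolding l_def by (rule cSup_upper[OF _ bdd]) (use that in \<open>auto simp: A_def\<close>)
  \<comment> \<open>The kernel itself, scaled, is the test function that shows \<open>l > 0\<close>:
    its image at 0 is \<open>nsq k / K\<close>.\<close>
  define k1 where "k1 x = of_real (1 / K) * k x" for x
  have k1: "uc k1" unfolding k1_def by (intro uc_mult uc_const k(1))
  have nk1: "nsq k1 \<le> 1" using nsq_le[OF k1, of 1] K by (auto simp: k1_def norm_mult norm_divide)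
  have "conv k k1 0 = of_real (1 / K) * mean (\<lambda>y. k y * cnj (k y))"
    using mean_cmult[OF uc_nsq[OF k(1)], of "of_real (1 / K)"]
    by (simp add: conv_def k1_def k(2) mult_ac)
  moreover have "Re (mean (\<lambda>y. k y * cnj (k y))) > 0" using nsq_pos[OF k(1,3)] unfolding nsq_def .
  ultimately have "conv k k1 0 \<noteq> 0" using K(1) by (auto simp: complex_eq_iff)
  then have "nsq (conv k k1) > 0" using nsq_pos uc_conv k(1) k1 by blast
  with le_l[OF k1 nk1] have l: "l > 0" by linarith
  have le_l': "nsq (conv k g) \<le> l * nsq g" if g: "uc g" for g
  proof (cases "nsq g = 0")
    case True
    then have "\<And>x. g x = 0" using nsq_pos[OF g] by force
    then have "conv k g = (\<lambda>_. 0)" by (simp add: fun_eq_iff conv_def)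
    then show ?thesis using True by (simp add: nsq_def)
  next
    case False
    then have s: "nsq g > 0" using nsq_nonneg[OF g] by simp
    define c where "c = complex_of_real (1 / sqrt (nsq g))"
    have c2: "(norm c)\<^sup>2 = 1 / nsq g" using s by (simp add: c_def norm_divide power_divide)
    have "nsq (conv k (\<lambda>x. c * g x)) \<le> l"
      by (rule le_l) (use g s in \<open>auto simp: nsq_cmult c2\<close>)
    moreover have "conv k (\<lambda>x. c * g x) = (\<lambda>x. c * conv k g x)" by (simp add: fun_eq_iff conv_cmult k g)
    ultimately show ?thesis using s by (simp add: nsq_cmult c2 uc_conv k g field_simps)
  qed
  have Ane: "A \<noteq> {}" using k1 nk1 unfolding A_def by blast
  have "\<exists>g. uc g \<and> nsq g \<le> 1 \<and> l - 1 / real (Suc n) < nsq (conv k g)" for n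
  proof -
    have "l - 1 / real (Suc n) < Sup A" by (simp add: l_def)
    then obtain a where "a \<in> A" "l - 1 / real (Suc n) < a" using less_cSupD[OF Ane] by blast
    then show ?thesis unfolding A_def by blast
  qed
  then obtain g where g: "\<And>n. uc (g n)" "\<And>n. nsq (g n) \<le> 1"
    "\<And>n. l - 1 / real (Suc n) < nsq (conv k (g n))" by metis
  have lim: "(\<lambda>n. nsq (conv k (g n))) \<longlonglongrightarrow> l"
  proof (rule tendsto_sandwich[OF always_eventually always_eventually])
    show "\<forall>n. l - 1 / real (Suc n) \<le> nsq (conv k (g n))" using g(3) less_imp_le by blast
    show "\<forall>n. nsq (conv k (g n)) \<le> l" using le_l g by blast
    show "(\<lambda>n. l - 1 / real (Suc n)) \<longlonglongrightarrow> l"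
      using tendsto_diff[OF tendsto_const LIMSEQ_inverse_real_of_nat, of l] by (simp add: inverse_eq_divide)
  qed simp
  define r where "r n x = conv k (conv k (g n)) x - of_real l * g n x" for n x
  have ucc: "uc (conv k (g n))" "uc (conv k (conv k (g n)))" for n using k(1) g(1) by blast+
  have ucr: "uc (r n)" for n unfolding r_def[abs_def] by (intro uc_diff uc_mult uc_const ucc g)
  have nsq_r: "nsq (r n) \<le> 2 * l * (l - nsq (conv k (g n)))" for n
  proof -
    have "mean (\<lambda>x. conv k (conv k (g n)) x * cnj (g n x)) = mean (\<lambda>x. conv k (g n) x * cnj (conv k (g n) x))"
      by (rule conv_selfadjoint[OF k(1,2) ucc(1) g(1)])
    then have "nsq (r n) = nsq (conv k (conv k (g n))) - 2 * l * nsq (conv k (g n)) + l\<^sup>2 * nsq (g n)"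
      unfolding r_def[abs_def] by (subst nsq_diff_scaled[OF ucc(2) g(1)]) (simp add: nsq_def)
    also have "\<dots> \<le> l * l - 2 * l * nsq (conv k (g n)) + l\<^sup>2 * 1"
    proof (intro add_mono diff_mono order_refl mult_left_mono g)
      have "nsq (conv k (conv k (g n))) \<le> l * nsq (conv k (g n))" by (rule le_l'[OF ucc(1)])
      also have "\<dots> \<le> l * l" using l le_l[OF g(1,2)] by (intro mult_left_mono) auto
      finally show "nsq (conv k (conv k (g n))) \<le> l * l" .
    qed simp
    also have "\<dots> = 2 * l * (l - nsq (conv k (g n)))" by (simp add: power2_eq_square algebra_simps)
    finally show ?thesis .
  qed
  \<comment> \<open>A convolution turns smallness in the mean square into smallness in the supremum
    norm; the outer one is only estimated by \<open>K\<close>.\<close>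
  have conv_r: "norm (conv k (conv k (r n)) x) \<le> K * (K * (s + 2 * l * (l - nsq (conv k (g n))) / s) / 2)"
    if s: "s > 0" for n x s
  proof (rule norm_conv_le[OF k(1) uc_conv[OF k(1) ucr] K(2)])
    fix x
    have "norm (conv k (r n) x) \<le> K * (s + nsq (r n) / s) / 2"
      unfolding conv_def by (rule norm_mean_mult_le) (use s K k ucr in auto)
    also have "\<dots> \<le> K * (s + 2 * l * (l - nsq (conv k (g n))) / s) / 2"
      by (intro divide_right_mono mult_left_mono add_left_mono nsq_r) (use s K(1) in auto)
    finally show "norm (conv k (r n) x) \<le> K * (s + 2 * l * (l - nsq (conv k (g n))) / s) / 2" .
  qed
  have conv_r_lim: "(\<lambda>n. conv k (conv k (r n)) x) \<longlonglongrightarrow> 0" for x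
  proof (rule LIMSEQ_I)
    fix e :: real assume e: "e > 0"
    \<comment> \<open>The bound then tends to \<open>e / 2\<close>.\<close>
    define s where "s = e / (K * K)"
    have s: "s > 0" using e K by (simp add: s_def)
    have "(\<lambda>n. K * (K * (s + 2 * l * (l - nsq (conv k (g n))) / s) / 2)) \<longlonglongrightarrow>
        K * (K * (s + 2 * l * (l - l) / s) / 2)"
      by (intro tendsto_intros lim) (use s in auto)
    moreover have "K * (K * (s + 2 * l * (l - l) / s) / 2) < e" using e K by (simp add: s_def)
    ultimately have "\<forall>\<^sub>F n in sequentially. K * (K * (s + 2 * l * (l - nsq (conv k (g n))) / s) / 2) < e"
      by (rule order_tendstoD)
    then obtain n0 where n0: "\<And>n. n \<ge> n0 \<Longrightarrow> K * (K * (s + 2 * l * (l - nsq (conv k (g n))) / s) / 2) < e"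
      unfolding eventually_sequentially by blast
    have "norm (conv k (conv k (r n)) x) < e" if "n \<ge> n0" for n
      by (rule order_le_less_trans[OF conv_r[OF s] n0[OF that]])
    then show "\<exists>n0. \<forall>n\<ge>n0. norm (conv k (conv k (r n)) x - 0) < e" by auto
  qed
  \<comment> \<open>The modulus comes from the outer kernel alone, since \<open>conv k (g n)\<close>
    is bounded by \<open>K\<close> for all \<open>n\<close>.\<close>
  have equi: "\<exists>d>0. \<forall>n x y. N (x - y) < d \<longrightarrow> norm (conv k (conv k (g n)) x - conv k (conv k (g n)) y) < e"
    if e: "e > 0" for e
  proof -
    have "e / (2 * K) > 0" using e K by simp
    then obtain d where d: "d > 0" "\<And>x y. N (x - y) < d \<Longrightarrow> norm (k x - k y) < e / (2 * K)"
      using ucD[OF k(1)] by blast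
    have "norm (conv k (conv k (g n)) x - conv k (conv k (g n)) y) < e" if xy: "N (x - y) < d" for n x y
    proof -
      have "norm (mean (\<lambda>z. k (x - z) * conv k (g n) z) - mean (\<lambda>z. k (y - z) * conv k (g n) z)) \<le> e / (2 * K) * K"
      proof (rule norm_mean_diff_le)
        fix z
        have "norm (k (x - z) - k (y - z)) \<le> e / (2 * K)" using d(2)[of "x - z" "y - z"] xy by simp
        then have "norm (k (x - z) - k (y - z)) * norm (conv k (g n) z) \<le> e / (2 * K) * K"
          by (intro mult_mono conv_bound g) (use e K in auto)
        then show "norm (k (x - z) * conv k (g n) z - k (y - z) * conv k (g n) z) \<le> e / (2 * K) * K"
          by (simp add: norm_mult flip: left_diff_distrib)
      qed (use k(1) ucc in auto)
      then show ?thesis using e K by (simp add: conv_def)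
    qed
    with d(1) show ?thesis by blast
  qed
  have bd: "norm (conv k (conv k (g n)) x) \<le> K * K" for n x
    by (rule norm_conv_le[OF k(1) ucc(1) K(2) conv_bound[OF g(1,2)]])
  obtain q h where q: "strict_mono (q :: nat \<Rightarrow> nat)"
    and h: "uniform_limit UNIV (\<lambda>n. conv k (conv k (g (q n)))) h sequentially" "uc h"
    using Arzela_Ascoli_uc[of "\<lambda>n. conv k (conv k (g n))", OF bd equi] by auto
  have lim_q: "(\<lambda>n. nsq (conv k (g (q n)))) \<longlonglongrightarrow> l"
    using LIMSEQ_subseq_LIMSEQ[OF lim q] by (simp add: o_def)
  have eigen: "conv k (conv k h) x = of_real l * h x" for x
  proof -
    have "uniform_limit UNIV (\<lambda>n. conv k (conv k (conv k (conv k (g (q n)))))) (conv k (conv k h)) sequentially"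
      by (intro conv_uniform_limit h k(1) uc_conv g)
    then have "(\<lambda>n. conv k (conv k (conv k (conv k (g (q n))))) x) \<longlonglongrightarrow> conv k (conv k h) x"
      by (rule tendsto_uniform_limitI) simp
    moreover have "(\<lambda>n. conv k (conv k (g (q n))) x) \<longlonglongrightarrow> h x"
      by (rule tendsto_uniform_limitI[OF h(1)]) simp
    ultimately have L1: "(\<lambda>n. conv k (conv k (conv k (conv k (g (q n))))) x - of_real l * conv k (conv k (g (q n))) x)
        \<longlonglongrightarrow> conv k (conv k h) x - of_real l * h x"
      by (intro tendsto_intros)
    have r_eq: "conv k (conv k (r n)) x =
        conv k (conv k (conv k (conv k (g n)))) x - of_real l * conv k (conv k (g n)) x" for n
    proof -
      have "conv k (r n) = (\<lambda>x. conv k (conv k (conv k (g n))) x - of_real l * conv k (g n) x)"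
        unfolding r_def[abs_def]
        by (rule ext) (simp add: conv_diff conv_cmult k(1) ucc g(1) uc_mult)
      then show ?thesis
        by (simp add: conv_diff conv_cmult k(1) ucc g(1) uc_mult uc_conv)
    qed
    have "(\<lambda>n. conv k (conv k (r (q n))) x) \<longlonglongrightarrow> 0"
      using LIMSEQ_subseq_LIMSEQ[OF conv_r_lim q] by (simp add: o_def)
    from LIMSEQ_unique[OF L1 this[unfolded r_eq]]
    have "conv k (conv k h) x - of_real l * h x = 0" .
    then show ?thesis by simp
  qed
  \<comment> \<open>Otherwise the twofold convolutions tend to 0 uniformly along \<open>q\<close>,
    and so does their pairing with \<open>g (q n)\<close>, which is
    \<open>nsq (conv k (g (q n)))\<close> and tends to \<open>l\<close>.\<close>
  have "\<exists>a. h a \<noteq> 0"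
  proof (rule ccontr)
    assume "\<not> (\<exists>a. h a \<noteq> 0)"
    then have h0: "h = (\<lambda>_. 0)" by auto
    have "\<forall>\<^sub>F n in sequentially. \<forall>x\<in>UNIV. dist (conv k (conv k (g (q n))) x) (h x) < l / 2"
      using uniform_limitD[OF h(1), of "l / 2"] l by simp
    moreover have "\<forall>\<^sub>F n in sequentially. l / 2 < nsq (conv k (g (q n)))"
      using order_tendstoD(1)[OF lim_q, of "l / 2"] l by simp
    ultimately have "\<forall>\<^sub>F n in sequentially. False"
    proof eventually_elim
      case (elim n)
      have "mean (\<lambda>x. conv k (conv k (g (q n))) x * cnj (g (q n) x)) =
          mean (\<lambda>x. conv k (g (q n)) x * cnj (conv k (g (q n)) x))"
        by (rule conv_selfadjoint[OF k(1,2) ucc(1) g(1)])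
      then have "nsq (conv k (g (q n))) = Re (mean (\<lambda>x. conv k (conv k (g (q n))) x * cnj (g (q n) x)))"
        by (simp add: nsq_def)
      also have "\<dots> \<le> norm (mean (\<lambda>x. conv k (conv k (g (q n))) x * cnj (g (q n) x)))"
        by (rule complex_Re_le_cmod)
      also have "\<dots> \<le> l / 2 * (1 + nsq (\<lambda>x. cnj (g (q n) x)) / 1) / 2"
        by (rule norm_mean_mult_le) (use elim(1) ucc g(1) h0 in \<open>auto intro: less_imp_le\<close>)
      also have "nsq (\<lambda>x. cnj (g (q n) x)) = nsq (g (q n))" by (simp add: nsq_def mult.commute)
      also have "l / 2 * (1 + nsq (g (q n)) / 1) / 2 \<le> l / 2 * (1 + 1 / 1) / 2"
        using l g(2)[of "q n"] by (intro divide_right_mono mult_left_mono add_left_mono) auto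
      finally show False using elim(2) by simp
    qed
    then show False by simp
  qed
  then obtain b where b: "h b \<noteq> 0" by blast
  \<comment> \<open>Convolution commutes with translation, so a translate moves a nonzero value of
    \<open>h\<close> to the prescribed point \<open>a\<close>.\<close>
  show thesis
  proof (rule that[of l "\<lambda>x. h (x + (b - a))"])
    show "conv k (conv k (\<lambda>x. h (x + (b - a)))) x = of_real l * h (x + (b - a))" for x
    proof -
      have "conv k (\<lambda>x. h (x + (b - a))) = (\<lambda>x. conv k h (x + (b - a)))"
        using conv_shift[OF k(1) h(2)] by blast
      then show ?thesis using conv_shift[OF k(1) uc_conv[OF k(1) h(2)]] eigen by simp
    qed
  qed (use l h(2) b in auto)
qed

section \<open>Positive definite eigenfunctions and characters\<close>

definition corr :: "('g \<Rightarrow> complex) \<Rightarrow> ('g \<Rightarrow> complex) \<Rightarrow> 'g \<Rightarrow> complex" where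
  "corr f g x = mean (\<lambda>y. f (x + y) * cnj (g y))"

lemma uc_corr [intro]: "uc f \<Longrightarrow> uc g \<Longrightarrow> uc (corr f g)"
  unfolding corr_def[abs_def]
  by (rule bi_uc_Fubini(2)[of "\<lambda>y x. f (x + y) * cnj (g y)"])
    (subst add.commute, intro bi_uc_mult bi_uc_add bi_uc_fst uc_cnj)

lemma conv_corr:
  assumes k: "uc k" and f: "uc f" and g: "uc g"
  shows "conv k (corr f g) x = corr (conv k f) g x"
proof -
  have fg: "uc (\<lambda>z. f (y + z) * cnj (g z))" for y using f g by (intro uc_mult uc_shift(2) uc_cnj)
  have kf: "uc (\<lambda>y. k (x - y) * f (y + z))" for z by (rule uc_conv_arg[OF k uc_shift(1)[OF f]])
  have "conv k (corr f g) x = mean (\<lambda>y. mean (\<lambda>z. k (x - y) * (f (y + z) * cnj (g z))))"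
    unfolding conv_def corr_def using mean_cmult[OF fg] by simp
  also have "\<dots> = mean (\<lambda>z. mean (\<lambda>y. k (x - y) * (f (y + z) * cnj (g z))))"
    using f g by (intro bi_uc_Fubini(1)[symmetric] bi_uc_mult bi_uc_add bi_uc_snd bi_uc_fst uc_cnj uc_shift(4)[OF k])
  also have "\<dots> = mean (\<lambda>z. conv k f (x + z) * cnj (g z))"
  proof -
    have "mean (\<lambda>y. k (x - y) * (f (y + z) * cnj (g z))) = conv k f (x + z) * cnj (g z)" for z
      using mean_cmult[OF kf, of "cnj (g z)" z] conv_shift[OF k f, of z x]
      by (simp add: conv_def mult_ac)
    then show ?thesis by simp
  qed
  finally show ?thesis by (simp add: corr_def)
qed

text \<open>On a finitely supported measure, the form of the autocorrelation is the squared norm of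
  the corresponding combination of translates of \<open>h\<close>. With \<open>conv_corr\<close>
  this yields positive definite eigenfunctions.\<close>

lemma posdef_corr:
  assumes h: "uc h"
  shows "posdef (corr h h)"
proof -
  have hh: "uc (\<lambda>y. h (x + y) * cnj (h (z + y)))" for x z
    using h by (intro uc_mult uc_cnj uc_shift(2))
  have diff: "corr h h (x - z) = mean (\<lambda>y. h (x + y) * cnj (h (z + y)))" for x z
    using mean_shift[OF uc_mult[OF uc_shift(2)[OF h] uc_cnj[OF h]], of "x - z" z]
    by (simp add: corr_def add.commute)
  show ?thesis
    unfolding posdef_def
  proof (intro conjI allI)
    fix x
    show "corr h h (- x) = cnj (corr h h x)"
      using diff[of 0 x] mean_cnj[OF hh, of x 0] by (simp add: corr_def mult.commute)
  next
    fix L :: "(complex \<times> 'g) list"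
    define s where "s y = (\<Sum>p\<leftarrow>L. fst p * h (snd p + y))" for y
    have ucs: "uc s" unfolding s_def[abs_def] using h by (intro uc_sum_list uc_mult uc_const uc_shift(2))
    have "form (corr h h) L L =
        (\<Sum>p\<leftarrow>L. \<Sum>q\<leftarrow>L. mean (\<lambda>y. fst p * cnj (fst q) * (h (snd p + y) * cnj (h (snd q + y)))))"
      unfolding form_def diff by (simp add: mean_cmult[OF hh])
    also have "\<dots> = (\<Sum>p\<leftarrow>L. mean (\<lambda>y. \<Sum>q\<leftarrow>L. fst p * cnj (fst q) * (h (snd p + y) * cnj (h (snd q + y)))))"
      by (subst mean_sum_list) (intro uc_mult uc_const hh, rule refl)
    also have "\<dots> = mean (\<lambda>y. \<Sum>p\<leftarrow>L. \<Sum>q\<leftarrow>L. fst p * cnj (fst q) * (h (snd p + y) * cnj (h (snd q + y))))"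
      by (subst mean_sum_list) (intro uc_sum_list uc_mult uc_const hh, rule refl)
    also have "(\<lambda>y. \<Sum>p\<leftarrow>L. \<Sum>q\<leftarrow>L. fst p * cnj (fst q) * (h (snd p + y) * cnj (h (snd q + y)))) =
        (\<lambda>y. s y * cnj (s y))"
    proof
      fix y
      have cs: "cnj (\<Sum>q\<leftarrow>K. g q) = (\<Sum>q\<leftarrow>K. cnj (g q))" for K and g :: "complex \<times> 'g \<Rightarrow> complex"
        by (induction K) simp_all
      show "(\<Sum>p\<leftarrow>L. \<Sum>q\<leftarrow>L. fst p * cnj (fst q) * (h (snd p + y) * cnj (h (snd q + y)))) = s y * cnj (s y)"
        unfolding s_def cs sum_list_mult_sum_list by (simp add: mult_ac)
    qed
    finally show "0 \<le> Re (form (corr h h) L L)"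
      using nsq_nonneg[OF ucs] by (simp add: nsq_def)
  qed
qed

text \<open>Strict convexity of the Hilbert norm: \<open>nsq\<close> of the mixture falls short of
  the mixture of the values by \<open>t * (1 - t)\<close> times the squared norm of the
  difference.\<close>

lemma nsq_convex:
  assumes f: "uc f" and g: "uc g" and "0 < t" "t < 1"
    and "nsq f \<le> J" "nsq g \<le> J" "J \<le> nsq (\<lambda>x. of_real t * f x + of_real (1 - t) * g x)"
  shows "f x = g x"
proof (rule ccontr)
  assume "f x \<noteq> g x"
  then have pos: "0 < nsq (\<lambda>x. f x - of_real 1 * g x)"
    using nsq_pos[of "\<lambda>x. f x - of_real 1 * g x" x] f g by (simp add: uc_diff)
  define m where "m = Re (mean (\<lambda>x. f x * cnj (g x)))"
  have 1: "nsq (\<lambda>x. f x - of_real 1 * g x) = nsq f - 2 * m + nsq g"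
    using nsq_diff_scaled[OF f g, of 1] by (simp add: m_def)
  have tf: "uc (\<lambda>x. of_real t * f x)" using f by (intro uc_mult uc_const)
  have "mean (\<lambda>x. of_real t * f x * cnj (g x)) = of_real t * mean (\<lambda>x. f x * cnj (g x))"
    using mean_cmult[OF uc_mult[OF f uc_cnj[OF g]], of "of_real t"] by (simp add: mult.assoc)
  then have "nsq (\<lambda>x. of_real t * f x + of_real (1 - t) * g x) = t\<^sup>2 * nsq f + 2 * t * (1 - t) * m + (1 - t)\<^sup>2 * nsq g"
    using nsq_diff_scaled[OF tf g, of "- (1 - t)"] nsq_cmult[OF f, of "of_real t"] assms(3,4)
    by (simp add: m_def power2_eq_square algebra_simps)
  also have "\<dots> = t * nsq f + (1 - t) * nsq g - t * (1 - t) * (nsq f - 2 * m + nsq g)"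
    by (simp add: power2_eq_square algebra_simps)
  also have "\<dots> < t * J + (1 - t) * J"
  proof -
    have "t * nsq f \<le> t * J" "(1 - t) * nsq g \<le> (1 - t) * J" using assms by (auto intro: mult_left_mono)
    moreover have "0 < t * (1 - t) * (nsq f - 2 * m + nsq g)" using pos 1 assms(3,4) by simp
    ultimately show ?thesis by linarith
  qed
  finally show False using assms(7) by (simp add: algebra_simps)
qed

text \<open>\<open>E\<close> is the convex set of normalized positive definite eigenfunctions. The
  eigenvalue equation makes it equicontinuous, hence \<open>nsq\<close> attains its maximum; by
  strict convexity the maximizer is extreme. Two opposite perturbations by translates stay in
  \<open>E\<close> after normalization and mix to the maximizer, so both equal it, and this leads to
  the functional equation of a character.\<close>

lemma eigencharacter:
  assumes k: "uc k" "\<And>x. k (- x) = cnj (k x)" "k 0 \<noteq> 0"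
  obtains l \<xi> where "l > 0" "uc \<xi>" "\<And>x. conv k (conv k \<xi>) x = of_real l * \<xi> x"
    "\<And>x y. \<xi> (x + y) = \<xi> x * \<xi> y" "\<And>x. norm (\<xi> x) = 1"
proof -
  obtain l h where l: "l > 0" and h: "uc h" "h 0 \<noteq> 0" "\<And>x. conv k (conv k h) x = of_real l * h x"
    using eigenfunction[OF k] by metis
  obtain K where K: "K > 0" "\<And>x. norm (k x) \<le> K" using uc_bounded[OF k(1)] by blast
  define E where "E = {f. uc f \<and> posdef f \<and> f 0 = 1 \<and> (\<forall>x. conv k (conv k f) x = of_real l * f x)}"
  have E_norm: "norm (f x) \<le> 1" if "f \<in> E" for f x
    using posdef_norm_le(1)[of f x] that unfolding E_def by simp
  have E_scale: "(\<lambda>x. of_real (1 / t) * f x) \<in> E"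
    if f: "uc f" "posdef f" "f 0 = of_real t" "t > 0" "\<And>x. conv k (conv k f) x = of_real l * f x" for f t
  proof -
    have "conv k (\<lambda>x. of_real (1 / t) * f x) = (\<lambda>x. of_real (1 / t) * conv k f x)"
      by (rule ext) (rule conv_cmult[OF k(1) f(1)])
    then have "conv k (conv k (\<lambda>x. of_real (1 / t) * f x)) x = of_real l * (of_real (1 / t) * f x)" for x
      using conv_cmult[OF k(1) uc_conv[OF k(1) f(1)], of "of_real (1 / t)" x] f(5)[of x] by simp
    moreover have "posdef (\<lambda>x. of_real (1 / t) * f x)" by (rule posdef_scale) (use f in auto)
    moreover have "uc (\<lambda>x. of_real (1 / t) * f x)" using f(1) by (intro uc_mult uc_const)
    ultimately show ?thesis using f(3,4) unfolding E_def by simp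
  qed
  have "(\<lambda>x. of_real (1 / nsq h) * corr h h x) \<in> E"
  proof (rule E_scale)
    show "uc (corr h h)" "posdef (corr h h)" using h(1) by (auto intro: posdef_corr)
    show "nsq h > 0" by (rule nsq_pos[OF h(1,2)])
    show "corr h h 0 = of_real (nsq h)"
      using posdef_norm_le(2)[OF posdef_corr[OF h(1)]] by (simp add: corr_def nsq_def)
    fix x
    have "conv k (corr h h) = corr (conv k h) h" using conv_corr[OF k(1) h(1) h(1)] by blast
    then have "conv k (conv k (corr h h)) x = corr (conv k (conv k h)) h x"
      using conv_corr[OF k(1) uc_conv[OF k(1) h(1)] h(1)] by simp
    also have "\<dots> = mean (\<lambda>y. of_real l * (h (x + y) * cnj (h y)))" by (simp add: corr_def h(3) mult.assoc)
    also have "\<dots> = of_real l * corr h h x"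
      unfolding corr_def using h(1) by (intro mean_cmult uc_mult uc_shift(2) uc_cnj)
    finally show "conv k (conv k (corr h h)) x = of_real l * corr h h x" .
  qed
  then have Ene: "E \<noteq> {}" by blast
  define J where "J = Sup (nsq ` E)"
  have bdd: "bdd_above (nsq ` E)"
    unfolding bdd_above_def
  proof (intro exI ballI)
    fix y assume "y \<in> nsq ` E"
    then obtain f where f: "f \<in> E" "y = nsq f" by blast
    then have "uc f" unfolding E_def by blast
    then show "y \<le> 1\<^sup>2" unfolding f(2) by (rule nsq_le) (rule E_norm[OF f(1)])
  qed
  have le_J: "nsq f \<le> J" if "f \<in> E" for f
    unfolding J_def using that by (intro cSup_upper bdd) auto
  have "\<exists>f. f \<in> E \<and> J - 1 / real (Suc n) < nsq f" for n
  proof -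
    have "J - 1 / real (Suc n) < Sup (nsq ` E)" by (simp add: J_def)
    then show ?thesis using less_cSupD[of "nsq ` E"] Ene by blast
  qed
  then obtain f where f: "\<And>n. f n \<in> E" "\<And>n. J - 1 / real (Suc n) < nsq (f n)" by metis
  have ucf: "uc (f n)" for n using f(1) unfolding E_def by blast
  have lim: "(\<lambda>n. nsq (f n)) \<longlonglongrightarrow> J"
  proof (rule tendsto_sandwich[OF always_eventually always_eventually])
    show "\<forall>n. J - 1 / real (Suc n) \<le> nsq (f n)" using f(2) less_imp_le by blast
    show "\<forall>n. nsq (f n) \<le> J" using le_J f(1) by blast
    show "(\<lambda>n. J - 1 / real (Suc n)) \<longlonglongrightarrow> J"
      using tendsto_diff[OF tendsto_const LIMSEQ_inverse_real_of_nat, of J] by (simp add: inverse_eq_divide)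
  qed simp
  \<comment> \<open>Members of \<open>E\<close> equal \<open>1 / l\<close> times their twofold
    convolution and are bounded by 1, so the modulus of \<open>k\<close> serves for all of
    them.\<close>
  have equi: "\<exists>d>0. \<forall>n x y. N (x - y) < d \<longrightarrow> norm (f n x - f n y) < e" if e: "e > 0" for e
  proof -
    have "e * l / (2 * K) > 0" using e K l by simp
    then obtain d where d: "d > 0" "\<And>x y. N (x - y) < d \<Longrightarrow> norm (k x - k y) < e * l / (2 * K)"
      using ucD[OF k(1)] by blast
    have "norm (f n x - f n y) < e" if xy: "N (x - y) < d" for n x y
    proof -
      have "norm (mean (\<lambda>z. k (x - z) * conv k (f n) z) - mean (\<lambda>z. k (y - z) * conv k (f n) z)) \<le> e * l / (2 * K) * K"
      proof (rule norm_mean_diff_le)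
        fix z
        have "norm (conv k (f n) z) \<le> K * 1"
          by (rule norm_conv_le[OF k(1) ucf K(2) E_norm[OF f(1)]])
        moreover have "norm (k (x - z) - k (y - z)) \<le> e * l / (2 * K)" using d(2)[of "x - z" "y - z"] xy by simp
        ultimately have "norm (k (x - z) - k (y - z)) * norm (conv k (f n) z) \<le> e * l / (2 * K) * K"
          by (intro mult_mono) (use e K l in auto)
        then show "norm (k (x - z) * conv k (f n) z - k (y - z) * conv k (f n) z) \<le> e * l / (2 * K) * K"
          by (simp add: norm_mult flip: left_diff_distrib)
      qed (use k(1) ucf in auto)
      then have "norm (conv k (conv k (f n)) x - conv k (conv k (f n)) y) \<le> e * l / 2"
        using K by (simp add: conv_def)
      moreover have "conv k (conv k (f n)) x - conv k (conv k (f n)) y = of_real l * (f n x - f n y)"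
        using f(1)[of n] unfolding E_def by (simp add: algebra_simps)
      ultimately have "l * norm (f n x - f n y) \<le> e * l / 2" using l by (simp add: norm_mult)
      then have "norm (f n x - f n y) \<le> e / 2" using l by (simp add: field_simps)
      then show ?thesis using e by simp
    qed
    with d(1) show ?thesis by blast
  qed
  obtain q \<phi> where q: "strict_mono (q :: nat \<Rightarrow> nat)"
    and \<phi>: "uniform_limit UNIV (\<lambda>n. f (q n)) \<phi> sequentially" "uc \<phi>"
    using Arzela_Ascoli_uc[of f, OF E_norm[OF f(1)] equi] by auto
  have pt: "(\<lambda>n. f (q n) x) \<longlonglongrightarrow> \<phi> x" for x by (rule tendsto_uniform_limitI[OF \<phi>(1)]) simp
  have \<phi>E: "\<phi> \<in> E"
    unfolding E_def
  proof (intro CollectI conjI allI \<phi>(2))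
    show "posdef \<phi>" by (rule posdef_LIMSEQ[OF _ pt]) (use f(1) in \<open>auto simp: E_def\<close>)
    have "f (q n) 0 = 1" for n using f(1)[of "q n"] unfolding E_def by simp
    then show "\<phi> 0 = 1" using pt[of 0] by (simp add: LIMSEQ_const_iff)
    fix x
    have "uniform_limit UNIV (\<lambda>n. conv k (conv k (f (q n)))) (conv k (conv k \<phi>)) sequentially"
      by (intro conv_uniform_limit \<phi> k(1) uc_conv ucf)
    then have "(\<lambda>n. conv k (conv k (f (q n))) x) \<longlonglongrightarrow> conv k (conv k \<phi>) x"
      by (rule tendsto_uniform_limitI) simp
    moreover have "conv k (conv k (f (q n))) x = of_real l * f (q n) x" for n
      using f(1)[of "q n"] unfolding E_def by blast
    moreover have "(\<lambda>n. of_real l * f (q n) x) \<longlonglongrightarrow> of_real l * \<phi> x" by (intro tendsto_intros pt)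
    ultimately show "conv k (conv k \<phi>) x = of_real l * \<phi> x" by (simp add: LIMSEQ_unique)
  qed
  have \<phi>0: "\<phi> 0 = 1" and pd: "posdef \<phi>" and eig: "\<And>x. conv k (conv k \<phi>) x = of_real l * \<phi> x"
    using \<phi>E unfolding E_def by auto
  have "(\<lambda>n. nsq (f (q n))) \<longlonglongrightarrow> nsq \<phi>"
    by (rule nsq_uniform_limit[OF \<phi>(1) ucf \<phi>(2) E_norm[OF f(1)]])
  moreover have "(\<lambda>n. nsq (f (q n))) \<longlonglongrightarrow> J"
    using LIMSEQ_subseq_LIMSEQ[OF lim q] by (simp add: o_def)
  ultimately have max: "nsq \<phi> = J" by (rule LIMSEQ_unique)
  have herm: "\<phi> (- x) = cnj (\<phi> x)" for x using pd unfolding posdef_def by blast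
  have twist: "c * \<phi> (x + a) + cnj c * \<phi> (x - a) = of_real (2 * Re (c * \<phi> a)) * \<phi> x"
    if c: "norm c = 1" for c a x
  proof -
    define P where "P c x = \<phi> x + (1/4) * (c * \<phi> (x + a) + cnj c * \<phi> (x - a))" for c x
    have ucP: "uc (P c)" for c unfolding P_def[abs_def]
      by (intro uc_add uc_mult uc_const uc_shift(1,3) \<phi>(2))
    have P0: "P c 0 = of_real (1 + Re (c * \<phi> a) / 2)" for c
      using herm[of a] by (simp add: P_def \<phi>0 complex_eq_iff)
    have ab: "\<bar>Re (c * \<phi> a)\<bar> \<le> 1" if "norm c = 1" for c
      using abs_Re_le_cmod[of "c * \<phi> a"] E_norm[OF \<phi>E, of a] that by (simp add: norm_mult)
    have convP: "conv k (conv k (P c)) x = of_real l * P c x" for c x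
    proof -
      have conv_sh: "conv k (\<lambda>x. g (x + b)) = (\<lambda>x. conv k g (x + b))" if "uc g" for g b
        using conv_shift[OF k(1) that] by blast
      have conv_sh': "conv k (\<lambda>x. g (x - b)) = (\<lambda>x. conv k g (x - b))" if "uc g" for g b
        using conv_sh[OF that, of "- b"] by simp
      have ucs: "uc (\<lambda>x. g (x + b))" "uc (\<lambda>x. g (x - b))" "uc (\<lambda>x. d * g x)" if "uc g" for g :: "'g \<Rightarrow> complex" and b d
        using that by (auto intro: uc_mult)
      have step: "conv k (\<lambda>x. g x + (1/4) * (c * g (x + a) + cnj c * g (x - a))) =
          (\<lambda>x. conv k g x + (1/4) * (c * conv k g (x + a) + cnj c * conv k g (x - a)))" if "uc g" for g
        by (rule ext) (simp add: conv_add conv_cmult conv_sh[OF that] conv_sh'[OF that] k(1) ucs uc_add that del: times_divide_eq_left)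
      show ?thesis
        unfolding P_def[abs_def] step[OF \<phi>(2)] step[OF uc_conv[OF k(1) \<phi>(2)]]
        by (simp add: eig algebra_simps)
    qed
    have inE: "(\<lambda>x. of_real (1 / (1 + Re (c * \<phi> a) / 2)) * P c x) \<in> E" if "norm c = 1" for c
    proof (rule E_scale)
      show "posdef (P c)" unfolding P_def[abs_def] by (rule posdef_perturb[OF pd that])
      show "P c 0 = of_real (1 + Re (c * \<phi> a) / 2)" by (rule P0)
      show "0 < 1 + Re (c * \<phi> a) / 2" using ab[OF that] by linarith
    qed (rule ucP convP)+
    define s where "s = Re (c * \<phi> a)"
    have s: "\<bar>s\<bar> \<le> 1" unfolding s_def by (rule ab[OF c])
    define F where "F x = of_real (1 / (1 + s / 2)) * P c x" for x
    define G where "G x = of_real (1 / (1 - s / 2)) * P (- c) x" for x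
    have F: "F \<in> E" unfolding F_def[abs_def] s_def by (rule inE[OF c])
    have "1 - s / 2 = 1 + Re (- c * \<phi> a) / 2" by (simp add: s_def field_simps)
    then have G: "G \<in> E" unfolding G_def[abs_def] by (simp only:) (rule inE, use c in simp)
    \<comment> \<open>The weights are proportional to the values of \<open>P c\<close> and
      \<open>P (- c)\<close> at 0. The normalizing factors cancel, and so do the opposite
      perturbations, which leaves \<open>\<phi>\<close>.\<close>
    define t where "t = (1 + s / 2) / 2"
    have t: "0 < t" "t < 1" using s unfolding t_def by (auto simp: abs_le_iff)
    have mix: "(\<lambda>x. of_real t * F x + of_real (1 - t) * G x) = \<phi>"
    proof
      fix x
      have "t * (1 / (1 + s / 2)) = 1 / 2" "(1 - t) * (1 / (1 - s / 2)) = 1 / 2"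
        using s unfolding t_def by (auto simp: field_simps)
      then have FG: "of_real t * F x = of_real (1/2) * P c x" "of_real (1 - t) * G x = of_real (1/2) * P (- c) x"
        unfolding F_def G_def by (metis (no_types) mult.assoc of_real_mult)+
      show "of_real t * F x + of_real (1 - t) * G x = \<phi> x"
        unfolding FG by (simp add: P_def algebra_simps)
    qed
    have FG: "F x = G x" for x
      by (rule nsq_convex[where t = t and J = J]) (use F G t le_J max mix in \<open>auto simp: E_def\<close>)
    have "F x = \<phi> x" using fun_cong[OF mix, of x] FG[of x] by (simp add: algebra_simps)
    then have Pc: "P c x = of_real (1 + s / 2) * \<phi> x" using s unfolding F_def by (auto simp: field_simps complex_eq_iff)
    have "c * \<phi> (x + a) + cnj c * \<phi> (x - a) = 4 * (P c x - \<phi> x)" by (simp add: P_def)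
    also have "\<dots> = of_real (2 * s) * \<phi> x" unfolding Pc by (simp add: algebra_simps)
    finally show ?thesis unfolding s_def .
  qed
  \<comment> \<open>\<open>c = 1\<close> gives the sum of \<open>\<phi> (x + a)\<close> and
    \<open>\<phi> (x - a)\<close>, \<open>c = \<i>\<close> their difference; together they eliminate
    \<open>\<phi> (x - a)\<close>.\<close>
  have hom: "\<phi> (x + a) = \<phi> x * \<phi> a" for x a
    using twist[of 1 x a] twist[of \<i> x a] by (simp add: complex_eq_iff algebra_simps)
  have "norm (\<phi> x) = 1" for x
  proof -
    have "\<phi> x * cnj (\<phi> x) = 1" using hom[of x "- x"] by (simp add: herm \<phi>0)
    then have "(norm (\<phi> x))\<^sup>2 = 1" by (metis complex_norm_square of_real_eq_1_iff)
    then show ?thesis by (simp add: power2_eq_1_iff) (metis norm_ge_zero not_one_le_zero neg_0_le_iff_le)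
  qed
  with l \<phi>(2) eig hom show thesis using that by blast
qed

text \<open>The kernel \<open>k\<close> is chosen such that its Fourier coefficient at a character \<open>\<xi>\<close> has the factor \<open>1 - Re (\<xi> a)\<close>.\<close>

theorem separating_character:
  assumes a: "N a > 0"
  obtains \<xi> where "uc \<xi>" "\<And>x y. \<xi> (x + y) = \<xi> x * \<xi> y" "\<And>x. norm (\<xi> x) = 1" "\<xi> a \<noteq> (1::complex)"
proof -
  have ucN: "uc N" unfolding uc_def
  proof (intro allI impI)
    fix e :: real assume "e > 0"
    have "norm (N x - N y) \<le> N (x - y)" for x y
      using triangle[of "x - y" y] triangle[of "y - x" x] commute[of x y] by simp
    then show "\<exists>d>0. \<forall>x y. N (x - y) < d \<longrightarrow> norm (N x - N y) < e"
      using \<open>e > 0\<close> by (metis order_le_less_trans)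
  qed
  \<comment> \<open>A tent of height 1 at 0 that vanishes where \<open>N x \<ge> N a\<close>, in
    particular at \<open>a\<close> and \<open>- a\<close>. Hence \<open>k 0 = 2\<close>.\<close>
  define b where "b x = complex_of_real (max 0 (1 - N x / N a))" for x
  have ucb: "uc b"
  proof -
    have eq: "b x = complex_of_real ((1 - (1 / N a) * N x + norm (1 - (1 / N a) * N x)) * (1/2))" for x
      by (simp add: b_def max_def)
    show ?thesis unfolding eq[abs_def]
      by (intro uc_of_real uc_mult uc_add uc_diff uc_norm uc_const ucN)
  qed
  define k where "k x = 2 * b x - b (x - a) - b (x + a)" for x
  have k1: "uc k" unfolding k_def[abs_def] by (intro uc_diff uc_mult uc_const uc_shift(1,3) ucb)
  have b_minus: "b (- x) = b x" "cnj (b x) = b x" for x by (simp_all add: b_def)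
  have "k (- x) = cnj (k x)" for x
    using b_minus(1)[of "x + a"] b_minus(1)[of "x - a"] by (simp add: k_def b_minus(2) b_minus(1))
  moreover have "k 0 \<noteq> 0" using a b_minus(1)[of a] by (simp add: k_def b_def)
  ultimately obtain l \<xi> where l: "l > 0" and \<xi>: "uc \<xi>" "\<And>x. conv k (conv k \<xi>) x = of_real l * \<xi> x"
    "\<And>x y. \<xi> (x + y) = \<xi> x * \<xi> y" "\<And>x. norm (\<xi> x) = 1"
    using eigencharacter[OF k1] by metis
  have "\<xi> a \<noteq> 1"
  proof
    assume a1: "\<xi> a = 1"
    have inv: "\<xi> (y + a) = \<xi> y" "\<xi> (y - a) = \<xi> y" for y
      using \<xi>(3)[of y a] \<xi>(3)[of "y - a" a] a1 by auto
    \<comment> \<open>As \<open>\<xi>\<close> has period \<open>a\<close>, the translates of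
      \<open>b\<close> have the same convolution with \<open>\<xi>\<close>, and the coefficients 2,
      -1, -1 cancel.\<close>
    have "conv k \<xi> x = 0" for x
    proof -
      have F: "uc (\<lambda>y. b (c - y) * \<xi> y)" for c by (rule uc_conv_arg[OF ucb \<xi>(1)])
      have "mean (\<lambda>y. b (x - a - y) * \<xi> y) = mean (\<lambda>y. b (x - y) * \<xi> y)"
        using mean_shift[OF F, of "x - a" "- a"] inv by simp
      moreover have "mean (\<lambda>y. b (x + a - y) * \<xi> y) = mean (\<lambda>y. b (x - y) * \<xi> y)"
        using mean_shift[OF F, of "x + a" a] inv by simp
      moreover have "(\<lambda>y. k (x - y) * \<xi> y) =
          (\<lambda>y. 2 * (b (x - y) * \<xi> y) - b (x - a - y) * \<xi> y - b (x + a - y) * \<xi> y)"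
        by (simp add: fun_eq_iff k_def algebra_simps)
      ultimately show ?thesis
        unfolding conv_def using F by (simp add: mean_diff mean_cmult uc_diff uc_mult)
    qed
    then have "conv k (conv k \<xi>) 0 = 0" by (simp add: conv_def)
    moreover have "\<xi> 0 \<noteq> 0" using \<xi>(4)[of 0] by auto
    ultimately show False using \<xi>(2)[of 0] l by simp
  qed
  then show thesis using that \<xi> by blast
qed

end

section \<open>Pseudonorms and finitely generated character groups\<close>

text \<open>\<open>x\<close> is the entry at which the partial sums reach \<open>t\<close>; it is
  left out of both parts, so its own weight is not limited by \<open>t\<close>. The threshold is
  arbitrary because the induction lowers it by each entry passed.\<close>

lemma list_split_at_half:
  fixes f :: "'a \<Rightarrow> real"
  assumes "xs \<noteq> []" "\<And>x. 0 \<le> f x" "0 \<le> t" "t \<le> (\<Sum>x\<leftarrow>xs. f x)"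
  shows "\<exists>ys x zs. xs = ys @ x # zs \<and> (\<Sum>x\<leftarrow>ys. f x) \<le> t \<and> (\<Sum>x\<leftarrow>zs. f x) \<le> (\<Sum>x\<leftarrow>xs. f x) - t"
  using assms
proof (induction xs arbitrary: t)
  case Nil
  then show ?case by simp
next
  case (Cons a xs)
  show ?case
  proof (cases "t \<le> f a")
    case True
    then show ?thesis using Cons.prems by (intro exI[of _ "[]"] exI[of _ a] exI[of _ xs]) simp
  next
    case False
    have "xs \<noteq> []" using False Cons.prems by auto
    moreover have "0 \<le> t - f a" "t - f a \<le> (\<Sum>x\<leftarrow>xs. f x)" using Cons.prems False by auto
    ultimately obtain ys x zs where "xs = ys @ x # zs" "(\<Sum>x\<leftarrow>ys. f x) \<le> t - f a"
      "(\<Sum>x\<leftarrow>zs. f x) \<le> (\<Sum>x\<leftarrow>xs. f x) - (t - f a)"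
      using Cons.IH[of "t - f a"] Cons.prems(2) by blast
    then show ?thesis by (intro exI[of _ "a # ys"] exI[of _ x] exI[of _ zs]) simp
  qed
qed

text \<open>Birkhoff and Kakutani: \<open>N x\<close> is the infimum of \<open>\<rho> x\<^sub>1 + \<dots> + \<rho> x\<^sub>n\<close> over all decompositions of \<open>x\<close>.
  It is not much smaller than \<open>\<rho> x\<close>, as one sees by cutting a decomposition into two halves of equal weight.\<close>

lemma pseudonorm_of_neighbourhoods:
  fixes V :: "nat \<Rightarrow> 'g::ab_group_add set"
  assumes zero: "\<And>n. 0 \<in> V n" and minus: "\<And>n x. x \<in> V n \<Longrightarrow> - x \<in> V n"
    and sum3: "\<And>n x y z. x \<in> V (Suc n) \<Longrightarrow> y \<in> V (Suc n) \<Longrightarrow> z \<in> V (Suc n) \<Longrightarrow> x + y + z \<in> V n"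
  obtains N :: "'g \<Rightarrow> real" where "N 0 = 0" "\<And>x. N (- x) = N x" "\<And>x y. N (x + y) \<le> N x + N y"
    "\<And>n x. x \<in> V n \<Longrightarrow> N x \<le> (1/2) ^ n" "\<And>n x. x \<notin> V n \<Longrightarrow> (1/2) ^ n \<le> N x"
proof -
  have "V (Suc n) \<subseteq> V n" for n using sum3[of _ n 0 0] zero by auto
  then have V_mono: "V n \<subseteq> V m" if "m \<le> n" for m n using lift_Suc_antimono_le[of V, OF _ that] by blast
  \<comment> \<open>The value 2 stands for points outside all \<open>V n\<close> and keeps the set
    nonempty. It is twice the value for \<open>n = 0\<close>, so the comparison in
    \<open>\<rho>_less\<close> excludes it.\<close>
  define R :: "'g \<Rightarrow> real set" where "R x = insert 2 {(1/2) ^ n | n. x \<in> V n}" for x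
  define \<rho> :: "'g \<Rightarrow> real" where "\<rho> x = Inf (R x)" for x
  have R_nonneg: "0 \<le> r" if "r \<in> R x" for r x using that by (auto simp: R_def)
  have bddR: "bdd_below (R x)" for x unfolding bdd_below_def using R_nonneg by blast
  have \<rho>_nonneg: "0 \<le> \<rho> x" for x
    unfolding \<rho>_def by (rule cInf_greatest) (use R_nonneg in \<open>auto simp: R_def\<close>)
  have \<rho>_le: "\<rho> x \<le> (1/2) ^ n" if "x \<in> V n" for x n
    unfolding \<rho>_def by (rule cInf_lower[OF _ bddR]) (use that in \<open>auto simp: R_def\<close>)
  have \<rho>_minus: "\<rho> (- x) = \<rho> x" for x
  proof -
    have "x \<in> V n \<longleftrightarrow> - x \<in> V n" for n using minus[of x n] minus[of "- x" n] by auto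
    then show ?thesis by (simp add: \<rho>_def R_def)
  qed
  \<comment> \<open>The elements of \<open>R x\<close> are powers of 1/2 or the value 2, so one
    below \<open>2 * (1/2) ^ n\<close> is already at most \<open>(1/2) ^ n\<close>.\<close>
  have \<rho>_less: "x \<in> V n" if "\<rho> x < 2 * (1/2) ^ n" for x n
  proof -
    have ne: "R x \<noteq> {}" by (simp add: R_def)
    from cInf_lessD[OF ne that[unfolded \<rho>_def]]
    obtain r where r: "r \<in> R x" "r < 2 * (1/2) ^ n" ..
    have "r \<noteq> 2"
    proof
      assume "r = 2"
      moreover have "(1/2::real) ^ n \<le> 1" by (rule power_le_one) auto
      ultimately show False using r(2) by simp
    qed
    then obtain m where m: "x \<in> V m" "r = (1/2) ^ m" using r(1) by (auto simp: R_def)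
    have "n \<le> m"
    proof (rule ccontr)
      assume "\<not> n \<le> m"
      then have "Suc m \<le> n" by simp
      then have "(1/2::real) ^ n \<le> (1/2) ^ Suc m" by (rule power_decreasing) auto
      then show False using r(2) m(2) by simp
    qed
    then show ?thesis using V_mono m(1) by blast
  qed
  \<comment> \<open>The factor 2 in \<open>\<rho>_less\<close> is spent here: the middle entry is
    only bounded by the whole weight, which is below \<open>2 * (1/2) ^ Suc n\<close>, and still
    lies in \<open>V (Suc n)\<close>. So \<open>sum3\<close> applies to the two halves and this
    entry.\<close>
  have chain: "sum_list xs \<in> V n" if "(\<Sum>x\<leftarrow>xs. \<rho> x) < (1/2) ^ n" for xs n
    using that
  proof (induction "length xs" arbitrary: xs n rule: less_induct)
    case less
    show ?case
    proof (cases "xs = []")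
      case True
      then show ?thesis using zero by simp
    next
      case False
      define s where "s = (\<Sum>x\<leftarrow>xs. \<rho> x)"
      have s: "0 \<le> s" unfolding s_def by (rule sum_list_nonneg) (use \<rho>_nonneg in auto)
      obtain ys x zs where xs: "xs = ys @ x # zs" "(\<Sum>x\<leftarrow>ys. \<rho> x) \<le> s / 2" "(\<Sum>x\<leftarrow>zs. \<rho> x) \<le> s - s / 2"
        using list_split_at_half[of xs \<rho> "s / 2", OF False \<rho>_nonneg] s unfolding s_def[symmetric] by auto
      have nn: "0 \<le> (\<Sum>x\<leftarrow>us. \<rho> x)" for us by (rule sum_list_nonneg) (use \<rho>_nonneg in auto)
      have "sum_list ys \<in> V (Suc n)" "sum_list zs \<in> V (Suc n)"
      proof -
        have "s < (1/2) ^ n" using less.prems by (simp add: s_def)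
        then have "(\<Sum>x\<leftarrow>ys. \<rho> x) < (1/2) ^ Suc n" "(\<Sum>x\<leftarrow>zs. \<rho> x) < (1/2) ^ Suc n"
          using xs(2,3) by auto
        then show "sum_list ys \<in> V (Suc n)" "sum_list zs \<in> V (Suc n)"
          using xs(1) by (auto intro: less.hyps)
      qed
      moreover have "\<rho> x \<le> s" using nn[of ys] nn[of zs] by (simp add: s_def xs(1))
      then have "x \<in> V (Suc n)" using less.prems by (intro \<rho>_less) (simp add: s_def)
      ultimately show ?thesis using sum3[of "sum_list ys" n x "sum_list zs"] by (simp add: xs(1) add.assoc)
    qed
  qed
  define S where "S x = {(\<Sum>z\<leftarrow>xs. \<rho> z) | xs. sum_list xs = x}" for x
  define N where "N x = Inf (S x)" for x
  have S_I: "(\<Sum>z\<leftarrow>xs. \<rho> z) \<in> S (sum_list xs)" for xs unfolding S_def by blast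
  have Sne: "S x \<noteq> {}" for x using S_I[of "[x]"] by auto
  have S_nonneg: "0 \<le> r" if "r \<in> S x" for r x
    using that unfolding S_def by (auto intro!: sum_list_nonneg \<rho>_nonneg)
  have bddS: "bdd_below (S x)" for x unfolding bdd_below_def using S_nonneg by blast
  have N_le: "N (sum_list xs) \<le> (\<Sum>z\<leftarrow>xs. \<rho> z)" for xs
    unfolding N_def by (rule cInf_lower[OF S_I bddS])
  have N_less: "\<exists>xs. sum_list xs = x \<and> (\<Sum>z\<leftarrow>xs. \<rho> z) < e" if "N x < e" for x e
    using cInf_lessD[OF Sne that[unfolded N_def]] unfolding S_def by blast
  have N_nonneg: "0 \<le> N x" for x unfolding N_def by (rule cInf_greatest[OF Sne S_nonneg])
  have minus_le: "N (- x) \<le> N x" for x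
  proof (rule field_le_epsilon)
    fix e :: real assume "e > 0"
    then obtain xs where xs: "sum_list xs = x" "(\<Sum>z\<leftarrow>xs. \<rho> z) < N x + e" using N_less[of x "N x + e"] by auto
    have "sum_list (map uminus xs) = - sum_list xs" by (induction xs) simp_all
    then show "N (- x) \<le> N x + e" using N_le[of "map uminus xs"] xs by (simp add: o_def \<rho>_minus)
  qed
  show thesis
  proof (rule that[of N])
    show "N 0 = 0" using N_le[of "[]"] N_nonneg[of 0] by simp
    show "N (- x) = N x" for x using minus_le[of x] minus_le[of "- x"] by simp
    show "N (x + y) \<le> N x + N y" for x y
    proof (rule field_le_epsilon)
      fix e :: real assume "e > 0"
      obtain xs where xs: "sum_list xs = x" "(\<Sum>z\<leftarrow>xs. \<rho> z) < N x + e / 2"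
        using N_less[of x "N x + e / 2"] \<open>e > 0\<close> by auto
      obtain ys where ys: "sum_list ys = y" "(\<Sum>z\<leftarrow>ys. \<rho> z) < N y + e / 2"
        using N_less[of y "N y + e / 2"] \<open>e > 0\<close> by auto
      show "N (x + y) \<le> N x + N y + e" using N_le[of "xs @ ys"] xs ys by simp
    qed
    show "N x \<le> (1/2) ^ n" if "x \<in> V n" for n x using N_le[of "[x]"] \<rho>_le[OF that] by simp
    show "(1/2) ^ n \<le> N x" if "x \<notin> V n" for n x
    proof (rule ccontr)
      assume "\<not> (1/2) ^ n \<le> N x"
      then have "N x < (1/2) ^ n" by simp
      from N_less[OF this] show False using chain that by blast
    qed
  qed
qed

section \<open>Characters and the pseudonorms that they generate\<close>

definition is_char :: "('g::ab_group_add \<Rightarrow> complex) \<Rightarrow> bool" where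
  "is_char f \<longleftrightarrow> (\<forall>x y. f (x + y) = f x * f y) \<and> (\<forall>x. norm (f x) = 1)"

lemma is_char_props:
  assumes "is_char f"
  shows "f (x + y) = f x * f y" "norm (f x) = 1" "f 0 = 1" "f x * cnj (f x) = 1" "f (- x) = cnj (f x)" "f x \<noteq> 0"
    "f (x - y) = f x * cnj (f y)"
proof -
  have add: "f (x + y) = f x * f y" for x y using assms unfolding is_char_def by blast
  have n: "norm (f x) = 1" for x using assms unfolding is_char_def by blast
  show "f (x + y) = f x * f y" by (rule add)
  show "norm (f x) = 1" by (rule n)
  have nz: "f x \<noteq> 0" for x using n[of x] by auto
  show "f x \<noteq> 0" by (rule nz)
  show f0: "f 0 = 1" using add[of 0 0] nz[of 0] by simp
  have cc: "f x * cnj (f x) = 1" for x using n[of x] by (simp add: complex_norm_square[symmetric])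
  show "f x * cnj (f x) = 1" by (rule cc)
  have neg: "f (- x) = cnj (f x)" for x
    using add[of x "- x"] f0 cc[of x] nz[of x] by (metis add.right_inverse mult_left_cancel)
  show "f (- x) = cnj (f x)" by (rule neg)
  show "f (x - y) = f x * cnj (f y)" using add[of x "- y"] neg by simp
qed

lemma is_char_dist: "is_char f \<Longrightarrow> norm (f x - f y) = norm (f (x - y) - 1)"
proof -
  assume f: "is_char f"
  have "f x - f y = f y * (f (x - y) - 1)"
    using is_char_props(4)[OF f, of y] by (simp add: is_char_props(7)[OF f] algebra_simps)
  then show ?thesis using is_char_props(2)[OF f] by (simp add: norm_mult)
qed

text \<open>The values on \<open>Y\<close> are rounded to a finite net of the circle; only finitely
  many patterns occur, and one representative of each suffices.\<close>

lemma chars_totally_bounded: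
  assumes "finite Y" "\<And>f. f \<in> Y \<Longrightarrow> is_char f" "e > 0"
  shows "\<exists>F. finite F \<and> (\<forall>x. \<exists>y\<in>F. \<forall>f\<in>Y. norm (f x - f y) < e)"
proof -
  obtain Q where Q: "finite Q" "sphere (0::complex) 1 \<subseteq> (\<Union>z\<in>Q. ball z (e / 2))"
    using compact_imp_seq_compact[OF compact_sphere, of "0::complex" 1]
      seq_compact_imp_totally_bounded[of "sphere (0::complex) 1"] assms(3)
    by (metis half_gt_zero)
  have "\<exists>z. z \<in> Q \<and> norm (f x - z) < e / 2" if "f \<in> Y" for f x
    using Q(2) is_char_props(2)[OF assms(2)[OF that], of x] by (fastforce simp: dist_norm norm_minus_commute)
  then obtain q where q: "\<And>f x. f \<in> Y \<Longrightarrow> q f x \<in> Q" "\<And>f x. f \<in> Y \<Longrightarrow> norm (f x - q f x) < e / 2"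
    by metis
  define c where "c x = restrict (\<lambda>f. q f x) Y" for x
  have "range c \<subseteq> PiE Y (\<lambda>_. Q)" using q(1) unfolding c_def by auto
  then have fin: "finite (range c)" using finite_PiE[OF assms(1)] Q(1) finite_subset by metis
  define F where "F = inv_into UNIV c ` range c"
  have "\<exists>y\<in>F. \<forall>f\<in>Y. norm (f x - f y) < e" for x
  proof (intro bexI ballI)
    show "inv_into UNIV c (c x) \<in> F" unfolding F_def by blast
    fix f assume f: "f \<in> Y"
    have "c (inv_into UNIV c (c x)) = c x" by (simp add: f_inv_into_f)
    then have "c (inv_into UNIV c (c x)) f = c x f" by (rule fun_cong)
    then have "q f (inv_into UNIV c (c x)) = q f x" using f by (simp only: c_def restrict_apply if_True)
    then show "norm (f x - f (inv_into UNIV c (c x))) < e"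
      using q(2)[OF f, of x] q(2)[OF f, of "inv_into UNIV c (c x)"]
        norm_triangle_ineq4[of "f x - q f x" "f (inv_into UNIV c (c x)) - q f x"] by simp
  qed
  moreover have "finite F" unfolding F_def using fin by simp
  ultimately show ?thesis by blast
qed

lemma char_pseudonorm:
  assumes Y: "finite Y" "\<And>f. f \<in> Y \<Longrightarrow> is_char f"
  shows "bounded_pseudonorm (\<lambda>x. \<Sum>f\<in>Y. norm (f x - 1))"
proof
  show "(\<Sum>f\<in>Y. norm (f 0 - 1)) = 0" by (rule sum.neutral) (simp add: is_char_props(3)[OF Y(2)])
  fix x y
  show "(\<Sum>f\<in>Y. norm (f (- x) - 1)) = (\<Sum>f\<in>Y. norm (f x - 1))"
  proof (rule sum.cong[OF refl])
    fix f assume "f \<in> Y"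
    then have "f (- x) - 1 = cnj (f x - 1)" using is_char_props(5)[OF Y(2)] by simp
    then show "norm (f (- x) - 1) = norm (f x - 1)" by (simp only: complex_mod_cnj)
  qed
  show "(\<Sum>f\<in>Y. norm (f (x + y) - 1)) \<le> (\<Sum>f\<in>Y. norm (f x - 1)) + (\<Sum>f\<in>Y. norm (f y - 1))"
    unfolding sum.distrib[symmetric]
  proof (rule sum_mono)
    fix f assume f: "f \<in> Y"
    have "f (x + y) - 1 = f x * (f y - 1) + (f x - 1)"
      using is_char_props(1)[OF Y(2)[OF f]] by (simp add: algebra_simps)
    then have "norm (f (x + y) - 1) \<le> norm (f x * (f y - 1)) + norm (f x - 1)"
      by (simp only: norm_triangle_ineq)
    then show "norm (f (x + y) - 1) \<le> norm (f x - 1) + norm (f y - 1)"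
      using is_char_props(2)[OF Y(2)[OF f]] by (simp add: norm_mult)
  qed
next
  fix e :: real assume e: "e > 0"
  define d where "d = e / (real (card Y) + 1)"
  have d: "d > 0" using e by (simp add: d_def)
  obtain F where F: "finite F" "\<And>x. \<exists>y\<in>F. \<forall>f\<in>Y. norm (f x - f y) < d"
    using chars_totally_bounded[OF Y d] by blast
  have "\<exists>y\<in>F. (\<Sum>f\<in>Y. norm (f (x - y) - 1)) < e" for x
  proof -
    obtain y where y: "y \<in> F" "\<And>f. f \<in> Y \<Longrightarrow> norm (f x - f y) < d" using F(2) by blast
    have "(\<Sum>f\<in>Y. norm (f (x - y) - 1)) \<le> (\<Sum>f\<in>Y. d)"
      by (rule sum_mono) (use y(2) is_char_dist[OF Y(2)] in \<open>auto intro: less_imp_le\<close>)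
    also have "\<dots> < e" using e by (simp add: d_def field_simps)
    finally show ?thesis using y(1) by blast
  qed
  with F(1) show "\<exists>F. finite F \<and> (\<forall>x. \<exists>y\<in>F. (\<Sum>f\<in>Y. norm (f (x - y) - 1)) < e)" by blast
qed

text \<open>The function \<open>F\<close> in the proof is a Fejer-type kernel: it is a trigonometric polynomial over \<open>Z\<close>,
  hence orthogonal to \<open>c\<close>, and it concentrates where \<open>c\<close> is close to 1.\<close>

lemma char_mem_generated:
  assumes Y: "finite Y" "Y \<subseteq> Z" and Z: "\<And>f. f \<in> Z \<Longrightarrow> is_char f"
    and Z1: "(\<lambda>_. 1) \<in> Z" and Zmult: "\<And>f g. f \<in> Z \<Longrightarrow> g \<in> Z \<Longrightarrow> (\<lambda>x. f x * g x) \<in> Z"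
    and Zcnj: "\<And>f. f \<in> Z \<Longrightarrow> (\<lambda>x. cnj (f x)) \<in> Z"
    and c: "is_char c" and e: "e > 0"
    and near: "\<And>x. (\<And>f. f \<in> Y \<Longrightarrow> norm (f x - 1) < e) \<Longrightarrow> norm (c x - 1) \<le> 1/2"
  shows "c \<in> Z"
proof (rule ccontr)
  assume cZ: "c \<notin> Z"
  \<comment> \<open>The cut at 1 keeps the base \<open>r\<close> of the decay positive and the
    radius \<open>d\<close> at most 1.\<close>
  define e1 where "e1 = min e 1"
  have e1: "0 < e1" "e1 \<le> 1" "e1 \<le> e" using e by (auto simp: e1_def)
  have Ych: "is_char f" if "f \<in> Y" for f using Z Y that by blast
  \<comment> \<open>The character \<open>c\<close> is included so that it is \<open>uc\<close> and
    its products with \<open>uc\<close> functions have means.\<close>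
  define N where "N x = (\<Sum>f\<in>insert c Y. norm (f x - 1))" for x
  interpret bounded_pseudonorm N
    unfolding N_def[abs_def] by (rule char_pseudonorm) (use Y c Z in auto)
  have le_N: "norm (f x - 1) \<le> N x" if "f \<in> insert c Y" for f x
    unfolding N_def by (rule member_le_sum[OF that]) (use Y in auto)
  have ucY: "uc f" if f: "f \<in> insert c Y" for f
    unfolding uc_def
  proof (intro allI impI)
    fix e :: real assume "e > 0"
    have "is_char f" using f c Z Y by auto
    then have "norm (f x - f y) \<le> N (x - y)" for x y using le_N[OF f] by (simp add: is_char_dist)
    then show "\<exists>d>0. \<forall>x y. N (x - y) < d \<longrightarrow> norm (f x - f y) < e"
      using \<open>e > 0\<close> by (metis order_le_less_trans)
  qed
  have ucc: "uc c" by (rule ucY) simp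
  \<comment> \<open>For \<open>f\<close> in \<open>Y\<close> this is
    \<open>(1 + Re (f x)) / 2\<close>, with values between 0 and 1 and equal to 1 only where
    \<open>f x = 1\<close>, written as a trigonometric polynomial.\<close>
  define q where "q f x = (1/4) * (2 + f x + cnj (f x))" for f :: "'a \<Rightarrow> complex" and x
  have q_real: "q f x = of_real (1 - (norm (f x - 1))\<^sup>2 / 4)" if "f \<in> Y" for f x
  proof -
    have "complex_of_real ((norm (f x - 1))\<^sup>2) = (f x - 1) * cnj (f x - 1)" by (rule complex_norm_square)
    also have "\<dots> = 2 - f x - cnj (f x)"
      using is_char_props(4)[OF Ych[OF that], of x] by (simp add: algebra_simps)
    finally have eq: "complex_of_real ((norm (f x - 1))\<^sup>2) = 2 - f x - cnj (f x)" .
    have "q f x = 1 - (1/4) * (2 - f x - cnj (f x))" by (simp add: q_def algebra_simps)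
    also have "\<dots> = of_real (1 - (norm (f x - 1))\<^sup>2 / 4)" unfolding eq[symmetric] by simp
    finally show ?thesis .
  qed
  \<comment> \<open>Orthogonality to \<open>c\<close> is asked with all multipliers \<open>g\<close>
    in \<open>Z\<close> at once. The class is then closed under multiplication by
    \<open>q f\<close>, and the powers of the kernel need not be expanded.\<close>
  define L where "L = {f. uc f \<and> (\<forall>g\<in>Z. uc g \<longrightarrow> mean (\<lambda>x. f x * (g x * c x)) = 0)}"
  \<comment> \<open>A nontrivial character has mean 0, since a translation by \<open>a\<close>
    multiplies the mean by \<open>g a * c a\<close>. If the product of \<open>g\<close> and
    \<open>c\<close> were trivial, \<open>c\<close> would be the conjugate of \<open>g\<close> and
    lie in \<open>Z\<close>.\<close>
  have L1: "(\<lambda>_. 1) \<in> L"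
    unfolding L_def
  proof (intro CollectI conjI ballI impI uc_const)
    fix g assume g: "g \<in> Z" "uc g"
    have gc: "uc (\<lambda>x. g x * c x)" using g(2) ucc by (rule uc_mult)
    have "\<exists>a. g a * c a \<noteq> 1"
    proof (rule ccontr)
      assume "\<not> (\<exists>a. g a * c a \<noteq> 1)"
      then have "c x = cnj (g x)" for x
        using is_char_props(4)[OF Z[OF g(1)], of x] is_char_props(6)[OF Z[OF g(1)], of x]
        by (metis mult_left_cancel)
      then have "c = (\<lambda>x. cnj (g x))" by blast
      then show False using Zcnj[OF g(1)] cZ by simp
    qed
    then obtain a where a: "g a * c a \<noteq> 1" by blast
    have "mean (\<lambda>x. g x * c x) = mean (\<lambda>x. g a * c a * (g x * c x))"
      using mean_shift[OF gc, of a]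
      by (simp add: is_char_props(1)[OF Z[OF g(1)]] is_char_props(1)[OF c] mult_ac)
    also have "\<dots> = g a * c a * mean (\<lambda>x. g x * c x)" by (rule mean_cmult[OF gc])
    finally show "mean (\<lambda>x. 1 * (g x * c x)) = 0" using a by simp
  qed
  have Lq: "(\<lambda>x. q f x * h x) \<in> L" if f: "f \<in> Y" and h: "h \<in> L" for f h
    unfolding L_def
  proof (intro CollectI conjI ballI impI)
    have ucf: "uc f" using ucY f by blast
    have uch: "uc h" using h unfolding L_def by blast
    have fZ: "f \<in> Z" using f Y by blast
    show "uc (\<lambda>x. q f x * h x)"
      unfolding q_def by (intro uc_mult uc_add uc_const uc_cnj ucf uch)
    fix g assume g: "g \<in> Z" "uc g"
    have h0: "mean (\<lambda>x. h x * (g' x * c x)) = 0" if "g' \<in> Z" "uc g'" for g'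
      using h that unfolding L_def by blast
    have hu: "uc (\<lambda>x. h x * (g' x * c x))" if "uc g'" for g' using that uch ucc by (intro uc_mult)
    have u: "uc (\<lambda>x. f x * g x)" "uc (\<lambda>x. cnj (f x) * g x)" using ucf g(2) by (auto intro!: uc_mult)
    have z: "(\<lambda>x. f x * g x) \<in> Z" "(\<lambda>x. cnj (f x) * g x) \<in> Z" using Zmult Zcnj fZ g(1) by blast+
    have "mean (\<lambda>x. q f x * h x * (g x * c x)) = mean (\<lambda>x. (1/4) * (2 * (h x * (g x * c x))
        + h x * ((f x * g x) * c x) + h x * ((cnj (f x) * g x) * c x)))"
      by (rule arg_cong[of _ _ mean]) (simp add: fun_eq_iff q_def algebra_simps)
    also have "\<dots> = (1/4) * (2 * mean (\<lambda>x. h x * (g x * c x))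
        + mean (\<lambda>x. h x * ((f x * g x) * c x)) + mean (\<lambda>x. h x * ((cnj (f x) * g x) * c x)))"
      using hu[OF g(2)] hu[OF u(1)] hu[OF u(2)]
      by (simp only: mean_cmult mean_add uc_add uc_mult uc_const)
    also have "\<dots> = 0"
      by (simp only: h0[OF g] h0[OF z(1) u(1)] h0[OF z(2) u(2)]) simp
    finally show "mean (\<lambda>x. q f x * h x * (g x * c x)) = 0" .
  qed
  have Lprod: "(\<lambda>x. (\<Prod>f\<in>Y'. q f x) * h x) \<in> L" if "finite Y'" "Y' \<subseteq> Y" "h \<in> L" for Y' h
    using that
  proof (induction Y')
    case (insert f Y')
    then show ?case using Lq[of f "\<lambda>x. (\<Prod>f\<in>Y'. q f x) * h x"] by (simp add: mult.assoc)
  qed simp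
  define F where "F m x = (\<Prod>f\<in>Y. q f x) ^ m" for m x
  have FL: "F m \<in> L" for m
  proof (induction m)
    case 0
    then show ?case using L1 by (simp add: F_def[abs_def])
  next
    case (Suc m)
    then show ?case using Lprod[OF Y(1) subset_refl, of "F m"] by (simp add: F_def[abs_def])
  qed
  have ucF: "uc (F m)" for m using FL unfolding L_def by blast
  have MF: "mean (\<lambda>x. F m x * c x) = 0" for m using FL[of m] Z1 unfolding L_def by fastforce
  define R where "R m x = (\<Prod>f\<in>Y. 1 - (norm (f x - 1))\<^sup>2 / 4) ^ m" for m x
  have FR: "F m x = of_real (R m x)" for m x
    unfolding F_def R_def by (simp add: q_real)
  have n2: "0 \<le> 1 - (norm (f x - 1))\<^sup>2 / 4" if "f \<in> Y" for f x
  proof -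
    have "norm (f x - 1) \<le> 2"
      using norm_triangle_ineq4[of "f x" 1] is_char_props(2)[OF Ych[OF that], of x] by simp
    then have "(norm (f x - 1))\<^sup>2 \<le> 2\<^sup>2" by (intro power_mono) auto
    then show ?thesis by simp
  qed
  have prod_bd: "0 \<le> (\<Prod>f\<in>Y. 1 - (norm (f x - 1))\<^sup>2 / 4)" "(\<Prod>f\<in>Y. 1 - (norm (f x - 1))\<^sup>2 / 4) \<le> 1" for x
    using n2 by (auto intro!: prod_nonneg prod_le_1)
  define r where "r = 1 - e1\<^sup>2 / 4"
  have e1sq: "0 < e1\<^sup>2" "e1\<^sup>2 \<le> 1" using e1 by (auto simp: power_le_one)
  then have r: "0 < r" "r < 1" unfolding r_def by auto
  have R0: "0 \<le> R m x" for m x unfolding R_def using prod_bd(1) by simp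
  have far: "R m x \<le> r ^ m" if f: "f \<in> Y" "norm (f x - 1) \<ge> e1" for f x m
  proof -
    have "(\<Prod>f\<in>Y. 1 - (norm (f x - 1))\<^sup>2 / 4) =
        (1 - (norm (f x - 1))\<^sup>2 / 4) * (\<Prod>f\<in>Y - {f}. 1 - (norm (f x - 1))\<^sup>2 / 4)"
      by (rule prod.remove[OF Y(1) f(1)])
    also have "\<dots> \<le> (1 - (norm (f x - 1))\<^sup>2 / 4) * 1"
      using n2 f by (intro mult_left_mono prod_le_1) auto
    also have "\<dots> \<le> r" unfolding r_def using power_mono[OF f(2), of 2] e1 by simp
    finally show ?thesis unfolding R_def by (rule power_mono[OF _ prod_bd(1)])
  qed
  \<comment> \<open>The mean of \<open>F m x * c x\<close> is 0. Where all of \<open>Y\<close> is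
    within \<open>e1\<close> of 1, the real part of \<open>c\<close> is at least 1/2; elsewhere it
    is at least -1 and the kernel is at most \<open>r ^ m\<close>. The factor 3/2 is 1/2 +
    1.\<close>
  have est: "(1/2) * Re (mean (F m)) \<le> (3/2) * r ^ m" for m
  proof -
    have uFc: "uc (\<lambda>x. F m x * c x)" using ucF ucc by (rule uc_mult)
    define H where "H x = (1/2) * F m x - of_real ((3/2) * r ^ m)" for x
    have uH: "uc H" unfolding H_def[abs_def] by (intro uc_diff uc_mult uc_const ucF)
    have le: "Re (mean H) \<le> Re (mean (\<lambda>x. F m x * c x))"
    proof (rule Re_mean_mono[OF uH uFc])
      fix x
      have Rec: "\<bar>Re (c x)\<bar> \<le> 1" using abs_Re_le_cmod[of "c x"] is_char_props(2)[OF c] by simp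
      have "(1/2) * R m x - (3/2) * r ^ m \<le> R m x * Re (c x)"
      proof (cases "\<exists>f\<in>Y. norm (f x - 1) \<ge> e1")
        case True
        then have "R m x \<le> r ^ m" using far by blast
        moreover have "R m x * (-1) \<le> R m x * Re (c x)" using Rec R0 by (intro mult_left_mono) auto
        ultimately show ?thesis by simp
      next
        case False
        then have "norm (c x - 1) \<le> 1/2" using e1(3) by (intro near) fastforce
        then have "1/2 \<le> Re (c x)" using abs_Re_le_cmod[of "c x - 1"] by (simp add: abs_le_iff)
        then have "R m x * (1/2) \<le> R m x * Re (c x)" using R0 by (intro mult_left_mono) auto
        moreover have "0 \<le> (3/2) * r ^ m" using r by simp
        ultimately show ?thesis by linarith
      qed
      then show "Re (H x) \<le> Re (F m x * c x)" by (simp add: H_def FR)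
    qed
    have mH: "mean H = (1/2) * mean (F m) - of_real ((3/2) * r ^ m)"
      unfolding H_def[abs_def] using ucF by (simp only: mean_diff mean_cmult mean_const uc_mult uc_const)
    show ?thesis using le unfolding MF mH by simp
  qed
  define n where "n = real (card Y)"
  define d where "d = e1 / (n + 1)"
  have n: "0 \<le> n" by (simp add: n_def)
  have d: "0 < d" using e1 n by (simp add: d_def)
  \<comment> \<open>On the ball of radius \<open>d\<close> the kernel is at least
    \<open>s ^ m\<close>, by Bernoulli's inequality. The radius \<open>e1 / (n + 1)\<close> is small
    enough for \<open>s\<close> to exceed the rate \<open>r\<close> of the far region.\<close>
  define s where "s = 1 - n * (d\<^sup>2 / 4)"
  have "n * d\<^sup>2 < e1\<^sup>2"
  proof -
    have "n < (n + 1)\<^sup>2" using n by (simp add: power2_eq_square algebra_simps add_pos_nonneg)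
    then show ?thesis using e1 n by (simp add: d_def power_divide divide_less_eq mult.commute)
  qed
  then have rs: "r < s" by (simp add: r_def s_def)
  obtain k where k: "k > 0"
    "\<And>f c. uc f \<Longrightarrow> (\<And>x. 0 \<le> Re (f x)) \<Longrightarrow> (\<And>x. N (x - 0) < d \<Longrightarrow> c \<le> Re (f x)) \<Longrightarrow> k * c \<le> Re (mean f)"
    using mean_pos_of_ball[OF d] by blast
  have low: "k * s ^ m \<le> Re (mean (F m))" for m
  proof (rule k(2)[OF ucF])
    show "0 \<le> Re (F m x)" for x using R0 by (simp add: FR)
    fix x assume x: "N (x - 0) < d"
    have d1: "d\<^sup>2 \<le> 1"
    proof -
      have "d \<le> 1" using e1 n by (simp add: d_def field_simps)
      then show ?thesis using d by (simp add: power_le_one)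
    qed
    have "s \<le> (1 + (- (d\<^sup>2 / 4))) ^ card Y"
      using Bernoulli_inequality[of "- (d\<^sup>2 / 4)" "card Y"] d1 by (simp add: s_def n_def)
    also have "\<dots> = (\<Prod>f\<in>Y. 1 - d\<^sup>2 / 4)" by simp
    also have "\<dots> \<le> (\<Prod>f\<in>Y. 1 - (norm (f x - 1))\<^sup>2 / 4)"
    proof (rule prod_mono)
      fix f assume "f \<in> Y"
      then have "norm (f x - 1) \<le> d" using le_N[of f x] x by simp
      then have "(norm (f x - 1))\<^sup>2 \<le> d\<^sup>2" by (intro power_mono) auto
      then show "0 \<le> 1 - d\<^sup>2 / 4 \<and> 1 - d\<^sup>2 / 4 \<le> 1 - (norm (f x - 1))\<^sup>2 / 4" using d1 by simp
    qed
    finally show "s ^ m \<le> Re (F m x)"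
      unfolding FR R_def Re_complex_of_real by (rule power_mono) (use rs r in simp)
  qed
  \<comment> \<open>The lower and the upper estimate for the mean of \<open>F m\<close> together
    bound \<open>(s / r) ^ m\<close> for all \<open>m\<close>, although
    \<open>s > r\<close>.\<close>
  have bound: "(s / r) ^ m \<le> 3 / k" for m
  proof -
    have "k * s ^ m \<le> 3 * r ^ m" using low[of m] est[of m] by linarith
    moreover have "0 < r ^ m" using r by simp
    ultimately show ?thesis using k(1) by (simp add: power_divide pos_divide_le_eq pos_le_divide_eq mult.commute)
  qed
  have "1 < s / r" using rs r by simp
  then obtain m where "3 / k < (s / r) ^ m" using real_arch_pow by blast
  then show False using bound[of m] by simp
qed

section \<open>Homomorphisms into Pruefer groups\<close>

definition prufer :: "nat \<Rightarrow> complex set" where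
  "prufer p = {z. \<exists>n. z ^ (p ^ n) = 1}"

lemma prufer_norm: "prime p \<Longrightarrow> z \<in> prufer p \<Longrightarrow> norm z = 1"
proof -
  assume p: "prime p" and "z \<in> prufer p"
  then obtain n where n: "z ^ (p ^ n) = 1" unfolding prufer_def by blast
  have "norm z ^ (p ^ n) = 1 ^ (p ^ n)" using n by (metis norm_power norm_one power_one)
  moreover have "0 < p ^ n" using p by (simp add: prime_gt_0_nat)
  ultimately show "norm z = 1" using power_eq_iff_eq_base[of "p ^ n" "norm z" 1] by simp
qed

lemma prufer_one: "1 \<in> prufer p"
  by (simp add: prufer_def)

lemma prufer_mult: "z \<in> prufer p \<Longrightarrow> w \<in> prufer p \<Longrightarrow> z * w \<in> prufer p"
proof -
  assume "z \<in> prufer p" "w \<in> prufer p"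
  then obtain m n where m: "z ^ (p ^ m) = 1" and n: "w ^ (p ^ n) = 1" unfolding prufer_def by blast
  have "z ^ (p ^ (m + n)) = 1" by (simp add: power_add power_mult m)
  moreover have "w ^ (p ^ (m + n)) = 1" by (subst add.commute) (simp add: power_add power_mult n)
  ultimately have "(z * w) ^ (p ^ (m + n)) = 1" by (simp add: power_mult_distrib)
  then show "z * w \<in> prufer p" unfolding prufer_def by blast
qed

lemma prufer_cnj: "z \<in> prufer p \<Longrightarrow> cnj z \<in> prufer p"
  unfolding prufer_def by (auto simp flip: complex_cnj_power)

lemma prufer_power: "z \<in> prufer p \<Longrightarrow> z ^ n \<in> prufer p"
  by (induction n) (auto intro: prufer_one prufer_mult)

lemma prufer_inverse: "prime p \<Longrightarrow> z \<in> prufer p \<Longrightarrow> inverse z \<in> prufer p"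
  unfolding prufer_def by (auto simp: power_inverse)

lemma prufer_powi: "prime p \<Longrightarrow> z \<in> prufer p \<Longrightarrow> z powi n \<in> prufer p"
  by (simp add: power_int_def prufer_power prufer_inverse)

lemma countable_prufer:
  assumes "prime p"
  shows "countable (prufer p)"
proof -
  have "finite {z::complex. z ^ (p ^ n) = 1}" for n
    using assms by (intro finite_roots_unity) (simp add: prime_gt_0_nat Suc_leI)
  moreover have "prufer p = (\<Union>n. {z. z ^ (p ^ n) = 1})" unfolding prufer_def by blast
  ultimately show ?thesis by (simp add: countable_finite)
qed

text \<open>The part of \<open>d\<close> prime to \<open>p\<close> is inverted modulo
  \<open>p ^ n\<close>, within the powers of \<open>z\<close>; the remaining \<open>p ^ k\<close>-th
  root is again a root of unity of \<open>p\<close>-power order.\<close>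

lemma prufer_divisible:
  assumes p: "prime p" and z: "z \<in> prufer p" and d: "d > 0"
  obtains w where "w \<in> prufer p" "w ^ d = z"
proof -
  obtain n where n: "z ^ (p ^ n) = 1" using z unfolding prufer_def by blast
  obtain k m where d_eq: "d = p ^ k * m" "\<not> p dvd m"
    using multiplicity_decompose'[of d p] d p by (metis mult.commute not_prime_unit less_not_refl)
  have "coprime m (p ^ n)"
    using prime_imp_coprime[OF p d_eq(2)] by (simp add: coprime_commute)
  then obtain m' where m': "[m * m' = 1] (mod p ^ n)"
    by (metis One_nat_def cong_solve_coprime_nat)
  have "z ^ (m * m') = z ^ 1"
  proof -
    have red: "z ^ j = z ^ (j mod p ^ n)" for j
    proof -
      have "z ^ j = z ^ (p ^ n * (j div p ^ n) + j mod p ^ n)" by simp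
      also have "\<dots> = z ^ (j mod p ^ n)" unfolding power_add power_mult by (simp add: n)
      finally show ?thesis .
    qed
    show ?thesis using m' red[of "m * m'"] red[of 1] unfolding cong_def by metis
  qed
  then have b: "(z ^ m') ^ m = z" by (simp add: mult.commute flip: power_mult)
  have "p ^ k \<noteq> 0" using p by auto
  then obtain w where w: "w ^ (p ^ k) = z ^ m'" using exists_complex_root[of "p ^ k" "z ^ m'"] by metis
  have "w ^ (p ^ (k + n)) = (z ^ m') ^ (p ^ n)" by (simp add: power_add power_mult w)
  also have "\<dots> = (z ^ (p ^ n)) ^ m'" by (simp add: mult.commute flip: power_mult)
  also have "\<dots> = 1" by (simp add: n)
  finally have "w \<in> prufer p" unfolding prufer_def by blast
  moreover have "w ^ d = z" by (simp add: d_eq(1) power_mult w b)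
  ultimately show thesis by (rule that)
qed

text \<open>The hypotheses say that \<open>u\<close> has order exactly \<open>p ^ m\<close>, so its
  powers are \<open>p ^ m\<close> distinct roots of unity and exhaust them. For \<open>m = 0\<close>
  the condition on \<open>m - 1\<close> is void, which guards the truncated subtraction.\<close>

lemma root_of_unity_power:
  fixes u w :: complex
  assumes p: "prime p" and u: "u ^ (p ^ m) = 1" "m > 0 \<Longrightarrow> u ^ (p ^ (m - 1)) \<noteq> 1" and w: "w ^ (p ^ m) = 1"
  obtains i where "w = u ^ i"
proof -
  have u0: "u \<noteq> 0" using u(1) p by (auto simp: power_0_left)
  have ord: "j = 0" if j: "u ^ j = 1" "j < p ^ m" for j
  proof (rule ccontr)
    assume "j \<noteq> 0"
    then have m: "m > 0" using j(2) by (cases m) auto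
    have g: "u ^ gcd j (p ^ m) = 1"
    proof -
      obtain x y where xy: "j * x = p ^ m * y + gcd j (p ^ m)"
        using bezout_nat[OF \<open>j \<noteq> 0\<close>, of "p ^ m"] by blast
      have "u ^ (j * x) = 1" by (simp add: power_mult j(1))
      then show ?thesis unfolding xy by (simp add: power_add power_mult u(1))
    qed
    obtain s where s: "s \<le> m" "gcd j (p ^ m) = p ^ s"
      using divides_primepow_nat[OF p, of "gcd j (p ^ m)" m] by auto
    have "s \<noteq> m"
    proof
      assume "s = m"
      then have "p ^ m dvd j" using s(2) by (metis gcd_dvd1)
      then show False using j(2) \<open>j \<noteq> 0\<close> by (simp add: nat_dvd_not_less)
    qed
    then have "m - 1 = s + (m - 1 - s)" using s(1) by simp
    then have "u ^ (p ^ (m - 1)) = 1" using g s(2) by (metis power_add power_mult power_one)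
    then show False using u(2)[OF m] by simp
  qed
  have "inj_on (\<lambda>i. u ^ i) {..<p ^ m}"
  proof (rule linorder_inj_onI')
    fix i j assume ij: "i \<in> {..<p ^ m}" "j \<in> {..<p ^ m}" "i < j"
    show "u ^ i \<noteq> u ^ j"
    proof
      assume "u ^ i = u ^ j"
      moreover have "u ^ j = u ^ i * u ^ (j - i)" using ij(3) by (simp flip: power_add)
      ultimately have "u ^ i * u ^ (j - i) = u ^ i * 1" by simp
      then have "u ^ (j - i) = 1" using u0 by simp
      moreover have "j - i < p ^ m" using ij by auto
      ultimately have "j - i = 0" by (rule ord)
      then show False using ij(3) by simp
    qed
  qed
  then have "card ((\<lambda>i. u ^ i) ` {..<p ^ m}) = p ^ m" by (simp add: card_image)
  moreover have "(\<lambda>i. u ^ i) ` {..<p ^ m} \<subseteq> {z. z ^ (p ^ m) = 1}"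
  proof clarify
    fix i
    have "(u ^ i) ^ (p ^ m) = (u ^ (p ^ m)) ^ i" by (simp add: mult.commute flip: power_mult)
    then show "(u ^ i) ^ (p ^ m) = 1" by (simp add: u(1))
  qed
  moreover have pm: "0 < p ^ m" using p by (simp add: prime_gt_0_nat)
  moreover have "finite {z::complex. z ^ (p ^ m) = 1}" by (rule finite_roots_unity) (use pm in linarith)
  ultimately have "(\<lambda>i. u ^ i) ` {..<p ^ m} = {z. z ^ (p ^ m) = 1}"
    using card_subset_eq card_roots_unity_eq[OF pm] by metis
  then show thesis using w that by blast
qed

lemma is_char_cmul:
  fixes f :: "('x \<Rightarrow>\<^sub>0 int) \<Rightarrow> complex"
  assumes f: "is_char f"
  shows "f (frag_cmul n c) = f c powi n"
proof -
  have nat: "f (frag_cmul (int n) c) = f c ^ n" for n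
  proof (induction n)
    case (Suc n)
    have "frag_cmul (int (Suc n)) c = c + frag_cmul (int n) c" by (simp add: frag_cmul_distrib)
    then show ?case using Suc by (simp add: is_char_props(1)[OF f])
  qed (simp add: is_char_props(3)[OF f])
  show ?thesis
  proof (cases "n \<ge> 0")
    case True
    then show ?thesis using nat[of "nat n"] by (simp add: power_int_def)
  next
    case False
    have inv: "cnj (f c) = inverse (f c)"
      using is_char_props(4)[OF f, of c] by (metis inverse_unique)
    have "frag_cmul n c = - frag_cmul (int (nat (- n))) c" using False by simp
    then have "f (frag_cmul n c) = cnj (f c ^ nat (- n))" using is_char_props(5)[OF f] nat by metis
    then show ?thesis using False inv by (simp add: power_int_def power_inverse)
  qed
qed

text \<open>A partial homomorphism is represented by its graph \<open>A\<close>, a subgroup of the product.\<close>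

lemma extend_to_prufer:
  fixes A :: "(('x \<Rightarrow>\<^sub>0 int) \<times> complex) set"
  assumes p: "prime p" and zero: "(0, 1) \<in> A"
    and add: "\<And>x y z w. (x, z) \<in> A \<Longrightarrow> (y, w) \<in> A \<Longrightarrow> (x + y, z * w) \<in> A"
    and minus: "\<And>x z. (x, z) \<in> A \<Longrightarrow> (- x, cnj z) \<in> A"
    and single: "\<And>z. (0, z) \<in> A \<Longrightarrow> z = 1"
    and vals: "\<And>x z. (x, z) \<in> A \<Longrightarrow> z \<in> prufer p"
  obtains h where "is_char h" "\<And>x. h x \<in> prufer p" "\<And>x z. (x, z) \<in> A \<Longrightarrow> h x = z"
proof -
  \<comment> \<open>Single-valuedness is reduced to the point 0, as graphs are closed under sums and
    negatives.\<close>
  define P where "P B \<longleftrightarrow> A \<subseteq> B \<and> (\<forall>x y z w. (x, z) \<in> B \<longrightarrow> (y, w) \<in> B \<longrightarrow> (x + y, z * w) \<in> B)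
      \<and> (\<forall>x z. (x, z) \<in> B \<longrightarrow> (- x, cnj z) \<in> B) \<and> (\<forall>z. (0, z) \<in> B \<longrightarrow> z = 1)
      \<and> (\<forall>x z. (x, z) \<in> B \<longrightarrow> z \<in> prufer p)" for B
  have "\<exists>M\<in>Collect P. \<forall>B\<in>Collect P. M \<subseteq> B \<longrightarrow> B = M"
  proof (rule subset_Zorn_nonempty)
    have "P A" unfolding P_def using assms by blast
    then show "Collect P \<noteq> {}" by blast
    fix \<C> assume ne: "\<C> \<noteq> {}" and ch: "subset.chain (Collect P) \<C>"
    have PC: "P B" if "B \<in> \<C>" for B using ch that unfolding subset.chain_def by blast
    have "(x + y, z * w) \<in> \<Union>\<C>" if xz: "(x, z) \<in> \<Union>\<C>" and yw: "(y, w) \<in> \<Union>\<C>" for x y z w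
    proof -
      obtain B B' where B: "B \<in> \<C>" "(x, z) \<in> B" "B' \<in> \<C>" "(y, w) \<in> B'" using xz yw by blast
      have "B \<subseteq> B' \<or> B' \<subseteq> B" using ch B(1,3) unfolding subset_chain_def by blast
      then obtain B'' where "B'' \<in> \<C>" "(x, z) \<in> B''" "(y, w) \<in> B''" using B by blast
      then show ?thesis using PC unfolding P_def by blast
    qed
    moreover have "A \<subseteq> \<Union>\<C>" using ne PC unfolding P_def by blast
    moreover have "(- x, cnj z) \<in> \<Union>\<C>" if "(x, z) \<in> \<Union>\<C>" for x z
      using that PC unfolding P_def by (meson Union_iff)
    moreover have "z = 1" if "(0, z) \<in> \<Union>\<C>" for z
      using that PC unfolding P_def by (meson Union_iff)
    moreover have "z \<in> prufer p" if "(x, z) \<in> \<Union>\<C>" for x z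
      using that PC unfolding P_def by (meson Union_iff)
    ultimately show "\<Union>\<C> \<in> Collect P" unfolding P_def mem_Collect_eq by (intro conjI allI impI)
  qed
  then obtain M where M: "P M" and max: "\<And>B. P B \<Longrightarrow> M \<subseteq> B \<Longrightarrow> B = M" by blast
  have M_add: "(x + y, z * w) \<in> M" if "(x, z) \<in> M" "(y, w) \<in> M" for x y z w using M that unfolding P_def by blast
  have M_minus: "(- x, cnj z) \<in> M" if "(x, z) \<in> M" for x z using M that unfolding P_def by blast
  have M_single: "z = 1" if "(0, z) \<in> M" for z using M that unfolding P_def by blast
  have M_vals: "z \<in> prufer p" if "(x, z) \<in> M" for x z using M that unfolding P_def by blast
  have M0: "(0, 1) \<in> M" using M zero unfolding P_def by blast
  have M_norm: "z * cnj z = 1" if "(x, z) \<in> M" for x z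
    using prufer_norm[OF p M_vals[OF that]] by (simp add: complex_norm_square[symmetric])
  have M_cmul_nat: "(frag_cmul (int n) x, z ^ n) \<in> M" if "(x, z) \<in> M" for n x z
  proof (induction n)
    case (Suc n)
    then show ?case using M_add[OF that Suc] by (simp add: frag_cmul_distrib)
  qed (simp add: M0)
  have M_cmul: "(frag_cmul n x, z powi n) \<in> M" if xz: "(x, z) \<in> M" for n x z
  proof (cases "n \<ge> 0")
    case True
    then show ?thesis using M_cmul_nat[OF xz, of "nat n"] by (simp add: power_int_def)
  next
    case False
    have "inverse z = cnj z" using M_norm[OF xz] by (metis inverse_unique)
    moreover have "frag_cmul (- n) (- x) = frag_cmul n x"
      by (metis frag_cmul_cmul frag_cmul_minus_one mult_minus1_right minus_minus)
    ultimately show ?thesis using M_cmul_nat[OF M_minus[OF xz], of "nat (- n)"] False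
      by (simp add: power_int_def)
  qed
  \<comment> \<open>A value \<open>\<zeta>\<close> for \<open>x\<close> must agree with
    \<open>M\<close> on the multiples of \<open>x\<close> that lie in the domain. Their factors are
    the multiples of a least positive \<open>d\<close>, so a \<open>d\<close>-th root of the value
    there works, or 1 if only the factor 0 occurs. By maximality the enlarged graph is
    \<open>M\<close>.\<close>
  have dom: "\<exists>z. (x, z) \<in> M" for x
  proof -
    define I where "I = {n. \<exists>z. (frag_cmul n x, z) \<in> M}"
    have "\<exists>\<zeta>. \<zeta> \<in> prufer p \<and> (\<forall>n z. (frag_cmul n x, z) \<in> M \<longrightarrow> z = \<zeta> powi n)"
    proof (cases "\<exists>n>0. int n \<in> I")
      case False
      have "n = 0" if "(frag_cmul n x, z) \<in> M" for n z
      proof (rule ccontr)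
        assume "n \<noteq> 0"
        moreover have "(frag_cmul (- n) x, cnj z) \<in> M" using M_minus[OF that] by simp
        ultimately have "int (nat \<bar>n\<bar>) \<in> I" using that unfolding I_def by (cases "n > 0") auto
        moreover have "nat \<bar>n\<bar> > 0" using \<open>n \<noteq> 0\<close> by simp
        ultimately show False using False by blast
      qed
      then have "z = 1 powi n" if "(frag_cmul n x, z) \<in> M" for n z
        using M_single that by fastforce
      then show ?thesis using prufer_one by blast
    next
      case True
      define d where "d = (LEAST n. n > 0 \<and> int n \<in> I)"
      have d: "d > 0" "int d \<in> I" using LeastI_ex[OF True] unfolding d_def by auto
      have least: "d \<le> n" if "n > 0" "int n \<in> I" for n unfolding d_def using that by (intro Least_le) simp
      obtain w where w: "(frag_cmul (int d) x, w) \<in> M" using d(2) unfolding I_def by blast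
      obtain \<zeta> where \<zeta>: "\<zeta> \<in> prufer p" "\<zeta> ^ d = w" using prufer_divisible[OF p M_vals[OF w] d(1)] by blast
      have "z = \<zeta> powi n" if nz: "(frag_cmul n x, z) \<in> M" for n z
      proof -
        define q where "q = n div int d"
        define r where "r = n mod int d"
        have n: "n = int d * q + r" by (simp add: q_def r_def)
        have r: "0 \<le> r" "r < int d" using d(1) by (simp_all add: r_def)
        have "(frag_cmul n x + frag_cmul (- q) (frag_cmul (int d) x), z * w powi (- q)) \<in> M"
          by (rule M_add[OF nz M_cmul[OF w]])
        moreover have "frag_cmul n x + frag_cmul (- q) (frag_cmul (int d) x) = frag_cmul r x"
          by (simp add: n frag_cmul_distrib mult.commute flip: minus_frag_cmul)
        ultimately have rM: "(frag_cmul r x, z * w powi (- q)) \<in> M" by simp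
        have "r = 0"
        proof (rule ccontr)
          assume "r \<noteq> 0"
          then have "d \<le> nat r" using r rM by (intro least) (auto simp: I_def)
          then show False using r by simp
        qed
        then have "z * w powi (- q) = 1" using rM M_single by simp
        moreover have "w \<noteq> 0" using M_norm[OF w] by auto
        ultimately have "z = w powi q" by (simp add: power_int_minus field_simps)
        also have "w = \<zeta> powi int d" using \<zeta>(2) by simp
        also have "(\<zeta> powi int d) powi q = \<zeta> powi n" using n \<open>r = 0\<close> by (simp add: power_int_mult)
        finally show ?thesis .
      qed
      then show ?thesis using \<zeta>(1) by blast
    qed
    then obtain \<zeta> where \<zeta>: "\<zeta> \<in> prufer p" "\<And>n z. (frag_cmul n x, z) \<in> M \<Longrightarrow> z = \<zeta> powi n" by blast
    have \<zeta>0: "\<zeta> \<noteq> 0" using prufer_norm[OF p \<zeta>(1)] by auto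
    have \<zeta>inv: "cnj \<zeta> = inverse \<zeta>"
      using prufer_norm[OF p \<zeta>(1)] by (metis complex_norm_square inverse_unique of_real_1 power_one)
    define B where "B = {(y + frag_cmul n x, w * \<zeta> powi n) | y w n. (y, w) \<in> M}"
    have BI: "(y + frag_cmul n x, w * \<zeta> powi n) \<in> B" if "(y, w) \<in> M" for y w n unfolding B_def using that by blast
    have MB: "M \<subseteq> B" using BI[of _ _ 0] by auto
    have "P B"
      unfolding P_def
    proof (intro conjI allI impI)
      show "A \<subseteq> B" using M MB unfolding P_def by blast
    next
      fix a b u v assume "(a, u) \<in> B" "(b, v) \<in> B"
      then obtain y w n y' w' n' where yw: "(y, w) \<in> M" "(y', w') \<in> M"
        "a = y + frag_cmul n x" "u = w * \<zeta> powi n" "b = y' + frag_cmul n' x" "v = w' * \<zeta> powi n'"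
        unfolding B_def by blast
      have "a + b = (y + y') + frag_cmul (n + n') x" "u * v = (w * w') * \<zeta> powi (n + n')"
        using yw \<zeta>0 by (simp_all add: frag_cmul_distrib power_int_add)
      then show "(a + b, u * v) \<in> B" using BI[OF M_add[OF yw(1,2)]] by simp
    next
      fix a u assume "(a, u) \<in> B"
      then obtain y w n where yw: "(y, w) \<in> M" "a = y + frag_cmul n x" "u = w * \<zeta> powi n"
        unfolding B_def by blast
      have "- a = - y + frag_cmul (- n) x" "cnj u = cnj w * \<zeta> powi (- n)"
        using yw by (simp_all add: \<zeta>inv power_int_minus power_int_inverse flip: minus_frag_cmul)
      then show "(- a, cnj u) \<in> B" using BI[OF M_minus[OF yw(1)]] by simp
    next
      fix u assume "(0, u) \<in> B"
      then obtain y w n where yw: "(y, w) \<in> M" "0 = y + frag_cmul n x" "u = w * \<zeta> powi n"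
        unfolding B_def by blast
      have "frag_cmul n x = - y" using yw(2) by (simp add: eq_neg_iff_add_eq_0 add.commute)
      then have "\<zeta> powi n = cnj w" using \<zeta>(2) M_minus[OF yw(1)] by metis
      then show "u = 1" using M_norm[OF yw(1)] yw(3) by simp
    next
      fix a u assume "(a, u) \<in> B"
      then obtain y w n where yw: "(y, w) \<in> M" "a = y + frag_cmul n x" "u = w * \<zeta> powi n"
        unfolding B_def by blast
      then show "u \<in> prufer p" using M_vals prufer_powi[OF p \<zeta>(1)] prufer_mult by blast
    qed
    then have "B = M" using max MB by blast
    then show ?thesis using BI[OF M0, of 1] by auto
  qed
  then obtain h where h: "\<And>x. (x, h x) \<in> M" by metis
  have uniq: "h x = z" if "(x, z) \<in> M" for x z
  proof -
    have "(x + - x, h x * cnj z) \<in> M" by (rule M_add[OF h M_minus[OF that]])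
    then have "h x * cnj z = 1" using M_single by simp
    then show ?thesis using M_norm[OF that] by (metis mult.commute mult.left_commute mult_1)
  qed
  show thesis
  proof (rule that[of h])
    show "is_char h" unfolding is_char_def
      using uniq[OF M_add[OF h h]] prufer_norm[OF p M_vals[OF h]] by blast
    show "h x \<in> prufer p" for x by (rule M_vals[OF h])
    show "h x = z" if "(x, z) \<in> A" for x z using uniq that M unfolding P_def by blast
  qed
qed

section \<open>Independent sets of characters\<close>

locale unimodular_group =
  fixes X :: "('a \<Rightarrow> complex) set"
  assumes one_mem: "(\<lambda>_. 1) \<in> X"
    and mult_mem: "f \<in> X \<Longrightarrow> g \<in> X \<Longrightarrow> (\<lambda>a. f a * g a) \<in> X"
    and cnj_mem: "f \<in> X \<Longrightarrow> (\<lambda>a. cnj (f a)) \<in> X"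
    and norm_one: "f \<in> X \<Longrightarrow> norm (f a) = 1"
begin

lemma mult_cnj: "f \<in> X \<Longrightarrow> f a * cnj (f a) = 1"
  using norm_one[of f a] by (simp add: complex_norm_square[symmetric])

definition grp :: "('a \<Rightarrow> complex) monoid" where
  "grp = \<lparr>carrier = X, monoid.mult = (\<lambda>f g a. f a * g a), one = (\<lambda>_. 1)\<rparr>"

lemma comm_group_grp: "comm_group grp"
proof (rule comm_groupI)
  fix x assume "x \<in> carrier grp"
  then show "\<exists>y\<in>carrier grp. y \<otimes>\<^bsub>grp\<^esub> x = \<one>\<^bsub>grp\<^esub>"
    using mult_cnj by (intro bexI[of _ "\<lambda>a. cnj (x a)"]) (auto simp: grp_def cnj_mem mult.commute)
qed (auto simp: grp_def mult_mem one_mem mult_ac)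

text \<open>\<open>X\<close> as a quotient of a free abelian group. Generators outside
  \<open>X\<close> go to the trivial element, so that the whole type is the domain.\<close>

definition ev :: "(('a \<Rightarrow> complex) \<Rightarrow>\<^sub>0 int) \<Rightarrow> 'a \<Rightarrow> complex" where
  "ev = (SOME h. h \<in> hom (free_Abelian_group UNIV) grp \<and>
      (\<forall>x. h (frag_of x) = (if x \<in> X then x else (\<lambda>_. 1))))"

lemma ev: "ev \<in> hom (free_Abelian_group UNIV) grp" "ev (frag_of x) = (if x \<in> X then x else (\<lambda>_. 1))"
proof -
  have "(\<lambda>x. if x \<in> X then x else (\<lambda>_. 1)) ` UNIV \<subseteq> carrier grp"
    using one_mem by (auto simp: grp_def)
  then obtain h where "h \<in> hom (free_Abelian_group UNIV) grp"
    "\<And>x. x \<in> UNIV \<Longrightarrow> h (frag_of x) = (if x \<in> X then x else (\<lambda>_. 1))"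
    using comm_group.free_Abelian_group_universal[OF comm_group_grp,
        of "\<lambda>x. if x \<in> X then x else (\<lambda>_. 1)" UNIV] by metis
  then have "\<exists>h. h \<in> hom (free_Abelian_group UNIV) grp \<and>
      (\<forall>x. h (frag_of x) = (if x \<in> X then x else (\<lambda>_. 1)))" by blast
  from someI_ex[OF this] show "ev \<in> hom (free_Abelian_group UNIV) grp"
    "ev (frag_of x) = (if x \<in> X then x else (\<lambda>_. 1))" unfolding ev_def by blast+
qed

lemma ev_mem: "ev c \<in> X"
  using ev(1) by (auto simp: hom_def grp_def)

lemma ev_add: "ev (c + d) a = ev c a * ev d a"
  using ev(1) by (auto simp: hom_def grp_def)

lemma is_char_ev: "is_char (\<lambda>c. ev c a)"
  unfolding is_char_def using ev_add norm_one[OF ev_mem] by blast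

lemma ev_frag_of: "x \<in> X \<Longrightarrow> ev (frag_of x) = x"
  by (simp add: ev(2))

lemmas ev_props = is_char_props[OF is_char_ev] is_char_cmul[OF is_char_ev]

lemma ev_zero: "ev 0 = (\<lambda>_. 1)"
  using ev_props(3) by blast

definition span :: "('a \<Rightarrow> complex) set \<Rightarrow> ('a \<Rightarrow> complex) set" where
  "span S = ev ` {c. Poly_Mapping.keys c \<subseteq> S}"

lemma span_powi: "x \<in> span S \<Longrightarrow> (\<lambda>a. x a powi n) \<in> span S"
proof -
  assume "x \<in> span S"
  then obtain c where c: "Poly_Mapping.keys c \<subseteq> S" "x = ev c" unfolding span_def by blast
  have eq: "(\<lambda>a. x a powi n) = ev (frag_cmul n c)" using ev_props(8) by (simp add: c(2) fun_eq_iff)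
  have "Poly_Mapping.keys (frag_cmul n c) \<subseteq> S" by (rule order_trans[OF keys_cmul c(1)])
  then show ?thesis unfolding span_def eq by (intro imageI CollectI)
qed

lemma countable_span:
  assumes "infinite X" "countable S"
  shows "countable (span S)"
proof -
  \<comment> \<open>The cardinality rule for free abelian groups asks for an infinite set of
    generators; a countable \<open>T\<close> supplies it when \<open>S\<close> is finite.\<close>
  obtain T where T: "T \<subseteq> X" "infinite T" "countable T"
    using infinite_countable_subset'[OF assms(1)] by blast
  have "carrier (free_Abelian_group (S \<union> T)) \<approx> S \<union> T"
    by (rule eqpoll_free_Abelian_group_infinite) (use T in simp)
  moreover have "carrier (free_Abelian_group (S \<union> T)) = {c. Poly_Mapping.keys c \<subseteq> S \<union> T}" by auto
  ultimately have "countable {c::('a \<Rightarrow> complex) \<Rightarrow>\<^sub>0 int. Poly_Mapping.keys c \<subseteq> S \<union> T}"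
    using countable_lepoll[OF _ eqpoll_imp_lepoll, of "S \<union> T"] assms(2) T(3) by simp
  then have "countable {c::('a \<Rightarrow> complex) \<Rightarrow>\<^sub>0 int. Poly_Mapping.keys c \<subseteq> S}"
    by (rule countable_subset[rotated]) blast
  then show ?thesis unfolding span_def by (rule countable_image)
qed

text \<open>Weaker than linear independence: relations are allowed if \<open>p\<close> divides all
  coefficients. This is what makes every map from \<open>S\<close> to the \<open>p\<close>-th roots
  of unity well defined as a homomorphism on the span.\<close>

definition indep :: "nat \<Rightarrow> ('a \<Rightarrow> complex) set \<Rightarrow> bool" where
  "indep p S \<longleftrightarrow> S \<subseteq> X \<and>
     (\<forall>c. Poly_Mapping.keys c \<subseteq> S \<longrightarrow> ev c = (\<lambda>_. 1) \<longrightarrow> (\<forall>s. int p dvd poly_mapping.lookup c s))"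

lemma ex_maximal_indep: "\<exists>S. indep p S \<and> (\<forall>S'. indep p S' \<longrightarrow> S \<subseteq> S' \<longrightarrow> S' = S)"
proof -
  have "\<exists>M\<in>Collect (indep p). \<forall>B\<in>Collect (indep p). M \<subseteq> B \<longrightarrow> B = M"
  proof (rule subset_Zorn_nonempty)
    have "indep p {}" unfolding indep_def by simp
    then show "Collect (indep p) \<noteq> {}" by blast
    fix \<C> assume ne: "\<C> \<noteq> {}" and ch: "subset.chain (Collect (indep p)) \<C>"
    have iC: "indep p B" if "B \<in> \<C>" for B using ch that unfolding subset.chain_def by blast
    have "int p dvd poly_mapping.lookup c s" if c: "Poly_Mapping.keys c \<subseteq> \<Union>\<C>" "ev c = (\<lambda>_. 1)" for c s
    proof -
      obtain B where "B \<in> \<C>" "Poly_Mapping.keys c \<subseteq> B"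
        using finite_subset_Union_chain[OF finite_keys c(1) ne ch] by blast
      then show ?thesis using iC c(2) unfolding indep_def by blast
    qed
    moreover have "\<Union>\<C> \<subseteq> X" using iC unfolding indep_def by blast
    ultimately show "\<Union>\<C> \<in> Collect (indep p)" unfolding indep_def by blast
  qed
  then show ?thesis by blast
qed

text \<open>By maximality, a new \<open>x\<close> creates a relation with a coefficient not
  divisible by \<open>p\<close>; the coefficient \<open>n\<close> at \<open>x\<close> is nonzero,
  since otherwise it would be a relation within \<open>S\<close>. If \<open>x\<close> has exponent
  \<open>p\<close>, then \<open>p\<close> cannot divide \<open>n\<close>, because the rest would
  again be a relation within \<open>S\<close>; a Bezout identity recovers \<open>x\<close>.\<close>

lemma maximal_indep:
  assumes p: "prime p" and S: "indep p S" and max: "\<And>S'. indep p S' \<Longrightarrow> S \<subseteq> S' \<Longrightarrow> S' = S"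
    and x: "x \<in> X"
  shows "\<exists>n>0. (\<lambda>a. x a ^ n) \<in> span S"
    and "(\<And>a. x a ^ p = 1) \<Longrightarrow> x \<in> span S"
proof -
  have "\<exists>n. n \<noteq> 0 \<and> (\<lambda>a. x a powi n) \<in> span S \<and> ((\<forall>a. x a ^ p = 1) \<longrightarrow> \<not> int p dvd n)"
  proof (cases "x \<in> S")
    case True
    then have "ev (frag_of x) \<in> span S" unfolding span_def by (intro imageI) (simp add: keys_frag_of)
    then have "x \<in> span S" by (simp add: ev_frag_of x)
    then show ?thesis using p by (intro exI[of _ 1]) (auto simp: prime_nat_iff)
  next
    case False
    then have "\<not> indep p (insert x S)" using max by blast
    then obtain c s where c: "Poly_Mapping.keys c \<subseteq> insert x S" "ev c = (\<lambda>_. 1)"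
      "\<not> int p dvd poly_mapping.lookup c s"
      using S x unfolding indep_def by blast
    define n where "n = poly_mapping.lookup c x"
    define c' where "c' = c - frag_cmul n (frag_of x)"
    have lc': "poly_mapping.lookup c' y = poly_mapping.lookup c y - (if y = x then n else 0)" for y
      by (simp add: c'_def lookup_minus lookup_single when_def)
    have kc': "Poly_Mapping.keys c' \<subseteq> S"
    proof
      fix y assume "y \<in> Poly_Mapping.keys c'"
      then have "poly_mapping.lookup c' y \<noteq> 0" by (simp add: in_keys_iff)
      then have "y \<noteq> x" "poly_mapping.lookup c y \<noteq> 0"
        by (auto simp: lc' n_def split: if_splits)
      then show "y \<in> S" using c(1) by (auto simp: in_keys_iff)
    qed
    have "c = c' + frag_cmul n (frag_of x)" by (simp add: c'_def)
    then have eq: "ev c' a * x a powi n = 1" for a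
      using c(2) ev_props(1)[of c' "frag_cmul n (frag_of x)" a] ev_props(8)[of n "frag_of x" a]
      by (simp add: ev_frag_of x)
    then have "x a powi n = ev (- c') a" for a
      using ev_props(4,5)[of c' a] by (metis inverse_unique)
    then have "(\<lambda>a. x a powi n) = ev (- c')" by blast
    moreover have "Poly_Mapping.keys (- c') \<subseteq> S" using kc' by simp
    ultimately have "(\<lambda>a. x a powi n) \<in> span S" unfolding span_def by blast
    moreover have "n \<noteq> 0"
    proof
      assume "n = 0"
      then have "Poly_Mapping.keys c \<subseteq> S" using kc' by (simp add: c'_def)
      then show False using S c(2,3) unfolding indep_def by blast
    qed
    moreover have "\<not> int p dvd n" if xp: "\<forall>a. x a ^ p = 1"
    proof
      assume pn: "int p dvd n"
      then obtain k where k: "n = int p * k" by blast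
      have "x a powi n = 1" for a unfolding k power_int_mult using xp by simp
      then have "ev c' = (\<lambda>_. 1)" using eq by (simp add: fun_eq_iff)
      then have "int p dvd poly_mapping.lookup c' s" using S kc' unfolding indep_def by blast
      then have "int p dvd poly_mapping.lookup c' s + (if s = x then n else 0)" using pn by simp
      then show False using c(3) unfolding lc' by simp
    qed
    ultimately show ?thesis by blast
  qed
  then obtain n where n: "n \<noteq> 0" "(\<lambda>a. x a powi n) \<in> span S" "(\<forall>a. x a ^ p = 1) \<longrightarrow> \<not> int p dvd n"
    by blast
  show "\<exists>n>0. (\<lambda>a. x a ^ n) \<in> span S"
  proof (intro exI conjI)
    show "nat \<bar>n\<bar> > 0" using n(1) by simp
    have "(\<lambda>a. (x a powi n) powi sgn n) \<in> span S" by (rule span_powi[OF n(2)])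
    moreover have "(x a powi n) powi sgn n = x a ^ nat \<bar>n\<bar>" for a
      by (cases "n > 0") (use n(1) in \<open>auto simp: power_int_def power_inverse\<close>)
    ultimately show "(\<lambda>a. x a ^ nat \<bar>n\<bar>) \<in> span S" by simp
  qed
  assume xp: "\<And>a. x a ^ p = 1"
  then have "coprime n (int p)" using n(3) p
    by (metis coprime_commute prime_imp_coprime prime_nat_int_transfer)
  then obtain u v where uv: "u * n + v * int p = 1" using bezout_int[of n "int p"] by (auto simp: coprime_iff_gcd_eq_1)
  have "(x a powi n) powi u = x a" for a
  proof -
    have "x a \<noteq> 0" using norm_one[OF x, of a] by auto
    then have "x a powi (u * n + v * int p) = x a powi (n * u) * x a powi (int p * v)"
      by (simp add: power_int_add mult.commute)
    then show ?thesis unfolding uv power_int_mult using xp by simp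
  qed
  then show "x \<in> span S" using span_powi[OF n(2), of u] by simp
qed

text \<open>The nonempty fibres of the power map are cosets of its kernel.\<close>

lemma countable_powers:
  assumes D: "countable D" and T: "countable {x \<in> X. \<forall>a. x a ^ n = 1}"
  shows "countable {x \<in> X. (\<lambda>a. x a ^ n) \<in> D}"
proof -
  have fib: "countable {x \<in> X. (\<lambda>a. x a ^ n) = d}" for d
  proof (cases "{x \<in> X. (\<lambda>a. x a ^ n) = d} = {}")
    case False
    then obtain y where y: "y \<in> X" "(\<lambda>a. y a ^ n) = d" by blast
    have "{x \<in> X. (\<lambda>a. x a ^ n) = d} \<subseteq> (\<lambda>t a. t a * y a) ` {x \<in> X. \<forall>a. x a ^ n = 1}"
    proof
      fix x assume "x \<in> {x \<in> X. (\<lambda>a. x a ^ n) = d}"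
      then have x: "x \<in> X" "x a ^ n = y a ^ n" for a using y(2) by (auto simp: fun_eq_iff)
      have "(x a * cnj (y a)) ^ n = (y a * cnj (y a)) ^ n" for a by (simp add: power_mult_distrib x(2))
      then have "(\<lambda>a. x a * cnj (y a)) \<in> {x \<in> X. \<forall>a. x a ^ n = 1}"
        using mult_mem[OF x(1) cnj_mem[OF y(1)]] mult_cnj[OF y(1)] by simp
      moreover have "x = (\<lambda>a. x a * cnj (y a) * y a)"
        using mult_cnj[OF y(1)] by (simp add: fun_eq_iff mult.assoc mult.commute[of "cnj _"])
      ultimately show "x \<in> (\<lambda>t a. t a * y a) ` {x \<in> X. \<forall>a. x a ^ n = 1}"
        by (intro image_eqI[where x = "\<lambda>a. x a * cnj (y a)"])
    qed
    then show ?thesis by (rule countable_subset) (rule countable_image[OF T])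
  next
    case True
    then show ?thesis by (simp only: countable_empty)
  qed
  have "{x \<in> X. (\<lambda>a. x a ^ n) \<in> D} = (\<Union>d\<in>D. {x \<in> X. (\<lambda>a. x a ^ n) = d})" by blast
  then show ?thesis using D fib by simp
qed

text \<open>If all such sets were countable, the elements of prime exponent would lie in countable
  spans, and induction over prime factors makes the \<open>n\<close>-torsion countable for every
  \<open>n\<close>. Since every element has a power in the span of a maximal set, here for
  \<open>p = 2\<close>, \<open>X\<close> would be countable.\<close>

lemma ex_uncountable_indep:
  assumes unc: "uncountable X"
  shows "\<exists>p S. prime p \<and> indep p S \<and> uncountable S"
proof (rule ccontr)
  assume "\<nexists>p S. prime p \<and> indep p S \<and> uncountable S"
  then have ctb: "countable S" if "prime p" "indep p S" for p S using that by blast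
  have infX: "infinite X" using unc countable_finite by blast
  obtain M where M: "\<And>p. indep p (M p)" "\<And>p S'. indep p S' \<Longrightarrow> M p \<subseteq> S' \<Longrightarrow> S' = M p"
    using ex_maximal_indep by metis
  have T: "countable {x \<in> X. \<forall>a. x a ^ n = 1}" if "n > 0" for n
    using that
  proof (induction n rule: less_induct)
    case (less n)
    show ?case
    proof (cases "n = 1")
      case True
      then have "{x \<in> X. \<forall>a. x a ^ n = 1} \<subseteq> {\<lambda>_. 1}" by auto
      then show ?thesis by (rule countable_subset) simp
    next
      case False
      then obtain p where p: "prime p" "p dvd n" using prime_factor_nat by blast
      then obtain m where m: "n = p * m" by blast
      have mn: "m > 0" "m < n" using m less.prems p(1) prime_gt_1_nat[OF p(1)] by auto
      have "{x \<in> X. \<forall>a. x a ^ p = 1} \<subseteq> span (M p)"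
        using maximal_indep(2)[OF p(1) M(1) M(2)] by blast
      then have "countable {x \<in> X. \<forall>a. x a ^ p = 1}"
        by (rule countable_subset) (rule countable_span[OF infX ctb[OF p(1) M(1)]])
      then have "countable {x \<in> X. (\<lambda>a. x a ^ p) \<in> {x \<in> X. \<forall>a. x a ^ m = 1}}"
        by (rule countable_powers[OF less.IH[OF mn(2,1)]])
      moreover have pow: "(\<lambda>a. x a ^ k) \<in> X" if "x \<in> X" for x and k :: nat
        by (induction k) (use one_mem mult_mem[OF that] in auto)
      have "{x \<in> X. \<forall>a. x a ^ n = 1} \<subseteq> {x \<in> X. (\<lambda>a. x a ^ p) \<in> {x \<in> X. \<forall>a. x a ^ m = 1}}"
        using pow by (auto simp: m power_mult)
      ultimately show ?thesis using countable_subset by blast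
    qed
  qed
  have two: "prime (2::nat)" by simp
  have "X \<subseteq> (\<Union>n\<in>{0<..}. {x \<in> X. (\<lambda>a. x a ^ n) \<in> span (M 2)})"
  proof
    fix x assume x: "x \<in> X"
    obtain n where "n > 0" "(\<lambda>a. x a ^ n) \<in> span (M 2)"
      using maximal_indep(1)[OF two M(1) M(2) x] by blast
    then show "x \<in> (\<Union>n\<in>{0<..}. {x \<in> X. (\<lambda>a. x a ^ n) \<in> span (M 2)})" using x by blast
  qed
  moreover have "countable (\<Union>n\<in>{0<..}. {x \<in> X. (\<lambda>a. x a ^ n) \<in> span (M 2)})"
    using countable_powers[OF countable_span[OF infX ctb[OF two M(1)]] T] by (intro countable_UN) auto
  ultimately show False using unc countable_subset by blast
qed

text \<open>Homomorphisms from \<open>X\<close> to the Pruefer group, represented by their lifts,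
  which are trivial on the kernel of \<open>ev\<close>.\<close>

definition homs :: "nat \<Rightarrow> ((('a \<Rightarrow> complex) \<Rightarrow>\<^sub>0 int) \<Rightarrow> complex) set" where
  "homs p = {h. is_char h \<and> (\<forall>c. h c \<in> prufer p) \<and> (\<forall>c. ev c = (\<lambda>_. 1) \<longrightarrow> h c = 1)}"

lemma Pow_indep_le_homs:
  assumes p: "prime p" and S: "indep p S"
  shows "|Pow S| \<le>o |homs p|"
proof -
  obtain \<zeta> :: complex where \<zeta>: "\<zeta> ^ p = 1" "\<zeta> \<noteq> 1"
  proof -
    have "card {z::complex. z ^ p = 1} = p" by (rule card_roots_unity_eq) (use p prime_gt_0_nat in blast)
    moreover have "card {1::complex} = 1" by simp
    ultimately have "{z::complex. z ^ p = 1} \<noteq> {1}" using p by (metis not_prime_1)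
    then show thesis using that by force
  qed
  have \<zeta>p: "\<zeta> \<in> prufer p" unfolding prufer_def using \<zeta>(1) by (auto intro: exI[of _ 1])
  have \<zeta>n: "norm \<zeta> = 1" by (rule prufer_norm[OF p \<zeta>p])
  then have \<zeta>0: "\<zeta> \<noteq> 0" by auto
  have \<zeta>inv: "cnj \<zeta> = inverse \<zeta>"
    using \<zeta>n by (metis complex_norm_square inverse_unique of_real_1 power_one)
  have "\<exists>h. h \<in> homs p \<and> (\<forall>s\<in>S. h (frag_of s) = (if s \<in> B then \<zeta> else 1))" for B
  proof -
    \<comment> \<open>The total coefficient of \<open>c\<close> on \<open>B\<close>, obtained as the
      coordinate of an induced homomorphism to the free abelian group on one generator; additivity
      is then immediate.\<close>
    define E where "E c = poly_mapping.lookup (frag_extend (\<lambda>s. if s \<in> B then frag_of () else 0) c) ()"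
      for c :: "('a \<Rightarrow> complex) \<Rightarrow>\<^sub>0 int"
    have E_add: "E (c + d) = E c + E d" for c d by (simp add: E_def frag_extend_add lookup_add)
    have E_0: "E 0 = 0" using E_add[of 0 0] by simp
    have E_minus: "E (- c) = - E c" for c using E_add[of c "- c"] E_0 by simp
    have E_of: "E (frag_of s) = (if s \<in> B then 1 else 0)" for s
      by (simp add: E_def)
    have E_dvd: "int p dvd E c" if "\<And>s. int p dvd poly_mapping.lookup c s" for c
      unfolding E_def frag_extend_def lookup_sum using that by (intro dvd_sum) simp
    \<comment> \<open>Adding the kernel of \<open>ev\<close> to the domain, with value 1, forces the
      extension to descend to \<open>X\<close>.\<close>
    define A where "A = {(c + w, \<zeta> powi E c) | c w. Poly_Mapping.keys c \<subseteq> S \<and> ev w = (\<lambda>_. 1)}"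
    have AI: "(c + w, \<zeta> powi E c) \<in> A" if "Poly_Mapping.keys c \<subseteq> S" "ev w = (\<lambda>_. 1)" for c w
      unfolding A_def using that by blast
    obtain h where h: "is_char h" "\<And>x. h x \<in> prufer p" "\<And>x z. (x, z) \<in> A \<Longrightarrow> h x = z"
    proof (rule extend_to_prufer[OF p])
      show "(0, 1) \<in> A" using AI[of 0 0] by (simp add: E_0 ev_zero)
    next
      fix x y z w assume "(x, z) \<in> A" "(y, w) \<in> A"
      then obtain c u d v where cd: "Poly_Mapping.keys c \<subseteq> S" "ev u = (\<lambda>_. 1)" "x = c + u" "z = \<zeta> powi E c"
        "Poly_Mapping.keys d \<subseteq> S" "ev v = (\<lambda>_. 1)" "y = d + v" "w = \<zeta> powi E d"
        unfolding A_def by blast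
      have "Poly_Mapping.keys (c + d) \<subseteq> S" using keys_add[of c d] cd by blast
      moreover have "ev (u + v) = (\<lambda>_. 1)" by (rule ext) (simp add: ev_add cd)
      ultimately have "(c + d + (u + v), \<zeta> powi E (c + d)) \<in> A" by (rule AI)
      moreover have "c + d + (u + v) = x + y" using cd by simp
      moreover have "\<zeta> powi E (c + d) = z * w" using cd \<zeta>0 by (simp add: E_add power_int_add)
      ultimately show "(x + y, z * w) \<in> A" by simp
    next
      fix x z assume "(x, z) \<in> A"
      then obtain c u where cd: "Poly_Mapping.keys c \<subseteq> S" "ev u = (\<lambda>_. 1)" "x = c + u" "z = \<zeta> powi E c"
        unfolding A_def by blast
      have "Poly_Mapping.keys (- c) \<subseteq> S" using cd by simp
      moreover have "ev (- u) = (\<lambda>_. 1)" by (rule ext) (simp add: ev_props(5) cd)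
      ultimately have "(- c + - u, \<zeta> powi E (- c)) \<in> A" by (rule AI)
      moreover have "\<zeta> powi E (- c) = cnj z"
        using cd by (simp add: E_minus \<zeta>inv power_int_minus power_int_inverse)
      ultimately show "(- x, cnj z) \<in> A" using cd by simp
    next
      fix z assume "(0, z) \<in> A"
      then obtain c u where cd: "Poly_Mapping.keys c \<subseteq> S" "ev u = (\<lambda>_. 1)" "0 = c + u" "z = \<zeta> powi E c"
        unfolding A_def by blast
      \<comment> \<open>Independence enters here: \<open>c\<close> is a relation on
        \<open>S\<close>, so \<open>p\<close> divides \<open>E c\<close>, and \<open>\<zeta>\<close>
        is a \<open>p\<close>-th root of unity.\<close>
      have "ev c a = 1" for a using ev_add[of c u a] cd(2) cd(3)[symmetric] ev_zero by simp
      then have "ev c = (\<lambda>_. 1)" by blast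
      then have "int p dvd poly_mapping.lookup c s" for s using S cd(1) unfolding indep_def by blast
      then obtain k where "E c = int p * k" using E_dvd by blast
      then show "z = 1" using cd(4) \<zeta>(1) by (simp add: power_int_mult)
    next
      fix x z assume "(x, z) \<in> A"
      then show "z \<in> prufer p" unfolding A_def using prufer_powi[OF p \<zeta>p] by blast
    qed blast
    have "h c = 1" if "ev c = (\<lambda>_. 1)" for c
      using h(3)[OF AI[of 0 c]] that by (simp add: E_0)
    then have "h \<in> homs p" unfolding homs_def using h by blast
    moreover have "h (frag_of s) = (if s \<in> B then \<zeta> else 1)" if "s \<in> S" for s
      using h(3)[OF AI[of "frag_of s" 0]] that by (simp add: E_of ev_zero keys_frag_of)
    ultimately show ?thesis by blast
  qed
  then obtain H where H: "\<And>B. H B \<in> homs p" "\<And>B s. s \<in> S \<Longrightarrow> H B (frag_of s) = (if s \<in> B then \<zeta> else 1)"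
    by metis
  have "inj_on H (Pow S)"
  proof (rule inj_onI)
    fix B B' assume B: "B \<in> Pow S" "B' \<in> Pow S" "H B = H B'"
    have "s \<in> B \<longleftrightarrow> s \<in> B'" if "s \<in> S" for s
      using H(2)[OF that, of B] H(2)[OF that, of B'] B(3) \<zeta>(2) by (auto split: if_splits)
    then show "B = B'" using B by blast
  qed
  moreover have "H ` Pow S \<subseteq> homs p" using H(1) by blast
  ultimately show ?thesis using card_of_ordLeq by blast
qed

end

section \<open>The cardinality bound\<close>

text \<open>With a base point in each fibre, \<open>x\<close> is determined by \<open>f x\<close>
  and by its difference \<open>\<delta>\<close> from the base point. The counting below applies this
  repeatedly with \<open>quot\<close> as difference.\<close>

lemma card_le_fibres:
  assumes f: "\<And>x. x \<in> A \<Longrightarrow> f x \<in> B"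
    and D: "\<And>x y. x \<in> A \<Longrightarrow> y \<in> A \<Longrightarrow> f x = f y \<Longrightarrow> \<delta> x y \<in> D"
    and inj: "\<And>x x' y. x \<in> A \<Longrightarrow> x' \<in> A \<Longrightarrow> y \<in> A \<Longrightarrow> \<delta> x y = \<delta> x' y \<Longrightarrow> x = x'"
  shows "|A| \<le>o |B \<times> D|"
proof -
  define r where "r b = (SOME y. y \<in> A \<and> f y = b)" for b
  have r: "r (f x) \<in> A" "f (r (f x)) = f x" if "x \<in> A" for x
  proof -
    have "\<exists>y. y \<in> A \<and> f y = f x" using that by blast
    from someI_ex[OF this] show "r (f x) \<in> A" "f (r (f x)) = f x" unfolding r_def by auto
  qed
  have "inj_on (\<lambda>x. (f x, \<delta> x (r (f x)))) A"
  proof (rule inj_onI)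
    fix x y assume xy: "x \<in> A" "y \<in> A" "(f x, \<delta> x (r (f x))) = (f y, \<delta> y (r (f y)))"
    then have "f x = f y" "\<delta> x (r (f x)) = \<delta> y (r (f y))" by auto
    then have "\<delta> x (r (f x)) = \<delta> y (r (f x))" by (simp only:)
    then show "x = y" using inj[OF xy(1,2) r(1)[OF xy(1)]] by simp
  qed
  moreover have "(\<lambda>x. (f x, \<delta> x (r (f x)))) ` A \<subseteq> B \<times> D"
    using f D r by fastforce
  ultimately show ?thesis using card_of_ordLeq by blast
qed

context unimodular_group
begin

lemma homsD:
  assumes "h \<in> homs p"
  shows "is_char h" "h c \<in> prufer p" "ev c = (\<lambda>_. 1) \<Longrightarrow> h c = 1"
  using assms unfolding homs_def by auto

lemma homs_cong:
  assumes h: "h \<in> homs p" and "ev c = ev d"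
  shows "h c = h d"
proof -
  have "ev (c - d) = (\<lambda>_. 1)" using ev_props(7)[of c d] ev_props(4)[of d] assms(2) by (simp add: fun_eq_iff)
  then have "h c * cnj (h d) = 1" using homsD(3)[OF h] is_char_props(7)[OF homsD(1)[OF h]] by metis
  moreover have "h d * cnj (h d) = 1" by (rule is_char_props(4)[OF homsD(1)[OF h]])
  moreover have "cnj (h d) \<noteq> 0" using is_char_props(6)[OF homsD(1)[OF h]] by simp
  ultimately show ?thesis by (metis mult_right_cancel)
qed

definition quot :: "((('a \<Rightarrow> complex) \<Rightarrow>\<^sub>0 int) \<Rightarrow> complex) \<Rightarrow> ((('a \<Rightarrow> complex) \<Rightarrow>\<^sub>0 int) \<Rightarrow> complex) \<Rightarrow> (('a \<Rightarrow> complex) \<Rightarrow>\<^sub>0 int) \<Rightarrow> complex" where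
  "quot h h' = (\<lambda>c. h c * cnj (h' c))"

lemma quot_homs:
  assumes "h \<in> homs p" "h' \<in> homs p"
  shows "quot h h' \<in> homs p"
proof -
  have "is_char (quot h h')"
    unfolding is_char_def quot_def
    using is_char_props(1,2)[OF homsD(1)[OF assms(1)]] is_char_props(1,2)[OF homsD(1)[OF assms(2)]]
    by (simp add: norm_mult mult_ac)
  moreover have "quot h h' c \<in> prufer p" for c
    unfolding quot_def by (intro prufer_mult prufer_cnj homsD(2)[OF assms(1)] homsD(2)[OF assms(2)])
  moreover have "quot h h' c = 1" if "ev c = (\<lambda>_. 1)" for c
    unfolding quot_def using homsD(3)[OF assms(1) that] homsD(3)[OF assms(2) that] by simp
  ultimately show ?thesis unfolding homs_def by blast
qed

lemma quot_inject:
  assumes "h'' \<in> homs p" "quot h h'' = quot h' h''"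
  shows "h = h'"
proof
  fix c
  have "h c * cnj (h'' c) = h' c * cnj (h'' c)" using fun_cong[OF assms(2), of c] unfolding quot_def .
  moreover have "cnj (h'' c) \<noteq> 0" using is_char_props(6)[OF homsD(1)[OF assms(1)]] by simp
  ultimately show "h c = h' c" by simp
qed

text \<open>Evaluation at \<open>g\<close> factors through \<open>h\<close> and is not trivial. In
  the compact group Hom(\<open>X\<close>, circle) this says that \<open>g\<close> defines a
  nontrivial element of the closed subgroup generated by \<open>h\<close>.\<close>

definition dominates :: "((('a \<Rightarrow> complex) \<Rightarrow>\<^sub>0 int) \<Rightarrow> complex) \<Rightarrow> 'a \<Rightarrow> bool" where
  "dominates h g \<longleftrightarrow> (\<forall>c. h c = 1 \<longrightarrow> ev c g = 1) \<and> (\<exists>c. ev c g \<noteq> 1)"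

definition gr :: "((('a \<Rightarrow> complex) \<Rightarrow>\<^sub>0 int) \<Rightarrow> complex) \<Rightarrow> 'a \<Rightarrow> (complex \<times> complex) set" where
  "gr h g = {(h c, ev c g) | c. True}"

text \<open>If \<open>h\<close> sends \<open>c\<close> to a \<open>p ^ n\<close>-th root of unity,
  it kills \<open>p ^ n\<close> times \<open>c\<close>, and so does evaluation at \<open>g\<close>.
  Hence a factorization is a subset of a countable set.\<close>

lemma gr_subset:
  assumes h: "h \<in> homs p" and dom: "dominates h g"
  shows "gr h g \<subseteq> prufer p \<times> prufer p"
proof clarify
  fix z w assume "(z, w) \<in> gr h g"
  then obtain c where c: "z = h c" "w = ev c g" unfolding gr_def by blast
  obtain n where "h c ^ (p ^ n) = 1" using homsD(2)[OF h, of c] unfolding prufer_def by blast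
  then have "h (frag_cmul (int (p ^ n)) c) = 1" by (simp add: is_char_cmul[OF homsD(1)[OF h]] del: of_nat_power)
  then have "ev (frag_cmul (int (p ^ n)) c) g = 1" using dom unfolding dominates_def by blast
  then have "ev c g ^ (p ^ n) = 1" by (simp add: ev_props(8) del: of_nat_power)
  then show "z \<in> prufer p \<and> w \<in> prufer p" using c homsD(2)[OF h] unfolding prufer_def by blast
qed

text \<open>Evaluation at \<open>g\<close> is \<open>\<phi> \<circ> h = \<phi> \<circ> h'\<close> for a single \<open>\<phi>\<close>, the relation \<open>gr h g\<close>. So \<open>quot h h'\<close> has values
  in the kernel of \<open>\<phi>\<close>, which is a proper and therefore finite subgroup of the Pruefer group.\<close>

lemma same_graph:
  assumes p: "prime p" and h: "h \<in> homs p" and h': "h' \<in> homs p"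
    and dom: "dominates h g" and gr: "gr h g = gr h' g" and c0: "ev c0 g \<noteq> 1"
  shows "\<exists>d. h d = quot h h' c" "h c0 \<noteq> quot h h' c ^ i"
    "h c0 ^ (p ^ m) = 1 \<Longrightarrow> quot h h' c ^ (p ^ m) = 1"
proof -
  \<comment> \<open>Equality of the graphs provides \<open>c'\<close> at which \<open>h\<close>
    takes the value of \<open>h'\<close> at \<open>c\<close> while the evaluations agree. So
    \<open>c - c'\<close> is killed by evaluation at \<open>g\<close>, and \<open>h\<close> sends it
    to \<open>quot h h' c\<close>.\<close>
  have "(h' c, ev c g) \<in> gr h g" unfolding gr unfolding gr_def by blast
  then obtain c' where c': "h c' = h' c" "ev c' g = ev c g" unfolding gr_def by auto
  have d: "h (c - c') = quot h h' c" "ev (c - c') g = 1"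
    using is_char_props(7)[OF homsD(1)[OF h], of c c'] ev_props(7)[of c c' g] ev_props(4)[of c g] c'
    by (simp_all add: quot_def)
  then show "\<exists>d. h d = quot h h' c" by blast
  have ne: "h c0 \<noteq> quot h h' c ^ i" for i
  proof
    \<comment> \<open>Then \<open>c0\<close> differs from \<open>i\<close> times
      \<open>c - c'\<close> by an element of the kernel of \<open>h\<close>, so evaluation at
      \<open>g\<close> kills \<open>c0\<close>.\<close>
    assume eq: "h c0 = quot h h' c ^ i"
    have "h (frag_cmul (int i) (c - c')) = h c0"
      by (simp add: is_char_cmul[OF homsD(1)[OF h]] d(1) eq)
    then have "h (c0 - frag_cmul (int i) (c - c')) = 1"
      using is_char_props(7)[OF homsD(1)[OF h], of c0 "frag_cmul (int i) (c - c')"]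
        is_char_props(4)[OF homsD(1)[OF h], of c0] by simp
    then have "ev (c0 - frag_cmul (int i) (c - c')) g = 1" using dom unfolding dominates_def by blast
    moreover have "ev (frag_cmul (int i) (c - c')) g = 1" using ev_props(8)[of "int i" "c - c'" g] d(2) by simp
    ultimately show False using c0 ev_props(7)[of c0 "frag_cmul (int i) (c - c')" g] by simp
  qed
  then show "h c0 \<noteq> quot h h' c ^ i" .
  assume w: "h c0 ^ (p ^ m) = 1"
  define z where "z = quot h h' c"
  show "quot h h' c ^ (p ^ m) = 1"
  proof (rule ccontr)
    assume "quot h h' c ^ (p ^ m) \<noteq> 1"
    then have zm: "z ^ (p ^ m) \<noteq> 1" by (simp add: z_def)
    have ex: "\<exists>j. z ^ (p ^ j) = 1" using homsD(2)[OF quot_homs[OF h h'], of c] unfolding z_def prufer_def by blast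
    \<comment> \<open>\<open>z\<close> has order \<open>p ^ j\<close>. If \<open>j\<close> exceeded
      \<open>m\<close>, a power of \<open>z\<close> would have order \<open>p ^ m\<close> and
      generate all \<open>p ^ m\<close>-th roots of unity, among them \<open>h c0\<close>.\<close>
    define j where "j = (LEAST j. z ^ (p ^ j) = 1)"
    have j: "z ^ (p ^ j) = 1" unfolding j_def by (rule LeastI_ex[OF ex])
    have least: "z ^ (p ^ i) \<noteq> 1" if "i < j" for i using not_less_Least[OF that[unfolded j_def]] .
    have mj: "m < j"
    proof (rule ccontr)
      assume "\<not> m < j"
      then have "p ^ m = p ^ j * p ^ (m - j)" by (simp flip: power_add)
      then have "z ^ (p ^ m) = 1" by (simp add: power_mult j)
      then show False using zm by simp
    qed
    obtain i where "h c0 = (z ^ (p ^ (j - m))) ^ i"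
    proof (rule root_of_unity_power[OF p])
      have "(z ^ (p ^ (j - m))) ^ (p ^ m) = z ^ (p ^ j)" using mj by (simp flip: power_mult power_add)
      then show "(z ^ (p ^ (j - m))) ^ (p ^ m) = 1" using j by simp
      show "(z ^ (p ^ (j - m))) ^ (p ^ (m - 1)) \<noteq> 1" if "m > 0"
      proof -
        have "(z ^ (p ^ (j - m))) ^ (p ^ (m - 1)) = z ^ (p ^ (j - 1))"
          using mj that by (simp flip: power_mult power_add)
        then show ?thesis using least[of "j - 1"] mj by simp
      qed
      show "h c0 ^ (p ^ m) = 1" by (rule w)
    qed blast
    then have "h c0 = quot h h' c ^ (p ^ (j - m) * i)" by (simp add: z_def power_mult)
    then show False using ne by blast
  qed
qed

lemma ex_dominated:
  assumes h: "h \<in> homs p" and nt: "h \<noteq> (\<lambda>_. 1)"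
    and proper: "\<And>Y. Y \<subset> X \<Longrightarrow> (\<lambda>_. 1) \<in> Y \<Longrightarrow> (\<And>x y. x \<in> Y \<Longrightarrow> y \<in> Y \<Longrightarrow> (\<lambda>a. x a * y a) \<in> Y) \<Longrightarrow>
        (\<And>x. x \<in> Y \<Longrightarrow> (\<lambda>a. cnj (x a)) \<in> Y) \<Longrightarrow> \<exists>g\<in>C. (\<forall>y\<in>Y. y g = 1) \<and> (\<exists>x\<in>X. x g \<noteq> 1)"
  shows "\<exists>g\<in>C. dominates h g"
proof -
  have frag: "h c = h (frag_of (ev c))" for c
    by (rule homs_cong[OF h]) (simp add: ev_frag_of ev_mem)
  define Y where "Y = {x \<in> X. h (frag_of x) = 1}"
  have "Y \<noteq> X"
  proof
    assume "Y = X"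
    then have "h (frag_of (ev c)) = 1" for c using ev_mem[of c] unfolding Y_def by blast
    then show False using nt frag by (simp add: fun_eq_iff)
  qed
  then have Y1: "Y \<subset> X" unfolding Y_def by blast
  have Y2: "(\<lambda>_. 1) \<in> Y" unfolding Y_def using one_mem homsD(3)[OF h] ev_frag_of[OF one_mem] by simp
  have Y3: "(\<lambda>a. x a * y a) \<in> Y" if "x \<in> Y" "y \<in> Y" for x y
  proof -
    have xy: "x \<in> X" "y \<in> X" "h (frag_of x) = 1" "h (frag_of y) = 1" using that unfolding Y_def by auto
    have "ev (frag_of (\<lambda>a. x a * y a)) = ev (frag_of x + frag_of y)"
      using xy by (simp add: fun_eq_iff ev_add ev_frag_of mult_mem)
    from homs_cong[OF h this] have "h (frag_of (\<lambda>a. x a * y a)) = 1"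
      using is_char_props(1)[OF homsD(1)[OF h], of "frag_of x" "frag_of y"] xy by simp
    then show ?thesis unfolding Y_def using xy mult_mem by blast
  qed
  have Y4: "(\<lambda>a. cnj (x a)) \<in> Y" if "x \<in> Y" for x
  proof -
    have x: "x \<in> X" "h (frag_of x) = 1" using that unfolding Y_def by auto
    have "ev (frag_of (\<lambda>a. cnj (x a))) = ev (- frag_of x)"
      using x by (simp add: fun_eq_iff ev_props(5) ev_frag_of cnj_mem)
    from homs_cong[OF h this] have "h (frag_of (\<lambda>a. cnj (x a))) = 1"
      using is_char_props(5)[OF homsD(1)[OF h], of "frag_of x"] x by simp
    then show ?thesis unfolding Y_def using x cnj_mem by blast
  qed
  have "\<exists>g\<in>C. (\<forall>y\<in>Y. y g = 1) \<and> (\<exists>x\<in>X. x g \<noteq> 1)"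
    by (rule proper[OF Y1 Y2 Y3 Y4])
  then obtain g where g: "g \<in> C" "\<And>y. y \<in> Y \<Longrightarrow> y g = 1" "\<exists>x\<in>X. x g \<noteq> 1" by blast
  have "ev c g = 1" if "h c = 1" for c
    using g(2)[of "ev c"] that frag[of c] ev_mem unfolding Y_def by simp
  moreover have "\<exists>c. ev c g \<noteq> 1" using g(3) ev_frag_of by metis
  ultimately show ?thesis using g(1) unfolding dominates_def by blast
qed

text \<open>The fibres of the code \<open>(G h, gr h (G h))\<close> consist, up to a base point, of
  homomorphisms of bounded exponent, so these are counted beforehand. On \<open>H 1\<close> the
  fibres are trivial; \<open>H (Suc k)\<close> is mapped to \<open>H k\<close> by the
  \<open>p\<close>-th power, with fibres in \<open>H 1\<close>; the union over \<open>k\<close> then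
  bounds the fibres on all of \<open>homs p\<close>.\<close>

theorem uncountable_imp_Pow_le:
  assumes unc: "uncountable X"
    and proper: "\<And>Y. Y \<subset> X \<Longrightarrow> (\<lambda>_. 1) \<in> Y \<Longrightarrow> (\<And>x y. x \<in> Y \<Longrightarrow> y \<in> Y \<Longrightarrow> (\<lambda>a. x a * y a) \<in> Y) \<Longrightarrow>
        (\<And>x. x \<in> Y \<Longrightarrow> (\<lambda>a. cnj (x a)) \<in> Y) \<Longrightarrow> \<exists>g\<in>C. (\<forall>y\<in>Y. y g = 1) \<and> (\<exists>x\<in>X. x g \<noteq> 1)"
    and cont: "|UNIV :: real set| \<le>o |C|"
  shows "\<exists>S. S \<subseteq> X \<and> uncountable S \<and> |Pow S| \<le>o |C|"
proof -
  obtain p S where p: "prime p" and S: "indep p S" "uncountable S"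
    using ex_uncountable_indep[OF unc] by blast
  have infC: "infinite C"
    using cont card_of_ordLeq_infinite infinite_UNIV_char_0 by blast
  define Q where "Q = prufer p \<times> prufer p"
  \<comment> \<open>The continuum bound on \<open>C\<close> absorbs the number of possible
    factorizations.\<close>
  have PowQ: "|Pow Q| \<le>o |C|"
  proof -
    have "countable Q" unfolding Q_def using countable_prufer[OF p] by simp
    then obtain f :: "complex \<times> complex \<Rightarrow> nat" where "inj_on f Q" unfolding countable_def by blast
    then have "inj_on (image f) (Pow Q)" by (rule inj_on_image_Pow)
    then have 1: "|Pow Q| \<le>o |UNIV :: nat set set|" using card_of_ordLeq by blast
    have "(UNIV :: nat set set) \<lesssim> (UNIV :: real set)"
      using nat_sets_eqpoll_reals eqpoll_imp_lepoll by blast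
    then have 2: "|UNIV :: nat set set| \<le>o |UNIV :: real set|" unfolding lepoll_def card_of_ordLeq .
    show ?thesis by (rule ordLeq_transitive[OF ordLeq_transitive[OF 1 2] cont])
  qed
  have one_C: "|{a}| \<le>o |C|" for a :: "(('a \<Rightarrow> complex) \<Rightarrow>\<^sub>0 int) \<Rightarrow> complex"
    by (rule card_of_singl_ordLeq) (use infC in auto)
  define H where "H k = {h \<in> homs p. \<forall>c. h c ^ (p ^ k) = 1}" for k
  have G: "\<exists>g\<in>C. dominates h g" if "h \<in> homs p" "h \<noteq> (\<lambda>_. 1)" for h
    by (rule ex_dominated[OF that proper])
  then obtain G where G: "\<And>h. h \<in> homs p \<Longrightarrow> h \<noteq> (\<lambda>_. 1) \<Longrightarrow> G h \<in> C"
    "\<And>h. h \<in> homs p \<Longrightarrow> h \<noteq> (\<lambda>_. 1) \<Longrightarrow> dominates h (G h)" by metis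
  have code: "(G h, gr h (G h)) \<in> C \<times> Pow Q" if "h \<in> homs p" "h \<noteq> (\<lambda>_. 1)" for h
    using G[OF that] gr_subset[OF that(1)] unfolding Q_def by blast
  have CQ: "|C \<times> Pow Q| \<le>o |C|" by (rule card_of_Times_ordLeq_infinite[OF infC ordLeq_refl[OF card_of_Card_order] PowQ])
  \<comment> \<open>The trivial homomorphism dominates no point and has to be counted apart.\<close>
  have insert_1: "|A| \<le>o |C|" if "|A - {\<lambda>_. 1}| \<le>o |C|"
    for A :: "((('a \<Rightarrow> complex) \<Rightarrow>\<^sub>0 int) \<Rightarrow> complex) set"
  proof -
    have "|(A - {\<lambda>_. 1}) \<union> {\<lambda>_. 1}| \<le>o |C|" by (rule card_of_Un_ordLeq_infinite[OF infC that one_C])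
    moreover have "|A| \<le>o |(A - {\<lambda>_. 1}) \<union> {\<lambda>_. 1}|" by (rule card_of_mono1) auto
    ultimately show ?thesis by (rule ordLeq_transitive[rotated])
  qed
  have H1: "|H 1| \<le>o |C|"
  proof (rule insert_1)
    have "|H 1 - {\<lambda>_. 1}| \<le>o |(C \<times> Pow Q) \<times> {\<lambda>_::(('a \<Rightarrow> complex) \<Rightarrow>\<^sub>0 int). 1::complex}|"
    proof (rule card_le_fibres[where f = "\<lambda>h. (G h, gr h (G h))" and \<delta> = quot])
      fix h assume "h \<in> H 1 - {\<lambda>_. 1}"
      then show "(G h, gr h (G h)) \<in> C \<times> Pow Q" using code unfolding H_def by blast
    next
      fix h h' assume "h \<in> H 1 - {\<lambda>_. 1}" "h' \<in> H 1 - {\<lambda>_. 1}" and eq: "(G h, gr h (G h)) = (G h', gr h' (G h'))"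
      then have hh: "h \<in> homs p" "h' \<in> homs p" "h \<noteq> (\<lambda>_. 1)" "\<And>c. h c ^ p = 1"
        unfolding H_def by auto
      have dom: "dominates h (G h)" by (rule G(2)[OF hh(1,3)])
      then obtain c0 where c0: "ev c0 (G h) \<noteq> 1" unfolding dominates_def by blast
      have eq': "gr h (G h) = gr h' (G h)" using eq by (metis Pair_inject)
      have "quot h h' c = 1" for c
      proof (rule ccontr)
        \<comment> \<open>A value of exponent \<open>p\<close> other than 1 generates all
          \<open>p\<close>-th roots of unity, so \<open>h c0\<close> would be one of its
          powers.\<close>
        assume ne: "quot h h' c \<noteq> 1"
        obtain d where d: "h d = quot h h' c" using same_graph(1)[OF p hh(1,2) dom eq' c0] by blast
        have u: "quot h h' c ^ (p ^ 1) = 1" "quot h h' c ^ (p ^ (1 - 1)) \<noteq> 1" "h c0 ^ (p ^ 1) = 1"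
          using hh(4)[of d] hh(4)[of c0] d ne by auto
        obtain i where "h c0 = quot h h' c ^ i" using root_of_unity_power[OF p u] by blast
        then show False using same_graph(2)[OF p hh(1,2) dom eq' c0] by blast
      qed
      then show "quot h h' \<in> {\<lambda>_. 1}" by blast
    next
      fix h h' h'' assume "h'' \<in> H 1 - {\<lambda>_. 1}" "quot h h'' = quot h' h''"
      then show "h = h'" using quot_inject unfolding H_def by blast
    qed
    also have "|(C \<times> Pow Q) \<times> {\<lambda>_::(('a \<Rightarrow> complex) \<Rightarrow>\<^sub>0 int). 1::complex}| \<le>o |C|"
      by (rule card_of_Times_ordLeq_infinite[OF infC CQ one_C])
    finally show "|H 1 - {\<lambda>_. 1}| \<le>o |C|" .
  qed
  have H: "|H k| \<le>o |C|" for k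
  proof (induction k)
    case 0
    have "H 0 \<subseteq> {\<lambda>_. 1}" unfolding H_def by auto
    then have "|H 0| \<le>o |{\<lambda>_::(('a \<Rightarrow> complex) \<Rightarrow>\<^sub>0 int). 1::complex}|" by (rule card_of_mono1)
    then show ?case using one_C by (rule ordLeq_transitive)
  next
    case (Suc k)
    have "|H (Suc k)| \<le>o |H k \<times> H 1|"
    proof (rule card_le_fibres[where f = "\<lambda>h c. h c ^ p" and \<delta> = quot])
      fix h assume "h \<in> H (Suc k)"
      then have h: "h \<in> homs p" "\<And>c. h c ^ (p ^ Suc k) = 1" unfolding H_def by auto
      have "is_char (\<lambda>c. h c ^ p)"
        unfolding is_char_def using is_char_props(1,2)[OF homsD(1)[OF h(1)]]
        by (simp add: power_mult_distrib norm_power)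
      moreover have "h c ^ p \<in> prufer p" for c by (rule prufer_power[OF homsD(2)[OF h(1)]])
      moreover have "h c ^ p = 1" if "ev c = (\<lambda>_. 1)" for c using homsD(3)[OF h(1) that] by simp
      ultimately have "(\<lambda>c. h c ^ p) \<in> homs p" unfolding homs_def by blast
      moreover have "(h c ^ p) ^ (p ^ k) = 1" for c using h(2)[of c] by (simp add: power_mult)
      ultimately show "(\<lambda>c. h c ^ p) \<in> H k" unfolding H_def by blast
    next
      fix h h' assume hh: "h \<in> H (Suc k)" "h' \<in> H (Suc k)" "(\<lambda>c. h c ^ p) = (\<lambda>c. h' c ^ p)"
      then have hm: "h \<in> homs p" "h' \<in> homs p" unfolding H_def by auto
      have "quot h h' c ^ p = 1" for c
      proof -
        have "quot h h' c ^ p = (h' c * cnj (h' c)) ^ p"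
          using fun_cong[OF hh(3), of c] by (simp add: quot_def power_mult_distrib)
        then show ?thesis using is_char_props(4)[OF homsD(1)[OF hm(2)], of c] by simp
      qed
      then show "quot h h' \<in> H 1" unfolding H_def using quot_homs[OF hm] by simp
    next
      fix h h' h'' assume "h'' \<in> H (Suc k)" "quot h h'' = quot h' h''"
      then show "h = h'" using quot_inject unfolding H_def by blast
    qed
    then show ?case by (rule ordLeq_transitive[OF _ card_of_Times_ordLeq_infinite[OF infC Suc H1]])
  qed
  have UH: "|\<Union>k. H k| \<le>o |C|"
  proof (rule card_of_UNION_ordLeq_infinite[OF infC])
    show "|UNIV :: nat set| \<le>o |C|" by (rule iffD1[OF infinite_iff_card_of_nat infC])
  qed (use H in blast)
  have "|homs p| \<le>o |C|"
  proof (rule insert_1)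
    have "|homs p - {\<lambda>_. 1}| \<le>o |(C \<times> Pow Q) \<times> (\<Union>k. H k)|"
    proof (rule card_le_fibres[where f = "\<lambda>h. (G h, gr h (G h))" and \<delta> = quot])
      fix h assume "h \<in> homs p - {\<lambda>_. 1}"
      then show "(G h, gr h (G h)) \<in> C \<times> Pow Q" using code by blast
    next
      fix h h' assume "h \<in> homs p - {\<lambda>_. 1}" "h' \<in> homs p - {\<lambda>_. 1}" and eq: "(G h, gr h (G h)) = (G h', gr h' (G h'))"
      then have hh: "h \<in> homs p" "h' \<in> homs p" "h \<noteq> (\<lambda>_. 1)" by auto
      have dom: "dominates h (G h)" by (rule G(2)[OF hh(1,3)])
      then obtain c0 where c0: "ev c0 (G h) \<noteq> 1" unfolding dominates_def by blast
      have eq': "gr h (G h) = gr h' (G h)" using eq by (metis Pair_inject)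
      \<comment> \<open>The order of the single value \<open>h c0\<close> bounds the exponent of the
        quotient.\<close>
      obtain m where m: "h c0 ^ (p ^ m) = 1" using homsD(2)[OF hh(1), of c0] unfolding prufer_def by blast
      have "quot h h' c ^ (p ^ m) = 1" for c by (rule same_graph(3)[OF p hh(1,2) dom eq' c0 m])
      then have "quot h h' \<in> H m" unfolding H_def using quot_homs[OF hh(1,2)] by blast
      then show "quot h h' \<in> (\<Union>k. H k)" by blast
    next
      fix h h' h'' assume "h'' \<in> homs p - {\<lambda>_. 1}" "quot h h'' = quot h' h''"
      then show "h = h'" using quot_inject by blast
    qed
    also have "|(C \<times> Pow Q) \<times> (\<Union>k. H k)| \<le>o |C|"
      by (rule card_of_Times_ordLeq_infinite[OF infC CQ UH])
    finally show "|homs p - {\<lambda>_. 1}| \<le>o |C|" .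
  qed
  then have "|Pow S| \<le>o |C|" by (rule ordLeq_transitive[OF Pow_indep_le_homs[OF p S(1)]])
  then show ?thesis using S unfolding indep_def by blast
qed

end

section \<open>Characters of pseudocompact groups\<close>

text \<open>An infinite set without accumulation point contains a closed discrete sequence; Tietze's
  theorem extends its numbering to an unbounded continuous function.\<close>

lemma pseudocompact_metrizable_imp_compact:
  assumes met: "metrizable_space T" and pc: "pseudocompact_space T"
  shows "compact_space T"
proof -
  obtain M d where M: "Metric_space M d" and T: "T = Metric_space.mtopology M d"
    using met unfolding metrizable_space_def by blast
  interpret Metric_space M d by (rule M)
  show ?thesis
    unfolding T compact_space_eq_Bolzano_Weierstrass
  proof (intro allI impI notI)
    fix S assume S: "S \<subseteq> M \<and> infinite S" and der: "mtopology derived_set_of S = {}"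
    obtain f :: "nat \<Rightarrow> 'a" where f: "inj f" "range f \<subseteq> S"
      using infinite_countable_subset[of S] S by blast
    have der': "mtopology derived_set_of range f = {}"
      using derived_set_of_mono[OF f(2), of mtopology] der by blast
    have sub: "range f \<subseteq> topspace mtopology" using f(2) S by auto
    have "closedin mtopology (range f)"
      unfolding closedin_contains_derived_set using der' sub by simp
    moreover have "subtopology mtopology (range f) = discrete_topology (range f)"
      by (rule subtopology_eq_discrete_topology) (use der' sub in simp)
    then have "continuous_map (subtopology mtopology (range f)) euclideanreal (\<lambda>x. real (inv_into UNIV f x))"
      by simp
    moreover have "normal_space mtopology" by (rule normal_space_mtopology)
    moreover have "is_interval (UNIV :: real set)" by simp
    ultimately obtain g where g: "continuous_map mtopology euclideanreal g"
      "\<And>x. x \<in> range f \<Longrightarrow> g x = real (inv_into UNIV f x)"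
      using Tietze_extension_realinterval[of mtopology "range f" UNIV "\<lambda>x. real (inv_into UNIV f x)"] by auto
    have "bounded (g ` topspace mtopology)" using pc g(1) unfolding pseudocompact_space_def T by blast
    then obtain B where B: "\<And>x. x \<in> M \<Longrightarrow> \<bar>g x\<bar> \<le> B" unfolding bounded_iff by auto
    have "real n \<le> B" for n
    proof -
      have "g (f n) = real n" using g(2)[of "f n"] f(1) by simp
      moreover have "f n \<in> M" using f(2) S by blast
      ultimately show ?thesis using B[of "f n"] by simp
    qed
    then show False using reals_Archimedean2[of B] by (meson not_le)
  qed
qed

lemma continuous_map_metric_iff:
  fixes f :: "'a \<Rightarrow> 'b::metric_space"
  shows "continuous_map T euclidean f \<longleftrightarrow>
    (\<forall>x\<in>topspace T. \<forall>e>0. \<exists>U. openin T U \<and> x \<in> U \<and> (\<forall>y\<in>U. dist (f x) (f y) < e))"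
  using Met_TC.continuous_map_to_metric[of T f] by simp

lemma continuous_map_complex_mult:
  fixes f g :: "'a \<Rightarrow> complex"
  assumes "continuous_map T euclidean f" "continuous_map T euclidean g"
  shows "continuous_map T euclidean (\<lambda>x. f x * g x)"
  using assms unfolding continuous_map_atin by (auto intro: tendsto_mult)

lemma continuous_map_complex_cnj:
  fixes f :: "'a \<Rightarrow> complex"
  assumes "continuous_map T euclidean f"
  shows "continuous_map T euclidean (\<lambda>x. cnj (f x))"
  using assms unfolding continuous_map_atin by (auto intro: tendsto_cnj)

section \<open>Continuous pseudonorms and continuous characters of an abelian topological
  group\<close>

locale abelian_topological_group = comm_group G for G (structure) +
  fixes T :: "'a topology"
  assumes group_topology: "group_topology G T"
begin

lemma topspace [simp]: "topspace T = carrier G"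
  and mult_continuous: "continuous_map (prod_topology T T) T (\<lambda>(x, y). x \<otimes> y)"
  and inv_continuous: "continuous_map T T (\<lambda>x. inv x)"
  and Hausdorff: "Hausdorff_space T"
  using group_topology unfolding group_topology_def by auto

lemma translation_continuous:
  assumes "c \<in> carrier G"
  shows "continuous_map T T (\<lambda>x. x \<otimes> c)"
proof -
  have "continuous_map T (prod_topology T T) (\<lambda>x. (x, c))"
    using assms by (simp add: continuous_map_pairedI)
  from continuous_map_compose[OF this mult_continuous] show ?thesis by (simp add: o_def)
qed

lemma neighbourhood_product:
  assumes U: "openin T U" "\<one> \<in> U"
  obtains W where "openin T W" "\<one> \<in> W" "\<And>x y. x \<in> W \<Longrightarrow> y \<in> W \<Longrightarrow> x \<otimes> y \<in> U"
proof -
  have op: "openin (prod_topology T T) {z \<in> topspace (prod_topology T T). (case z of (x, y) \<Rightarrow> x \<otimes> y) \<in> U}"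
    by (rule openin_continuous_map_preimage[OF mult_continuous U(1)])
  have mem: "(\<one>, \<one>) \<in> {z \<in> topspace (prod_topology T T). (case z of (x, y) \<Rightarrow> x \<otimes> y) \<in> U}"
    using U(2) by simp
  from openin_prod_topology_alt[THEN iffD1, rule_format, OF op mem]
  obtain A B where AB: "openin T A" "openin T B" "\<one> \<in> A" "\<one> \<in> B"
    "A \<times> B \<subseteq> {z \<in> topspace (prod_topology T T). (case z of (x, y) \<Rightarrow> x \<otimes> y) \<in> U}"
    by (elim exE conjE)
  show thesis
  proof (rule that[of "A \<inter> B"])
    show "openin T (A \<inter> B)" using AB by blast
    show "\<one> \<in> A \<inter> B" using AB by blast
    show "x \<otimes> y \<in> U" if "x \<in> A \<inter> B" "y \<in> A \<inter> B" for x y using AB(5) that by auto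
  qed
qed

lemma neighbourhood_triple:
  assumes U: "openin T U" "\<one> \<in> U"
  shows "\<exists>W. openin T W \<and> \<one> \<in> W \<and> (\<forall>x\<in>W. inv x \<in> W) \<and> (\<forall>x\<in>W. \<forall>y\<in>W. \<forall>z\<in>W. x \<otimes> y \<otimes> z \<in> U)"
proof -
  obtain A where A: "openin T A" "\<one> \<in> A" "\<And>x y. x \<in> A \<Longrightarrow> y \<in> A \<Longrightarrow> x \<otimes> y \<in> U"
    using neighbourhood_product[OF U] by blast
  obtain B where B: "openin T B" "\<one> \<in> B" "\<And>x y. x \<in> B \<Longrightarrow> y \<in> B \<Longrightarrow> x \<otimes> y \<in> A"
    using neighbourhood_product[OF A(1,2)] by blast
  define D where "D = A \<inter> B"
  define W where "W = D \<inter> {x \<in> topspace T. inv x \<in> D}"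
  have D: "openin T D" "\<one> \<in> D" unfolding D_def using A B by auto
  have "openin T W" unfolding W_def
    by (intro openin_Int D openin_continuous_map_preimage[OF inv_continuous])
  moreover have "\<one> \<in> W" unfolding W_def using D by simp
  moreover have "\<forall>x\<in>W. inv x \<in> W" unfolding W_def by auto
  moreover have "x \<otimes> y \<otimes> z \<in> U" if "x \<in> W" "y \<in> W" "z \<in> W" for x y z
    using that A(3) B(3) unfolding W_def D_def by blast
  ultimately show ?thesis by blast
qed

definition pr :: "('a \<Rightarrow>\<^sub>0 int) \<Rightarrow> 'a" where
  "pr = (SOME h. h \<in> hom (free_Abelian_group UNIV) G \<and>
      (\<forall>x. h (frag_of x) = (if x \<in> carrier G then x else \<one>)))"

lemma pr: "pr \<in> hom (free_Abelian_group UNIV) G" "pr (frag_of x) = (if x \<in> carrier G then x else \<one>)"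
proof -
  have "(\<lambda>x. if x \<in> carrier G then x else \<one>) ` UNIV \<subseteq> carrier G" by auto
  then obtain h where "h \<in> hom (free_Abelian_group UNIV) G"
    "\<And>x. x \<in> UNIV \<Longrightarrow> h (frag_of x) = (if x \<in> carrier G then x else \<one>)"
    using free_Abelian_group_universal[of "\<lambda>x. if x \<in> carrier G then x else \<one>" UNIV] by metis
  then have "\<exists>h. h \<in> hom (free_Abelian_group UNIV) G \<and>
      (\<forall>x. h (frag_of x) = (if x \<in> carrier G then x else \<one>))" by blast
  from someI_ex[OF this] show "pr \<in> hom (free_Abelian_group UNIV) G"
    "pr (frag_of x) = (if x \<in> carrier G then x else \<one>)" unfolding pr_def by blast+
qed

lemma pr_closed [simp]: "pr c \<in> carrier G"
  using pr(1) by (auto simp: hom_def)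

lemma pr_add: "pr (c + d) = pr c \<otimes> pr d"
  using pr(1) by (auto simp: hom_def)

lemma pr_frag_of [simp]: "x \<in> carrier G \<Longrightarrow> pr (frag_of x) = x"
  by (simp add: pr(2))

lemma pr_zero [simp]: "pr 0 = \<one>"
  using pr_add[of 0 0] by simp

lemma pr_minus: "pr (- c) = inv (pr c)"
  using pr_add[of c "- c"] by (simp add: inv_unique' m_comm)

lemma pr_diff: "pr (c - d) = pr c \<otimes> inv (pr d)"
  using pr_add[of c "- d"] by (simp add: pr_minus)

text \<open>Symmetric neighbourhoods with threefold products in their predecessors are chosen so
  that none contains \<open>a\<close>, and are pulled back along \<open>pr\<close>. The last
  property is continuity at the identity; the one before it lets functions of \<open>N\<close>
  descend to \<open>G\<close>.\<close>

lemma continuous_pseudonorm: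
  assumes a: "a \<in> carrier G" "a \<noteq> \<one>"
  obtains N where "N 0 = (0::real)" "\<And>x. N (- x) = N x" "\<And>x y. N (x + y) \<le> N x + N y"
    "N (frag_of a) > 0" "\<And>x. pr x = \<one> \<Longrightarrow> N x = 0"
    "\<And>e. e > 0 \<Longrightarrow> \<exists>U. openin T U \<and> \<one> \<in> U \<and> (\<forall>x. pr x \<in> U \<longrightarrow> N x < e)"
proof -
  obtain U0 where U0: "openin T U0" "\<one> \<in> U0" "a \<notin> U0"
  proof -
    obtain U V where "openin T U" "openin T V" "\<one> \<in> U" "a \<in> V" "disjnt U V"
      using Hausdorff a unfolding Hausdorff_space_def by (metis one_closed topspace)
    then show thesis using that unfolding disjnt_def by blast
  qed
  define P where "P n U \<longleftrightarrow> openin T U \<and> \<one> \<in> U \<and> (\<forall>x\<in>U. inv x \<in> U) \<and> a \<notin> U" for n :: nat and U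
  obtain W0 where W0: "openin T W0" "\<one> \<in> W0" "\<forall>x\<in>W0. inv x \<in> W0" "\<forall>x\<in>W0. \<forall>y\<in>W0. \<forall>z\<in>W0. x \<otimes> y \<otimes> z \<in> U0"
    using neighbourhood_triple[OF U0(1,2)] by blast
  have sub: "W \<subseteq> U" if "openin T W" "\<one> \<in> W" "\<forall>x\<in>W. \<forall>y\<in>W. \<forall>z\<in>W. x \<otimes> y \<otimes> z \<in> U" for W U
  proof
    fix x assume x: "x \<in> W"
    then have "x \<in> carrier G" using openin_subset[OF that(1)] by auto
    moreover have "x \<otimes> \<one> \<otimes> \<one> \<in> U" using x that(2,3) by blast
    ultimately show "x \<in> U" by simp
  qed
  have "\<exists>U. \<forall>n. P n (U n) \<and> (\<forall>x\<in>U (Suc n). \<forall>y\<in>U (Suc n). \<forall>z\<in>U (Suc n). x \<otimes> y \<otimes> z \<in> U n)"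
  proof (rule dependent_nat_choice)
    have "a \<notin> W0" using sub[OF W0(1,2,4)] U0(3) by (rule contra_subsetD)
    then have "P 0 W0" using W0(1,2,3) unfolding P_def by (intro conjI)
    then show "\<exists>U. P 0 U" by (rule exI)
    fix U n assume "P n U"
    then obtain W where W: "openin T W" "\<one> \<in> W" "\<forall>x\<in>W. inv x \<in> W" "\<forall>x\<in>W. \<forall>y\<in>W. \<forall>z\<in>W. x \<otimes> y \<otimes> z \<in> U"
      using neighbourhood_triple[of U] unfolding P_def by blast
    have "a \<notin> U" using \<open>P n U\<close> unfolding P_def by (elim conjE)
    with sub[OF W(1,2,4)] have "a \<notin> W" by (rule contra_subsetD)
    then have "P (Suc n) W" using W(1,2,3) unfolding P_def by (intro conjI)
    then show "\<exists>W. P (Suc n) W \<and> (\<forall>x\<in>W. \<forall>y\<in>W. \<forall>z\<in>W. x \<otimes> y \<otimes> z \<in> U)"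
      using W(4) by (intro exI conjI)
  qed
  then obtain U where PU: "\<And>n. P n (U n)"
    and U_triple: "\<And>n. \<forall>x\<in>U (Suc n). \<forall>y\<in>U (Suc n). \<forall>z\<in>U (Suc n). x \<otimes> y \<otimes> z \<in> U n" by meson
  have PU': "openin T (U n) \<and> \<one> \<in> U n \<and> (\<forall>x\<in>U n. inv x \<in> U n) \<and> a \<notin> U n" for n
    using PU[of n] unfolding P_def .
  have U: "openin T (U n)" "\<one> \<in> U n" "x \<in> U n \<Longrightarrow> inv x \<in> U n" "a \<notin> U n" for n x
    using PU'[of n] by auto
  have U3: "x \<otimes> y \<otimes> z \<in> U n" if "x \<in> U (Suc n)" "y \<in> U (Suc n)" "z \<in> U (Suc n)" for n x y z
    using U_triple[of n] that by blast
  obtain N :: "('a \<Rightarrow>\<^sub>0 int) \<Rightarrow> real" where N: "N 0 = 0" "\<And>x. N (- x) = N x" "\<And>x y. N (x + y) \<le> N x + N y"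
    "\<And>n x. x \<in> pr -` U n \<Longrightarrow> N x \<le> (1/2) ^ n" "\<And>n x. x \<notin> pr -` U n \<Longrightarrow> (1/2) ^ n \<le> N x"
    by (rule pseudonorm_of_neighbourhoods[of "\<lambda>n. pr -` U n"])
      (simp_all add: pr_add pr_minus U U3)
  have lim: "\<exists>n. (1/2) ^ n < e" if "e > 0" for e :: real
    using real_arch_pow_inv[OF that, of "1/2"] by auto
  show thesis
  proof (rule that[of N])
    show "N (frag_of a) > 0"
    proof -
      have "(1/2) ^ 0 \<le> N (frag_of a)" by (rule N(5)) (use U(4) a in simp)
      then show ?thesis by simp
    qed
    show "N x = 0" if "pr x = \<one>" for x
    proof -
      have "N x \<le> (1/2) ^ n" for n by (rule N(4)) (use U(2) that in simp)
      then have "N x \<le> 0" using lim by (metis not_le order_less_le_trans order_less_irrefl)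
      moreover have "0 \<le> N x" using N(1) N(3)[of x "- x"] N(2)[of x] by simp
      ultimately show ?thesis by simp
    qed
    show "\<exists>U. openin T U \<and> \<one> \<in> U \<and> (\<forall>x. pr x \<in> U \<longrightarrow> N x < e)" if e: "e > 0" for e
    proof -
      obtain n where n: "(1/2) ^ n < e" using lim[OF e] by blast
      have "N x < e" if "pr x \<in> U n" for x using N(4)[of x n] that n by simp
      then show ?thesis using U(1,2) by blast
    qed
  qed (rule N)+
qed

lemma continuous_map_translation:
  fixes f :: "'a \<Rightarrow> 'm::metric_space"
  assumes "\<And>x e. x \<in> carrier G \<Longrightarrow> e > 0 \<Longrightarrow>
    \<exists>U. openin T U \<and> \<one> \<in> U \<and> (\<forall>y\<in>carrier G. y \<otimes> inv x \<in> U \<longrightarrow> dist (f x) (f y) < e)"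
  shows "continuous_map T euclidean f"
  unfolding continuous_map_metric_iff
proof (intro ballI allI impI)
  fix x and e :: real assume x: "x \<in> topspace T" and e: "e > 0"
  then obtain U where U: "openin T U" "\<one> \<in> U" "\<And>y. y \<in> carrier G \<Longrightarrow> y \<otimes> inv x \<in> U \<Longrightarrow> dist (f x) (f y) < e"
    using assms[of x e] by auto
  have "openin T {y \<in> topspace T. y \<otimes> inv x \<in> U}"
    by (rule openin_continuous_map_preimage[OF translation_continuous U(1)]) (use x in simp)
  moreover have "x \<in> {y \<in> topspace T. y \<otimes> inv x \<in> U}" using x U(2) by simp
  ultimately show "\<exists>V. openin T V \<and> x \<in> V \<and> (\<forall>y\<in>V. dist (f x) (f y) < e)"
    using U(3) by (intro exI[of _ "{y \<in> topspace T. y \<otimes> inv x \<in> U}"]) auto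
qed

text \<open>Otherwise there is an \<open>e\<close>-separated sequence. Tents of radius
  \<open>e / 3\<close> around its points, the \<open>n\<close>-th of height \<open>n\<close>, form a
  locally finite family, and their sum is a continuous unbounded function.\<close>

lemma pseudonorm_totally_bounded:
  assumes pc: "pseudocompact_space T"
    and N: "N 0 = (0::real)" "\<And>x. N (- x) = N x" "\<And>x y. N (x + y) \<le> N x + N y"
    and small: "\<And>e. e > 0 \<Longrightarrow> \<exists>U. openin T U \<and> \<one> \<in> U \<and> (\<forall>x. pr x \<in> U \<longrightarrow> N x < e)"
    and ker: "\<And>x. pr x = \<one> \<Longrightarrow> N x = 0"
    and e: "e > 0"
  shows "\<exists>F. finite F \<and> (\<forall>x. \<exists>y\<in>F. N (x - y) < e)"
proof (rule ccontr)
  assume no: "\<not> (\<exists>F. finite F \<and> (\<forall>x. \<exists>y\<in>F. N (x - y) < e))"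
  have "\<exists>s. \<forall>n::nat. \<forall>m<n. e \<le> N (s n - s m)"
  proof (rule dependent_wellorder_choice)
    fix n :: nat and s :: "nat \<Rightarrow> ('a \<Rightarrow>\<^sub>0 int)"
    have "finite (s ` {..<n})" by simp
    then have "\<exists>x. \<forall>y\<in>s ` {..<n}. \<not> N (x - y) < e" using no by blast
    then show "\<exists>r. \<forall>m<n. e \<le> N (r - s m)" by (auto simp: not_less)
  qed simp
  then obtain s where s: "\<And>m n::nat. m < n \<Longrightarrow> e \<le> N (s n - s m)" by blast
  have comm: "N (x - y) = N (y - x)" for x y using N(2)[of "x - y"] by simp
  have tri: "N (x - z) \<le> N (x - y) + N (y - z)" for x y z using N(3)[of "x - y" "y - z"] by simp
  have sep: "m = n" if "N (s m - s n) < e" for m n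
    using s[of m n] s[of n m] comm[of "s m" "s n"] that by (cases m n rule: linorder_cases) auto
  \<comment> \<open>At most one index qualifies. If none does, \<open>k x\<close> is arbitrary, and
    \<open>f x\<close> vanishes because the second factor does.\<close>
  define k where "k x = (SOME n. N (x - s n) < e / 3)" for x
  define f where "f x = real (k x) * max 0 (1 - 3 / e * N (x - s (k x)))" for x
  have f0: "f x = 0" if "\<And>n. \<not> N (x - s n) < e / 3" for x
    using that[of "k x"] e by (simp add: f_def max_def field_simps)
  have f_loc: "f x = real n * max 0 (1 - 3 / e * N (x - s n))"
    if "\<And>m. N (x - s m) < e / 3 \<Longrightarrow> m = n" for x n
  proof (cases "\<exists>m. N (x - s m) < e / 3")
    case True
    then have "N (x - s (k x)) < e / 3" unfolding k_def by (rule someI_ex)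
    then have "k x = n" by (rule that)
    then show ?thesis by (simp add: f_def)
  next
    case False
    then have "f x = 0" by (intro f0) blast
    moreover have "\<not> N (x - s n) < e / 3" using False by blast
    then have "max 0 (1 - 3 / e * N (x - s n)) = 0" using e by (simp add: max_def field_simps)
    ultimately show ?thesis by simp
  qed
  have same: "N (x - y) = 0" if "pr x = pr y" for x y
    by (rule ker) (simp add: pr_diff that)
  \<comment> \<open>So \<open>f\<close> descends to \<open>G\<close>, where \<open>frag_of\<close>
    is a section of \<open>pr\<close>.\<close>
  have f_cong: "f x = f y" if "pr x = pr y" for x y
  proof -
    have "N (x - z) = N (y - z)" for z
      using tri[of x z y] tri[of y z x] same[OF that] same[OF that[symmetric]] by simp
    then show ?thesis unfolding f_def k_def by simp
  qed
  have "continuous_map T euclideanreal (\<lambda>g. f (frag_of g))"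
  proof (rule continuous_map_translation)
    fix g and d :: real assume g: "g \<in> carrier G" and d: "d > 0"
    define x where "x = frag_of g"
    \<comment> \<open>Within distance \<open>e / 6\<close> of \<open>x\<close> at most one tent is
      met: two of them would have centres closer than
      \<open>e / 3 + e / 6 + e / 6 + e / 3 = e\<close>.\<close>
    obtain n where n: "\<And>y m. N (y - x) < e / 6 \<Longrightarrow> N (y - s m) < e / 3 \<Longrightarrow> m = n"
    proof (cases "\<exists>y m. N (y - x) < e / 6 \<and> N (y - s m) < e / 3")
      case True
      then obtain y n where y: "N (y - x) < e / 6" "N (y - s n) < e / 3" by blast
      have "m = n" if "N (z - x) < e / 6" "N (z - s m) < e / 3" for z m
      proof (rule sep)
        have "N (s m - s n) \<le> N (s m - z) + (N (z - x) + (N (x - y) + N (y - s n)))"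
          using tri[of "s m" "s n" z] tri[of z "s n" x] tri[of x "s n" y] by linarith
        then show "N (s m - s n) < e" using y that comm[of "s m" z] comm[of x y] by linarith
      qed
      then show thesis using that by blast
    qed (use that in blast)
    \<comment> \<open>The slope of the \<open>n\<close>-th tent; the added 1 keeps the constant
      positive for \<open>n = 0\<close>.\<close>
    define L where "L = real n * (3 / e) + 1"
    have L: "L > 0" using e by (simp add: L_def add_nonneg_pos)
    have lip: "\<bar>f x - f y\<bar> \<le> L * N (y - x)" if "N (y - x) < e / 6" for y
    proof -
      have fy: "f y = real n * max 0 (1 - 3 / e * N (y - s n))" by (rule f_loc) (use n that in blast)
      have "N (x - x) < e / 6" using N(1) e by simp
      then have fx: "f x = real n * max 0 (1 - 3 / e * N (x - s n))" using n by (intro f_loc) blast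
      have "\<bar>max 0 (1 - 3 / e * N (x - s n)) - max 0 (1 - 3 / e * N (y - s n))\<bar> \<le> 3 / e * \<bar>N (x - s n) - N (y - s n)\<bar>"
      proof -
        have "\<bar>max 0 a - max 0 b\<bar> \<le> \<bar>a - b\<bar>" for a b :: real by linarith
        from this[of "1 - 3 / e * N (x - s n)" "1 - 3 / e * N (y - s n)"]
        have "\<bar>max 0 (1 - 3 / e * N (x - s n)) - max 0 (1 - 3 / e * N (y - s n))\<bar> \<le> \<bar>3 / e * (N (y - s n) - N (x - s n))\<bar>"
          by (simp add: right_diff_distrib)
        also have "\<dots> = 3 / e * \<bar>N (x - s n) - N (y - s n)\<bar>" unfolding abs_mult
          using e by (subst abs_minus_commute) simp
        finally show ?thesis .
      qed
      also have "\<dots> \<le> 3 / e * N (y - x)"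
        using tri[of x "s n" y] tri[of y "s n" x] comm[of x y] e by (intro mult_left_mono) auto
      finally have "real n * \<bar>max 0 (1 - 3 / e * N (x - s n)) - max 0 (1 - 3 / e * N (y - s n))\<bar> \<le> real n * (3 / e * N (y - x))"
        by (rule mult_left_mono) simp
      moreover have "0 \<le> N (y - x)" using tri[of y y x] comm[of y x] N(1) by simp
      moreover have "\<bar>f x - f y\<bar> = real n * \<bar>max 0 (1 - 3 / e * N (x - s n)) - max 0 (1 - 3 / e * N (y - s n))\<bar>"
        unfolding fx fy right_diff_distrib[symmetric] abs_mult by simp
      ultimately show ?thesis by (simp add: L_def algebra_simps)
    qed
    define c where "c = min (e / 6) (d / L)"
    have "c > 0" using e d L by (simp add: c_def)
    then obtain U where U: "openin T U" "\<one> \<in> U" "\<And>x. pr x \<in> U \<Longrightarrow> N x < c" using small by blast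
    have "dist (f x) (f (frag_of h)) < d" if h: "h \<in> carrier G" "h \<otimes> inv g \<in> U" for h
    proof -
      have "N (frag_of h - x) < c" by (rule U(3)) (use h g in \<open>simp add: x_def pr_diff\<close>)
      then have 1: "N (frag_of h - x) < e / 6" "N (frag_of h - x) < d / L" by (simp_all add: c_def)
      have "L * N (frag_of h - x) < d" using 1(2) L by (simp add: field_simps)
      then show ?thesis using lip[OF 1(1)] by (simp add: dist_real_def)
    qed
    then show "\<exists>U. openin T U \<and> \<one> \<in> U \<and> (\<forall>y\<in>carrier G. y \<otimes> inv g \<in> U \<longrightarrow> dist (f (frag_of g)) (f (frag_of y)) < d)"
      using U(1,2) unfolding x_def by blast
  qed
  then have "bounded ((\<lambda>g. f (frag_of g)) ` topspace T)" using pc unfolding pseudocompact_space_def by blast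
  then obtain B where B: "\<And>g. g \<in> carrier G \<Longrightarrow> \<bar>f (frag_of g)\<bar> \<le> B" unfolding bounded_iff by auto
  have "real n \<le> B" for n
  proof -
    have "f (frag_of (pr (s n))) = f (s n)" by (rule f_cong) simp
    also have "\<dots> = real n * max 0 (1 - 3 / e * N (s n - s n))"
    proof (rule f_loc)
      fix m assume "N (s n - s m) < e / 3"
      then have "n = m" using e by (intro sep) simp
      then show "m = n" by simp
    qed
    finally have "f (frag_of (pr (s n))) = real n" using N(1) by simp
    then show ?thesis using B[of "pr (s n)"] by simp
  qed
  then show False using reals_Archimedean2[of B] by (meson not_le)
qed

text \<open>The value 1 outside the carrier makes a character determined by its restriction to
  \<open>G\<close>, and keeps all values on the circle.\<close>

definition chars :: "('a \<Rightarrow> complex) set" where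
  "chars = {c. (\<forall>x\<in>carrier G. \<forall>y\<in>carrier G. c (x \<otimes> y) = c x * c y) \<and> (\<forall>x. norm (c x) = 1)
     \<and> (\<forall>x. x \<notin> carrier G \<longrightarrow> c x = 1) \<and> continuous_map T euclidean c}"

lemma unimodular_group_chars: "unimodular_group chars"
proof
  show "(\<lambda>_. 1) \<in> chars" by (simp add: chars_def)
  show "(\<lambda>a. f a * g a) \<in> chars" if "f \<in> chars" "g \<in> chars" for f g
    using that by (auto simp: chars_def norm_mult continuous_map_complex_mult)
  show "(\<lambda>a. cnj (f a)) \<in> chars" if "f \<in> chars" for f
    using that by (auto simp: chars_def continuous_map_complex_cnj)
  show "norm (f a) = 1" if "f \<in> chars" for f a using that by (simp add: chars_def)
qed

lemma is_char_pr:
  assumes "c \<in> chars"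
  shows "is_char (\<lambda>x. c (pr x))"
  using assms by (simp add: chars_def is_char_def pr_add)

theorem chars_separate:
  assumes pc: "pseudocompact_space T" and a: "a \<in> carrier G" "a \<noteq> \<one>"
  shows "\<exists>c\<in>chars. c a \<noteq> 1"
proof -
  obtain N where N: "N 0 = (0::real)" "\<And>x. N (- x) = N x" "\<And>x y. N (x + y) \<le> N x + N y"
    "N (frag_of a) > 0" "\<And>x. pr x = \<one> \<Longrightarrow> N x = 0"
    "\<And>e. e > 0 \<Longrightarrow> \<exists>U. openin T U \<and> \<one> \<in> U \<and> (\<forall>x. pr x \<in> U \<longrightarrow> N x < e)"
    using continuous_pseudonorm[OF a] by blast
  interpret bounded_pseudonorm N
  proof
    show "N 0 = 0" "N (- x) = N x" "N (x + y) \<le> N x + N y" for x y by (rule N)+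
    show "\<exists>F. finite F \<and> (\<forall>x. \<exists>y\<in>F. N (x - y) < e)" if "e > 0" for e
      by (rule pseudonorm_totally_bounded[OF pc N(1,2,3,6,5) that])
  qed
  obtain \<xi> :: "('a \<Rightarrow>\<^sub>0 int) \<Rightarrow> complex" where \<xi>: "uc \<xi>" "\<And>x y. \<xi> (x + y) = \<xi> x * \<xi> y" "\<And>x. norm (\<xi> x) = 1" "\<xi> (frag_of a) \<noteq> 1"
    using that by (rule separating_character[OF N(4)])
  have \<xi>_cong: "\<xi> x = \<xi> y" if "pr x = pr y" for x y
  proof -
    have "N (x - y) = 0" by (rule N(5)) (simp add: pr_diff that)
    have "norm (\<xi> x - \<xi> y) \<le> 0 + e" if "e > 0" for e
    proof -
      obtain d where "d > 0" "\<And>x y. N (x - y) < d \<Longrightarrow> norm (\<xi> x - \<xi> y) < e" using that by (rule ucD[OF \<xi>(1) \<open>e > 0\<close>])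
      then show ?thesis using \<open>N (x - y) = 0\<close> by (simp add: less_imp_le)
    qed
    then have "norm (\<xi> x - \<xi> y) \<le> 0" by (rule field_le_epsilon)
    then show ?thesis by simp
  qed
  define c where "c g = (if g \<in> carrier G then \<xi> (frag_of g) else 1)" for g
  have "continuous_map T euclidean c"
  proof (rule continuous_map_translation)
    fix g and e :: real assume g: "g \<in> carrier G" and e: "e > 0"
    obtain d where d: "d > 0" "\<And>x y. N (x - y) < d \<Longrightarrow> norm (\<xi> x - \<xi> y) < e" using that by (rule ucD[OF \<xi>(1) e])
    obtain U where U: "openin T U" "\<one> \<in> U" "\<And>x. pr x \<in> U \<Longrightarrow> N x < d" using N(6)[OF d(1)] by blast
    have "dist (c g) (c h) < e" if h: "h \<in> carrier G" "h \<otimes> inv g \<in> U" for h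
    proof -
      have "N (frag_of h - frag_of g) < d" by (rule U(3)) (use h g in \<open>simp add: pr_diff\<close>)
      then have "norm (\<xi> (frag_of h) - \<xi> (frag_of g)) < e" by (rule d(2))
      then show ?thesis using h g by (simp add: c_def dist_norm norm_minus_commute)
    qed
    then show "\<exists>U. openin T U \<and> \<one> \<in> U \<and> (\<forall>y\<in>carrier G. y \<otimes> inv g \<in> U \<longrightarrow> dist (c g) (c y) < e)"
      using U(1,2) by blast
  qed
  moreover have "c (x \<otimes> y) = c x * c y" if "x \<in> carrier G" "y \<in> carrier G" for x y
  proof -
    have "\<xi> (frag_of (x \<otimes> y)) = \<xi> (frag_of x + frag_of y)"
      by (rule \<xi>_cong) (use that in \<open>simp add: pr_add\<close>)
    then show ?thesis using that by (simp add: c_def \<xi>(2))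
  qed
  ultimately have "c \<in> chars" using \<xi>(3) by (auto simp: chars_def c_def)
  moreover have "c a \<noteq> 1" using \<xi>(4) a by (simp add: c_def)
  ultimately show ?thesis by blast
qed

end

section \<open>Weak topologies\<close>

lemma pseudocompact_continuous_image:
  assumes pc: "pseudocompact_space T" and f: "continuous_map T S f"
  shows "pseudocompact_space (subtopology S (f ` topspace T))"
  unfolding pseudocompact_space_def
proof (intro allI impI)
  fix g :: "_ \<Rightarrow> real"
  assume g: "continuous_map (subtopology S (f ` topspace T)) euclideanreal g"
  have "continuous_map T (subtopology S (f ` topspace T)) f"
    using f by (simp add: continuous_map_in_subtopology)
  then have "continuous_map T euclideanreal (g \<circ> f)" using g by (rule continuous_map_compose)
  then have "bounded ((g \<circ> f) ` topspace T)" using pc unfolding pseudocompact_space_def by blast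
  moreover have "topspace (subtopology S (f ` topspace T)) = f ` topspace T"
    using continuous_map_image_subset_topspace[OF f] by auto
  ultimately show "bounded (g ` topspace (subtopology S (f ` topspace T)))" by (simp add: image_comp)
qed

context abelian_topological_group
begin

definition emb :: "('a \<Rightarrow> complex) set \<Rightarrow> 'a \<Rightarrow> ('a \<Rightarrow> complex) \<Rightarrow> complex" where
  "emb Y g = restrict (\<lambda>c. c g) Y"

abbreviation power_space :: "('a \<Rightarrow> complex) set \<Rightarrow> (('a \<Rightarrow> complex) \<Rightarrow> complex) topology" where
  "power_space Y \<equiv> product_topology (\<lambda>_. euclidean) Y"

text \<open>The initial topology of the functions in \<open>Y\<close>.\<close>

definition weak :: "('a \<Rightarrow> complex) set \<Rightarrow> 'a topology" where
  "weak Y = pullback_topology (carrier G) (emb Y) (power_space Y)"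

lemma topspace_weak [simp]: "topspace (weak Y) = carrier G"
  by (auto simp: weak_def topspace_pullback_topology emb_def)

lemma continuous_map_emb:
  assumes "\<And>c. c \<in> Y \<Longrightarrow> continuous_map Z euclidean (\<lambda>z. c (f z))"
  shows "continuous_map Z (power_space Y) (\<lambda>z. emb Y (f z))"
  using assms by (auto simp: continuous_map_componentwise emb_def)

lemma continuous_map_into_weak:
  assumes "f \<in> topspace Z \<rightarrow> carrier G" "\<And>c. c \<in> Y \<Longrightarrow> continuous_map Z euclidean (\<lambda>z. c (f z))"
  shows "continuous_map Z (weak Y) f"
  unfolding weak_def
proof (rule continuous_map_pullback')
  show "continuous_map Z (power_space Y) (emb Y \<circ> f)"
    unfolding o_def by (rule continuous_map_emb[OF assms(2)])
  show "topspace Z \<subseteq> f -` carrier G" using assms(1) by auto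
qed

lemma weak_continuous:
  assumes "c \<in> Y"
  shows "continuous_map (weak Y) euclidean c"
proof -
  have "continuous_map (weak Y) euclidean ((\<lambda>x. x c) \<circ> emb Y)"
    unfolding weak_def by (rule continuous_map_pullback[OF continuous_map_product_projection[OF assms]])
  moreover have "(\<lambda>x. x c) \<circ> emb Y = c" using assms by (simp add: emb_def fun_eq_iff)
  ultimately show ?thesis by simp
qed

lemma charsD:
  assumes "c \<in> chars"
  shows "x \<in> carrier G \<Longrightarrow> y \<in> carrier G \<Longrightarrow> c (x \<otimes> y) = c x * c y"
    "norm (c x) = 1" "x \<notin> carrier G \<Longrightarrow> c x = 1" "continuous_map T euclidean c"
    "x \<in> carrier G \<Longrightarrow> c (inv x) = cnj (c x)" "c \<one> = 1"
proof -
  show 1: "x \<in> carrier G \<Longrightarrow> y \<in> carrier G \<Longrightarrow> c (x \<otimes> y) = c x * c y" for x y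
    using assms unfolding chars_def by blast
  show "norm (c x) = 1" "x \<notin> carrier G \<Longrightarrow> c x = 1" "continuous_map T euclidean c"
    using assms unfolding chars_def by blast+
  show "c \<one> = 1" using is_char_props(3)[OF is_char_pr[OF assms]] by simp
  show "c (inv x) = cnj (c x)" if "x \<in> carrier G"
    using is_char_props(5)[OF is_char_pr[OF assms], of "frag_of x"] that by (simp add: pr_minus)
qed

lemma group_topology_weak:
  assumes Y: "Y \<subseteq> chars" and sep: "\<And>g. g \<in> carrier G \<Longrightarrow> g \<noteq> \<one> \<Longrightarrow> \<exists>c\<in>Y. c g \<noteq> 1"
  shows "group_topology G (weak Y)"
  unfolding group_topology_def
proof (intro conjI)
  show "topspace (weak Y) = carrier G" by simp
  show "continuous_map (prod_topology (weak Y) (weak Y)) (weak Y) (\<lambda>(x, y). x \<otimes> y)"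
  proof (rule continuous_map_into_weak)
    show "(\<lambda>(x, y). x \<otimes> y) \<in> topspace (prod_topology (weak Y) (weak Y)) \<rightarrow> carrier G" by auto
    fix c assume c: "c \<in> Y"
    have "continuous_map (prod_topology (weak Y) (weak Y)) euclidean (\<lambda>z. c (fst z) * c (snd z))"
      using continuous_map_compose[OF continuous_map_fst weak_continuous[OF c]]
        continuous_map_compose[OF continuous_map_snd weak_continuous[OF c]]
      unfolding o_def by (rule continuous_map_complex_mult)
    then show "continuous_map (prod_topology (weak Y) (weak Y)) euclidean (\<lambda>z. c (case z of (x, y) \<Rightarrow> x \<otimes> y))"
      by (rule continuous_map_eq) (use charsD(1) c Y in auto)
  qed
  show "continuous_map (weak Y) (weak Y) (\<lambda>x. inv x)"
  proof (rule continuous_map_into_weak)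
    fix c assume c: "c \<in> Y"
    have "continuous_map (weak Y) euclidean (\<lambda>z. cnj (c z))"
      by (rule continuous_map_complex_cnj[OF weak_continuous[OF c]])
    then show "continuous_map (weak Y) euclidean (\<lambda>z. c (inv z))"
      by (rule continuous_map_eq) (use charsD(5) c Y in auto)
  qed auto
  show "Hausdorff_space (weak Y)"
  proof (rule Hausdorff_space_injective_preimage)
    show "Hausdorff_space (power_space Y)" by (simp add: Hausdorff_space_product_topology)
    show "continuous_map (weak Y) (power_space Y) (emb Y)"
      by (rule continuous_map_emb[of _ _ "\<lambda>x. x"]) (rule weak_continuous)
    show "inj_on (emb Y) (topspace (weak Y))"
    proof (rule inj_onI, rule ccontr)
      fix g h assume gh: "g \<in> topspace (weak Y)" "h \<in> topspace (weak Y)" "emb Y g = emb Y h" "g \<noteq> h"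
      then have "g \<otimes> inv h \<in> carrier G" "g \<otimes> inv h \<noteq> \<one>" using inv_equality[of g "inv h"] by auto
      then obtain c where c: "c \<in> Y" "c (g \<otimes> inv h) \<noteq> 1" using sep by blast
      have "c g = c h" using fun_cong[OF gh(3), of c] c(1) by (simp add: emb_def)
      then have "c (g \<otimes> inv h) = c h * cnj (c h)" using charsD(1,5)[of c] c(1) Y gh(1,2) by auto
      also have "\<dots> = 1" using charsD(2)[of c h] c(1) Y by (auto simp: complex_norm_square[symmetric])
      finally show False using c(2) by simp
    qed
  qed
qed

lemma weak_coarser:
  assumes "Y \<subseteq> chars"
  shows "{U. openin (weak Y) U} \<subseteq> {U. openin T U}"
proof clarify
  fix U assume U: "openin (weak Y) U"
  have "continuous_map T (weak Y) (\<lambda>x. x)"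
    by (rule continuous_map_into_weak) (use assms charsD(4) in auto)
  then have "openin T {x \<in> topspace T. x \<in> U}" using U by (rule openin_continuous_map_preimage)
  moreover have "{x \<in> topspace T. x \<in> U} = U" using openin_subset[OF U] by auto
  ultimately show "openin T U" by simp
qed

text \<open>Continuity of \<open>c\<close> at the identity involves only a finite subset
  \<open>F\<close> of \<open>Y\<close>: where its members are \<open>e\<close>-close to 1,
  \<open>c\<close> is 1/2-close to 1. Lifted along \<open>pr\<close>, this is the situation of
  \<open>char_mem_generated\<close>.\<close>

lemma weak_continuous_imp_mem:
  assumes Y: "Y \<subseteq> chars" "(\<lambda>_. 1) \<in> Y" "\<And>f g. f \<in> Y \<Longrightarrow> g \<in> Y \<Longrightarrow> (\<lambda>a. f a * g a) \<in> Y"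
      "\<And>f. f \<in> Y \<Longrightarrow> (\<lambda>a. cnj (f a)) \<in> Y"
    and c: "c \<in> chars" "continuous_map (weak Y) euclidean c"
  shows "c \<in> Y"
proof -
  have "openin (weak Y) {g \<in> topspace (weak Y). c g \<in> ball 1 (1/2)}"
    by (rule openin_continuous_map_preimage[OF c(2)]) simp
  then obtain W where W: "openin (power_space Y) W" "{g \<in> carrier G. c g \<in> ball 1 (1/2)} = emb Y -` W \<inter> carrier G"
    unfolding weak_def openin_pullback_topology topspace_weak[unfolded weak_def] by blast
  have "\<one> \<in> {g \<in> carrier G. c g \<in> ball 1 (1/2)}" using charsD(6)[OF c(1)] by simp
  then have "emb Y \<one> \<in> W" unfolding W(2) by blast
  from product_topology_open_contains_basis[OF W(1) this] obtain V where
    V: "emb Y \<one> \<in> (\<Pi>\<^sub>E i\<in>Y. V i)" "\<And>i. open (V i)" "finite {i. V i \<noteq> UNIV}" "(\<Pi>\<^sub>E i\<in>Y. V i) \<subseteq> W"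
    by auto
  define F where "F = {i \<in> Y. V i \<noteq> UNIV}"
  have F: "finite F" unfolding F_def by (rule finite_subset[OF _ V(3)]) blast
  have "\<exists>r>0. ball 1 r \<subseteq> V i" if "i \<in> F" for i
  proof -
    have i: "i \<in> Y" using that unfolding F_def by blast
    then have "emb Y \<one> i \<in> V i" using V(1) by blast
    moreover have "i \<one> = 1" using charsD(6) i Y(1) by blast
    ultimately have "1 \<in> V i" using i by (simp add: emb_def)
    then show ?thesis using V(2) open_contains_ball by blast
  qed
  then obtain r where r: "\<And>i. i \<in> F \<Longrightarrow> r i > 0" "\<And>i. i \<in> F \<Longrightarrow> ball 1 (r i) \<subseteq> V i" by metis
  \<comment> \<open>The inserted 1 covers the case of empty \<open>F\<close>.\<close>
  define e where "e = Min (insert 1 (r ` F))"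
  have e: "e > 0" unfolding e_def using F r(1) by (subst Min_gr_iff) auto
  have e_le: "e \<le> r i" if "i \<in> F" for i unfolding e_def using F that by (intro Min_le) auto
  have near: "norm (c g - 1) \<le> 1/2" if g: "g \<in> carrier G" "\<And>i. i \<in> F \<Longrightarrow> norm (i g - 1) < e" for g
  proof -
    have "emb Y g i \<in> V i" if i: "i \<in> Y" for i
    proof (cases "i \<in> F")
      case True
      then have "i g \<in> ball 1 (r i)" using g(2)[OF True] e_le[OF True] by (simp add: dist_norm norm_minus_commute)
      then show ?thesis using r(2)[OF True] i by (auto simp: emb_def)
    next
      case False
      then show ?thesis using i unfolding F_def by auto
    qed
    then have "emb Y g \<in> (\<Pi>\<^sub>E i\<in>Y. V i)" by (auto simp: emb_def)
    then have "g \<in> emb Y -` W \<inter> carrier G" using V(4) g(1) by blast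
    then have "c g \<in> ball 1 (1/2)" unfolding W(2)[symmetric] by blast
    then show ?thesis by (simp add: dist_norm norm_minus_commute)
  qed
  define lift where "lift f = (\<lambda>x. f (pr x))" for f :: "'a \<Rightarrow> complex"
  have "lift c \<in> lift ` Y"
  proof (rule char_mem_generated[where Y = "lift ` F" and Z = "lift ` Y" and e = e])
    show "finite (lift ` F)" using F by simp
    show "lift ` F \<subseteq> lift ` Y" unfolding F_def by blast
    show "is_char f" if "f \<in> lift ` Y" for f using that Y(1) is_char_pr unfolding lift_def by blast
    have "lift (\<lambda>_. 1) \<in> lift ` Y" using Y(2) by (rule imageI)
    then show "(\<lambda>_. 1) \<in> lift ` Y" unfolding lift_def .
    show "(\<lambda>x. f x * g x) \<in> lift ` Y" if fg: "f \<in> lift ` Y" "g \<in> lift ` Y" for f g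
    proof -
      obtain f' g' where f': "f' \<in> Y" "f = lift f'" and g': "g' \<in> Y" "g = lift g'" using fg by blast
      have "lift (\<lambda>a. f' a * g' a) \<in> lift ` Y" by (rule imageI[OF Y(3)[OF f'(1) g'(1)]])
      then show ?thesis unfolding f'(2) g'(2) lift_def .
    qed
    show "(\<lambda>x. cnj (f x)) \<in> lift ` Y" if f: "f \<in> lift ` Y" for f
    proof -
      obtain f' where f': "f' \<in> Y" "f = lift f'" using f by blast
      have "lift (\<lambda>a. cnj (f' a)) \<in> lift ` Y" by (rule imageI[OF Y(4)[OF f'(1)]])
      then show ?thesis unfolding f'(2) lift_def .
    qed
    show "is_char (lift c)" unfolding lift_def by (rule is_char_pr[OF c(1)])
    show "0 < e" by (rule e)
    fix x assume x: "\<And>f. f \<in> lift ` F \<Longrightarrow> norm (f x - 1) < e"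
    have "norm (i (pr x) - 1) < e" if "i \<in> F" for i using x[OF imageI[OF that]] unfolding lift_def .
    then show "norm (lift c x - 1) \<le> 1/2" unfolding lift_def by (intro near) simp_all
  qed
  then obtain f where f: "f \<in> Y" "lift c = lift f" by blast
  have "c = f"
  proof
    fix g
    show "c g = f g"
    proof (cases "g \<in> carrier G")
      case True
      then show ?thesis using fun_cong[OF f(2), of "frag_of g"] by (simp add: lift_def)
    next
      case False
      have "f \<in> chars" using f(1) Y(1) by blast
      then show ?thesis using charsD(3)[OF c(1) False] charsD(3)[of f, OF _ False] by simp
    qed
  qed
  then show ?thesis using f(1) by simp
qed

text \<open>In a finite image the powers of every \<open>g\<close> repeat, so at each point of the
  image all of \<open>Y\<close> takes values in the roots of unity of one fixed exponent. Members of
  \<open>Y\<close> are determined by these finitely many values.\<close>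

lemma finite_emb_imp_finite:
  assumes Y: "Y \<subseteq> chars" and fin: "finite (emb Y ` carrier G)"
  shows "finite Y"
proof -
  define K where "K = emb Y ` carrier G"
  have "\<exists>m>0. \<forall>c\<in>Y. k c ^ m = 1" if k: "k \<in> K" for k
  proof -
    obtain g where g: "g \<in> carrier G" "k = emb Y g" using k unfolding K_def by blast
    have pow: "c (g [^] (n::nat)) = c g ^ n" if "c \<in> Y" for c n
    proof -
      have c: "c \<in> chars" using that Y by blast
      show ?thesis by (induction n) (simp_all add: charsD(1)[OF c] charsD(6)[OF c] g(1) mult.commute)
    qed
    have "\<not> inj_on (\<lambda>n::nat. emb Y (g [^] n)) UNIV"
    proof
      assume "inj_on (\<lambda>n::nat. emb Y (g [^] n)) UNIV"
      moreover have "finite (range (\<lambda>n::nat. emb Y (g [^] n)))"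
        by (rule finite_subset[OF _ fin]) (use g(1) in auto)
      ultimately show False using finite_imageD infinite_UNIV_nat by blast
    qed
    then obtain i j :: nat where ij: "i < j" "emb Y (g [^] i) = emb Y (g [^] j)"
      unfolding inj_on_def by (metis linorder_neqE_nat)
    have "k c ^ (j - i) = 1" if c: "c \<in> Y" for c
    proof -
      have "c g ^ i = c g ^ j" using fun_cong[OF ij(2), of c] c pow[OF c] by (simp add: emb_def)
      also have "\<dots> = c g ^ i * c g ^ (j - i)" using ij(1) by (simp flip: power_add)
      finally have "c g ^ i * c g ^ (j - i) = c g ^ i * 1" by simp
      moreover have "c g \<noteq> 0" using charsD(2)[of c g] c Y by auto
      ultimately show ?thesis using c by (simp add: g(2) emb_def)
    qed
    then show ?thesis using ij(1) by (intro exI[of _ "j - i"]) auto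
  qed
  then obtain m where m: "\<And>k. k \<in> K \<Longrightarrow> m k > 0" "\<And>k c. k \<in> K \<Longrightarrow> c \<in> Y \<Longrightarrow> k c ^ m k = 1" by metis
  define R where "R c = restrict (\<lambda>k. k c) K" for c
  have "R ` Y \<subseteq> (\<Pi>\<^sub>E k\<in>K. {z::complex. z ^ m k = 1})" using m(2) unfolding R_def by auto
  moreover have "finite (\<Pi>\<^sub>E k\<in>K. {z::complex. z ^ m k = 1})"
  proof (rule finite_PiE)
    show "finite K" using fin by (simp add: K_def)
    show "finite {z::complex. z ^ m k = 1}" if "k \<in> K" for k
      by (rule finite_roots_unity) (use m(1)[OF that] in linarith)
  qed
  ultimately have "finite (R ` Y)" by (rule finite_subset)
  moreover have "inj_on R Y"
  proof (rule inj_onI)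
    fix c d assume cd: "c \<in> Y" "d \<in> Y" "R c = R d"
    show "c = d"
    proof
      fix g
      show "c g = d g"
      proof (cases "g \<in> carrier G")
        case True
        then have "emb Y g \<in> K" unfolding K_def by blast
        then show ?thesis using fun_cong[OF cd(3), of "emb Y g"] cd(1,2) by (simp add: R_def emb_def)
      next
        case False
        then show ?thesis using charsD(3) cd(1,2) Y by (metis subsetD)
      qed
    qed
  qed
  ultimately show ?thesis by (rule finite_imageD)
qed

text \<open>The image \<open>K\<close> of \<open>G\<close> under countably many characters is
  metrizable, hence compact by pseudocompactness. It is infinite and homogeneous, so it has no
  isolated point, and a nonempty perfect compact Hausdorff space has at least continuum many
  points.\<close>

lemma continuum_le_carrier:
  assumes pc: "pseudocompact_space T" and inf: "infinite chars"
  shows "|UNIV :: real set| \<le>o |carrier G|"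
proof -
  obtain Y where Y: "Y \<subseteq> chars" "infinite Y" "countable Y"
    using infinite_countable_subset'[OF inf] by blast
  define K where "K = emb Y ` carrier G"
  define S where "S = subtopology (power_space Y) K"
  have emb: "continuous_map T (power_space Y) (emb Y)"
    by (rule continuous_map_emb[of _ _ "\<lambda>x. x"]) (use charsD(4) Y(1) in auto)
  have "countable {i \<in> Y. \<not> (\<exists>a. topspace (euclidean :: complex topology) \<subseteq> {a})}"
    by (rule countable_subset[OF _ Y(3)]) blast
  then have "metrizable_space (power_space Y)"
    unfolding metrizable_space_product_topology using metrizable_space_euclidean by blast
  then have met: "metrizable_space S" unfolding S_def by (rule metrizable_space_subtopology)
  have "pseudocompact_space S"
    using pseudocompact_continuous_image[OF pc emb] by (simp add: S_def K_def)
  with met have comp: "compact_space S" by (rule pseudocompact_metrizable_imp_compact)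
  have Haus: "Hausdorff_space S" by (rule metrizable_imp_Hausdorff_space[OF met])
  have topS: "topspace S = K" unfolding S_def K_def by (auto simp: emb_def)
  have infK: "infinite K" unfolding K_def using finite_emb_imp_finite[OF Y(1)] Y(2) by blast
  have "x \<in> S derived_set_of K" if x: "x \<in> K" for x
  proof (rule ccontr)
    assume "x \<notin> S derived_set_of K"
    then obtain W where W: "openin S W" "x \<in> W" "\<And>y. y \<in> K \<Longrightarrow> y \<in> W \<Longrightarrow> y = x"
      using x unfolding in_derived_set_of topS by blast
    obtain g where g: "g \<in> carrier G" "x = emb Y g" using x unfolding K_def by blast
    have "openin S {y}" if y: "y \<in> K" for y
    proof -
      obtain h where h: "h \<in> carrier G" "y = emb Y h" using y unfolding K_def by blast
      \<comment> \<open>Multiplication by \<open>a\<close> carries \<open>y\<close> to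
        \<open>x\<close>; \<open>t\<close> is this translation in coordinates, and the preimage of
        \<open>W\<close> under it isolates \<open>y\<close>.\<close>
      define a where "a = inv h \<otimes> g"
      have a: "a \<in> carrier G" "h \<otimes> a = g" using g h by (simp_all add: a_def flip: m_assoc)
      define t where "t z = restrict (\<lambda>c. z c * c a) Y" for z :: "('a \<Rightarrow> complex) \<Rightarrow> complex"
      have t_emb: "t (emb Y u) = emb Y (u \<otimes> a)" if "u \<in> carrier G" for u
        using charsD(1) Y(1) that a(1) by (auto simp: t_def emb_def fun_eq_iff)
      have "continuous_map S (power_space Y) t"
        unfolding continuous_map_componentwise
      proof (intro conjI ballI)
        show "t ` topspace S \<subseteq> extensional Y" by (auto simp: t_def)
        fix c assume c: "c \<in> Y"
        have "continuous_map S euclidean (\<lambda>z. z c)"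
          unfolding S_def by (rule continuous_map_from_subtopology[OF continuous_map_product_projection[OF c]])
        then have "continuous_map S euclidean (\<lambda>z. z c * c a)"
          by (rule continuous_map_complex_mult) simp
        then show "continuous_map S euclidean (\<lambda>z. t z c)" using c by (simp add: t_def)
      qed
      moreover have tK: "t z \<in> K" if "z \<in> K" for z using that t_emb a(1) unfolding K_def by auto
      ultimately have "continuous_map S S t"
        unfolding S_def continuous_map_in_subtopology using topS unfolding S_def by auto
      then have "openin S {z \<in> topspace S. t z \<in> W}" using W(1) by (rule openin_continuous_map_preimage)
      moreover have "{z \<in> topspace S. t z \<in> W} = {y}"
      proof (intro equalityI subsetI)
        fix z assume z: "z \<in> {z \<in> topspace S. t z \<in> W}"
        then obtain u where u: "u \<in> carrier G" "z = emb Y u" unfolding topS K_def by blast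
        have "t z = x" using z W(3) tK topS by blast
        then have eq: "emb Y (u \<otimes> a) = emb Y (h \<otimes> a)" using u(1) t_emb by (simp add: u(2) g(2) a(2))
        have "c u = c h" if c: "c \<in> Y" for c
        proof -
          have "c u * c a = c h * c a"
            using fun_cong[OF eq, of c] c charsD(1)[of c] Y(1) u(1) h(1) a(1) by (auto simp: emb_def)
          moreover have "c a \<noteq> 0" using charsD(2)[of c a] c Y(1) by auto
          ultimately show ?thesis by simp
        qed
        then show "z \<in> {y}" by (auto simp: u(2) h(2) emb_def fun_eq_iff)
      next
        fix z assume "z \<in> {y}"
        then show "z \<in> {z \<in> topspace S. t z \<in> W}" using y W(2) t_emb[OF h(1)] topS by (simp add: h(2) a(2) g(2))
      qed
      ultimately show ?thesis by simp
    qed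
    then have "S = discrete_topology K" using discrete_topology_unique[of K S] topS by auto
    then show False using comp infK compact_space_discrete_topology by metis
  qed
  then have "S derived_set_of K = K" using derived_set_of_subset_topspace[of S K] topS by blast
  moreover have "locally_compact_space S" using comp by (rule compact_imp_locally_compact_space)
  moreover have "K \<noteq> {}" using infK by auto
  ultimately have "(UNIV :: real set) \<lesssim> K" using lepoll_perfect_set[of S K] Haus by blast
  then have "|UNIV :: real set| \<le>o |K|" unfolding lepoll_def card_of_ordLeq .
  moreover have "|K| \<le>o |carrier G|" unfolding K_def by (rule card_of_image)
  ultimately show ?thesis by (rule ordLeq_transitive)
qed

end

section \<open>From minimal pseudocompact to compact metrizable topologies, and back\<close>

lemma minimal_pseudocompact_imp:
  fixes G :: "('a, 'b) monoid_scheme"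
  assumes G: "comm_group G" and small: "|carrier G| <o two_to_omega1"
    and min: "minimal_group_topology G T" and pc: "pseudocompact_space T"
  shows "group_topology G T \<and> compact_space T \<and> metrizable_space T"
proof -
  have gt: "group_topology G T" using min unfolding minimal_group_topology_def by blast
  interpret abelian_topological_group G T
    by (intro abelian_topological_group.intro abelian_topological_group_axioms.intro G gt)
  interpret unimodular_group chars by (rule unimodular_group_chars)
  have sep: "\<exists>c\<in>chars. c g \<noteq> 1" if "g \<in> carrier G" "g \<noteq> \<one>\<^bsub>G\<^esub>" for g
    by (rule chars_separate[OF pc that])
  have weak_eq: "weak Y = T" if "Y \<subseteq> chars" "\<And>g. g \<in> carrier G \<Longrightarrow> g \<noteq> \<one>\<^bsub>G\<^esub> \<Longrightarrow> \<exists>c\<in>Y. c g \<noteq> 1" for Y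
    using min group_topology_weak[OF that] weak_coarser[OF that(1)] unfolding minimal_group_topology_def by blast
  have ctb: "countable chars"
  proof (rule ccontr)
    assume unc: "uncountable chars"
    have "\<exists>S. S \<subseteq> chars \<and> uncountable S \<and> |Pow S| \<le>o |carrier G|"
    proof (rule uncountable_imp_Pow_le[OF unc])
      show "|UNIV :: real set| \<le>o |carrier G|"
        by (rule continuum_le_carrier[OF pc]) (use unc countable_finite in blast)
      fix Y assume Y: "Y \<subset> chars" "(\<lambda>_. 1) \<in> Y" "\<And>x y. x \<in> Y \<Longrightarrow> y \<in> Y \<Longrightarrow> (\<lambda>a. x a * y a) \<in> Y"
        "\<And>x. x \<in> Y \<Longrightarrow> (\<lambda>a. cnj (x a)) \<in> Y"
      have "\<exists>g\<in>carrier G. g \<noteq> \<one>\<^bsub>G\<^esub> \<and> (\<forall>y\<in>Y. y g = 1)"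
      proof (rule ccontr)
        assume "\<not> (\<exists>g\<in>carrier G. g \<noteq> \<one>\<^bsub>G\<^esub> \<and> (\<forall>y\<in>Y. y g = 1))"
        then have eq: "weak Y = T" using Y(1) by (intro weak_eq) auto
        obtain c where c: "c \<in> chars" "c \<notin> Y" using Y(1) by blast
        have cont: "continuous_map (weak Y) euclidean c" unfolding eq by (rule charsD(4)[OF c(1)])
        have "c \<in> Y" by (rule weak_continuous_imp_mem[OF psubset_imp_subset[OF Y(1)] Y(2,3,4) c(1) cont])
        then show False using c(2) by simp
      qed
      then show "\<exists>g\<in>carrier G. (\<forall>y\<in>Y. y g = 1) \<and> (\<exists>x\<in>chars. x g \<noteq> 1)" using sep by blast
    qed
    then obtain S :: "('a \<Rightarrow> complex) set" where S: "uncountable S" "|Pow S| \<le>o |carrier G|"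
      by (elim exE conjE) (rule that)
    \<comment> \<open>An uncountable cardinal is at least the successor of \<open>natLeq\<close>, so
      the subsets of \<open>S\<close> alone number at least \<open>two_to_omega1\<close>.\<close>
    have "natLeq <o |S|"
    proof (rule ccontr)
      assume "\<not> natLeq <o |S|"
      then have "|S| \<le>o natLeq"
        using ordLess_or_ordLeq[OF natLeq_Well_order card_of_Well_order] by blast
      then have "|S| \<le>o |UNIV :: nat set|" by (rule ordLeq_ordIso_trans[OF _ ordIso_symmetric[OF card_of_nat]])
      then show False using S(1) unfolding card_of_ordLeq[symmetric] countable_def by blast
    qed
    then have le: "cardSuc natLeq \<le>o |S|"
      by (rule cardSuc_least[OF natLeq_Card_order card_of_Card_order])
    have "two_to_omega1 \<le>o ctwo ^c |S|"
      by (rule cexp_mono2_Cnotzero[OF le Card_order_ctwo Cinfinite_Cnotzero[OF Cinfinite_cardSuc[OF natLeq_Cinfinite]]])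
    moreover have "ctwo ^c |S| =o |Pow S|"
      unfolding cexp_def ctwo_def Field_card_of by (rule ordIso_symmetric[OF card_of_Pow_Func])
    ultimately have "two_to_omega1 \<le>o |Pow S|" by (rule ordLeq_ordIso_trans)
    then have "two_to_omega1 \<le>o |carrier G|" using S(2) by (rule ordLeq_transitive)
    then show False using small not_ordLess_ordLeq by blast
  qed
  have T: "weak chars = T" by (rule weak_eq) (use sep in auto)
  have "countable {i \<in> chars. \<not> (\<exists>a. topspace (euclidean :: complex topology) \<subseteq> {a})}"
    by (rule countable_subset[OF _ ctb]) blast
  then have "metrizable_space (power_space chars)"
    unfolding metrizable_space_product_topology using metrizable_space_euclidean by blast
  then have metK: "metrizable_space (subtopology (power_space chars) (emb chars ` carrier G))"
    by (rule metrizable_space_subtopology)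
  \<comment> \<open>As \<open>T\<close> is the topology induced by the countable set
    \<open>chars\<close>, the evaluation map embeds it into a countable power of the complex
    plane.\<close>
  have "homeomorphic_map T (subtopology (power_space chars) (emb chars ` carrier G)) (emb chars)"
  proof (rule bijective_open_imp_homeomorphic_map)
    show "continuous_map T (subtopology (power_space chars) (emb chars ` carrier G)) (emb chars)"
      using continuous_map_emb[of chars T "\<lambda>x. x"] charsD(4) by (simp add: continuous_map_in_subtopology)
    show "open_map T (subtopology (power_space chars) (emb chars ` carrier G)) (emb chars)"
      unfolding open_map_def
    proof (intro allI impI)
      fix U assume "openin T U"
      then have "openin (weak chars) U" by (simp only: T)
      then obtain W where W: "openin (power_space chars) W" "U = emb chars -` W \<inter> carrier G"
        unfolding weak_def openin_pullback_topology by blast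
      then have "emb chars ` U = W \<inter> emb chars ` carrier G" by blast
      then show "openin (subtopology (power_space chars) (emb chars ` carrier G)) (emb chars ` U)"
        using W(1) unfolding openin_subtopology by blast
    qed
    show "emb chars ` topspace T = topspace (subtopology (power_space chars) (emb chars ` carrier G))"
      by (auto simp: emb_def)
    show "inj_on (emb chars) (topspace T)"
    proof (rule inj_onI, rule ccontr)
      fix g h assume gh: "g \<in> topspace T" "h \<in> topspace T" "emb chars g = emb chars h" "g \<noteq> h"
      then have "g \<otimes>\<^bsub>G\<^esub> inv\<^bsub>G\<^esub> h \<in> carrier G" "g \<otimes>\<^bsub>G\<^esub> inv\<^bsub>G\<^esub> h \<noteq> \<one>\<^bsub>G\<^esub>" using inv_equality[of g "inv\<^bsub>G\<^esub> h"] by auto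
      then obtain c where c: "c \<in> chars" "c (g \<otimes>\<^bsub>G\<^esub> inv\<^bsub>G\<^esub> h) \<noteq> 1" using sep by blast
      have "c g = c h" using fun_cong[OF gh(3), of c] c(1) by (simp add: emb_def)
      then show False using c charsD(1,5)[OF c(1)] gh(1,2) mult_cnj[OF c(1)] by simp
    qed
  qed
  then have "metrizable_space T"
    using metK homeomorphic_map_imp_homeomorphic_space homeomorphic_metrizable_space by blast
  then show ?thesis using gt pseudocompact_metrizable_imp_compact[OF _ pc] by blast
qed

text \<open>The identity from a compact topology to a coarser Hausdorff one is a homeomorphism, and
  continuous images of compact spaces in the reals are bounded.\<close>

lemma compact_imp_minimal_pseudocompact:
  assumes gt: "group_topology G T" and comp: "compact_space T"
  shows "minimal_group_topology G T \<and> pseudocompact_space T"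
proof
  show "minimal_group_topology G T"
    unfolding minimal_group_topology_def
  proof (intro conjI allI impI gt)
    fix T' assume T': "group_topology G T' \<and> {U. openin T' U} \<subseteq> {U. openin T U}"
    have top: "topspace T' = topspace T" using T' gt unfolding group_topology_def by auto
    have "homeomorphic_map T T' (\<lambda>x. x)"
    proof (rule continuous_imp_homeomorphic_map[OF _ comp])
      have "{x \<in> topspace T. x \<in> U} = U" if "openin T' U" for U using openin_subset[OF that] top by auto
      then show "continuous_map T T' (\<lambda>x. x)" using T' top unfolding continuous_map_def by auto
      show "Hausdorff_space T'" using T' unfolding group_topology_def by blast
    qed (simp_all add: top)
    then have "open_map T T' (\<lambda>x. x)" by (simp add: homeomorphic_imp_open_map)
    then have "openin T' U" if "openin T U" for U using that unfolding open_map_def by force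
    then show "T' = T" using T' unfolding topology_eq by blast
  qed
  show "pseudocompact_space T"
    unfolding pseudocompact_space_def
  proof (intro allI impI)
    fix f :: "'a \<Rightarrow> real" assume "continuous_map T euclideanreal f"
    then have "compactin euclideanreal (f ` topspace T)"
      using comp image_compactin unfolding compact_space_def by blast
    then show "bounded (f ` topspace T)" by (simp add: compact_imp_bounded)
  qed
qed

theorem corollary2p7:
  fixes G :: "('a, 'b) monoid_scheme"
  assumes "comm_group G"
    and "|carrier G| <o two_to_omega1"
  shows "(\<exists>T. minimal_group_topology G T \<and> pseudocompact_space T) \<longleftrightarrow>
         (\<exists>T. group_topology G T \<and> compact_space T \<and> metrizable_space T)"
  using minimal_pseudocompact_imp[OF assms] compact_imp_minimal_pseudocompact by blast

end
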